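(* Let $F$ be a simple rational function of degree $m\geq 4$. Then for every $l\geq 1$, any decomposition of the iterate $F^{\circ l}$ into a composition of indecomposable rational functions is equivalent to the decomposition $F^{\circ l}=F\circ F\circ\dots\circ F$ ($l$ factors).
   Context: Rational functions are rational functions of one complex variable, viewed as holomorphic maps $\mathbb{C}\mathbb{P}^1\to\mathbb{C}\mathbb{P}^1$. A rational function $F$ of degree $m\ge 2$ is called simple if for every $z\in\mathbb{C}\mathbb{P}^1$ the preimage $F^{-1}\{z\}$ contains at least $m-1$ (distinct) points. $F^{\circ l}$ denotes the $l$-th iterate of $F$. A rational function $F$ of degree at least two is called indecomposable if $F=F_2\circ F_1$ with $F_1,F_2$ rational functions implies that at least one of $F_1,F_2$ has degree one. A decomposition of $F$ is a representation $F=F_r\circ F_{r-1}\circ\dots\circ F_1$ with $F_1,\dots,F_r$ rational functions of degree at least two. Two decompositions $F=F_r\circ\dots\circ F_1$ and $F=G_l\circ\dots\circ G_1$ are called equivalent if $l=r$ and either $r=1$ and $F_1=G_1$, or $r\ge 2$ and there exist Möbius transformations $\mu_i$, $1\le i\le r-1$, such that $F_r=G_r\circ\mu_{r-1}$, $F_i=\mu_i^{-1}\circ G_i\circ\mu_{i-1}$ for $1<i<r$, and $F_1=\mu_1^{-1}\circ G_1$. *)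

theory Defs
  imports Complex_Main "HOL-Computational_Algebra.Computational_Algebra"
    "HOL-Computational_Algebra.Field_as_Ring"
begin

text \<open>The sphere \<open>\<complex>\<P>\<^sup>1\<close> is \<open>complex option\<close>, with \<^term>\<open>None\<close> as the point at infinity
  (as in the library's Alexandroff compactification).\<close>

type_synonym sphere = "complex option"

text \<open>The map given by \<open>p / q\<close>, for coprime \<open>p\<close> and \<open>q\<close>. At infinity only the coefficients of the
  formal degree \<open>max (degree p) (degree q)\<close> matter; they are not both zero.\<close>

definition quot_map :: "complex poly \<Rightarrow> complex poly \<Rightarrow> sphere \<Rightarrow> sphere" where
  "quot_map p q w =
    (case w of
       Some z \<Rightarrow> if poly q z = 0 then None else Some (poly p z / poly q z)
     | None \<Rightarrow>
        (let n = max (degree p) (degree q)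
         in if coeff q n = 0 then None else Some (coeff p n / coeff q n)))"

definition rational_function :: "(sphere \<Rightarrow> sphere) \<Rightarrow> bool" where
  "rational_function F \<longleftrightarrow> (\<exists>p q. coprime p q \<and> q \<noteq> 0 \<and> F = quot_map p q)"

definition rat_degree :: "(sphere \<Rightarrow> sphere) \<Rightarrow> nat" where
  "rat_degree F =
    (THE n. \<exists>p q. coprime p q \<and> q \<noteq> 0 \<and> F = quot_map p q \<and> n = max (degree p) (degree q))"

lemma quot_map_eq_imp_cross_eq:
  assumes "q \<noteq> 0" "q' \<noteq> 0" "quot_map p q = quot_map p' q'"
  shows "p * q' = p' * q"
proof -
  have "poly ((p * q' - p' * q) * q) z = 0" for z
    using fun_cong[OF assms(3), of "Some z"]
    by (auto simp: quot_map_def field_simps split: if_splits)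
  then have "(p * q' - p' * q) * q = 0"
    by (simp only: poly_all_0_iff_0[symmetric]) simp
  with assms show ?thesis by simp
qed

lemma rat_degree_quot_map:
  assumes "coprime p q" "q \<noteq> 0"
  shows "rat_degree (quot_map p q) = max (degree p) (degree q)"
proof -
  have "max (degree p') (degree q') = max (degree p) (degree q)"
    if "coprime p' q'" "q' \<noteq> 0" "quot_map p q = quot_map p' q'" for p' q'
  proof -
    have eq: "p * q' = p' * q"
      using quot_map_eq_imp_cross_eq assms that by blast
    have "q dvd p * q'" "q' dvd p' * q" "p dvd p' * q" "p' dvd p * q'"
      using eq dvd_triv_left[of p q'] dvd_triv_left[of p' q]
        dvd_triv_right[of q' p] dvd_triv_right[of q p'] by simp_all
    moreover have "coprime q p" "coprime q' p'"
      using assms(1) that(1) by (simp_all only: coprime_commute)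
    ultimately have dvds: "q dvd q'" "q' dvd q" "p dvd p'" "p' dvd p"
      using assms(1) that(1)
      by (simp_all only: coprime_dvd_mult_left_iff coprime_dvd_mult_right_iff)
    then have "degree q' = degree q"
      using assms(2) that(2) by (simp add: dvd_imp_degree_le le_antisym)
    moreover have "degree p' = degree p"
      using dvds by (cases "p = 0 \<or> p' = 0") (auto simp: dvd_imp_degree_le le_antisym)
    ultimately show ?thesis by simp
  qed
  note unique = this
  show ?thesis
    unfolding rat_degree_def
  proof (rule the_equality)
    show "\<exists>p' q'. coprime p' q' \<and> q' \<noteq> 0 \<and> quot_map p q = quot_map p' q' \<and>
            max (degree p) (degree q) = max (degree p') (degree q')"
      using assms by blast
  qed (use unique in blast)
qed

text \<open>Fibres of a rational function of positive degree are finite, so \<^const>\<open>card\<close> does count their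
  points.\<close>

definition simple_rational :: "(sphere \<Rightarrow> sphere) \<Rightarrow> bool" where
  "simple_rational F \<longleftrightarrow>
    rational_function F \<and> 2 \<le> rat_degree F \<and> (\<forall>w. rat_degree F - 1 \<le> card (F -` {w}))"

definition indecomposable :: "(sphere \<Rightarrow> sphere) \<Rightarrow> bool" where
  "indecomposable F \<longleftrightarrow>
    rational_function F \<and> 2 \<le> rat_degree F \<and>
    (\<forall>F1 F2. rational_function F1 \<and> rational_function F2 \<and> F = F2 \<circ> F1
       \<longrightarrow> rat_degree F1 = 1 \<or> rat_degree F2 = 1)"

definition moebius :: "(sphere \<Rightarrow> sphere) \<Rightarrow> bool" where
  "moebius \<mu> \<longleftrightarrow> (\<exists>a b c d. a * d - b * c \<noteq> 0 \<and> \<mu> = quot_map [:b, a:] [:d, c:])"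

text \<open>A decomposition \<open>F\<^sub>r \<circ> \<dots> \<circ> F\<^sub>1\<close> is the list \<open>[F\<^sub>1, \<dots>, F\<^sub>r]\<close>: innermost factor first, so
  \<open>F\<^sub>i\<close> is the list entry with index \<open>i - 1\<close>.\<close>

definition decomposition :: "(sphere \<Rightarrow> sphere) \<Rightarrow> (sphere \<Rightarrow> sphere) list \<Rightarrow> bool" where
  "decomposition F Fs \<longleftrightarrow>
    Fs \<noteq> [] \<and> (\<forall>G\<in>set Fs. rational_function G \<and> 2 \<le> rat_degree G) \<and> F = fold (\<circ>) Fs id"

definition equivalent_decompositions ::
  "(sphere \<Rightarrow> sphere) \<Rightarrow> (sphere \<Rightarrow> sphere) list \<Rightarrow> (sphere \<Rightarrow> sphere) list \<Rightarrow> bool" where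
  "equivalent_decompositions F Fs Gs \<longleftrightarrow>
    decomposition F Fs \<and> decomposition F Gs \<and> length Gs = length Fs \<and>
    (let r = length Fs in
       r = 1 \<and> Fs ! 0 = Gs ! 0 \<or>
       r \<ge> 2 \<and>
       (\<exists>\<mu> :: nat \<Rightarrow> sphere \<Rightarrow> sphere.
          (\<forall>i\<in>{1..r - 1}. moebius (\<mu> i)) \<and>
          Fs ! (r - 1) = Gs ! (r - 1) \<circ> \<mu> (r - 1) \<and>
          (\<forall>i. 1 < i \<and> i < r \<longrightarrow> Fs ! (i - 1) = inv (\<mu> i) \<circ> Gs ! (i - 1) \<circ> \<mu> (i - 1)) \<and>
          Fs ! 0 = inv (\<mu> 1) \<circ> Gs ! 0))"

end

theory Submission imports Defs begin

text \<open>
  Everything follows from one statement: if \<open>F\<close> is simple of degree \<open>m \<ge> 4\<close>, \<open>deg G \<ge> 2\<close> and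
  \<open>F \<circ> X = G \<circ> Y\<close>, then \<open>X = R \<circ> Y\<close> and \<open>G = F \<circ> R\<close> for some rational \<open>R\<close>; factors are then
  stripped from the left of \<open>F\<close> iterated. By Lueroth's theorem one may cancel a common right factor
  of \<open>X\<close> and \<open>Y\<close>, so that \<open>(X, Y)\<close> is generically injective; the claim becomes \<open>k = deg Y = 1\<close>.

  Let \<open>n = deg G\<close>, \<open>j = deg X\<close>, so \<open>m j = n k\<close>. Let \<open>y\<close> have multiplicity \<open>b \<ge> 2\<close> under \<open>G\<close>. As \<open>F\<close> has
  at most one double point \<open>u\<close> over \<open>G y\<close>, every point over \<open>y\<close> not mapped to \<open>u\<close> by \<open>X\<close> has
  multiplicity at least \<open>b\<close> under \<open>X\<close>. If \<open>r\<close> of the \<open>k\<close> points over \<open>y\<close> go to \<open>u\<close>, the Riemann-Hurwitz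
  formulas for \<open>X\<close> and \<open>G\<close> give \<open>\<Sum> (b - 1) (k - r) \<le> 2 j - 2\<close> and \<open>\<Sum> (b - 1) = 2 n - 2\<close>. Generic
  injectivity forces \<open>r \<le> 2\<close>, which is a contradiction for \<open>k \<ge> 3\<close>. For \<open>k = 2\<close> let \<open>\<sigma>\<close> be the involution
  of \<open>Y\<close>: the equation \<open>X = X \<circ> \<sigma>\<close> has at most \<open>2 j\<close> solutions with multiplicity, but the points
  over the \<open>y\<close> with \<open>r = 2\<close> provide more.
\<close>

section \<open>Homogenisation and composition\<close>

text \<open>The bound \<open>m \<ge> 4\<close> acts through \<open>4 j \<le> m j = n k\<close>. For
  \<open>k \<ge> 3\<close> this contradicts \<open>(2 n - 2) (k - 2) \<le> 2 j - 2\<close>; for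
  \<open>k = 2\<close> it gives \<open>2 j \<le> n\<close>. Why \<open>r \<le> 2\<close>: count the
  \<open>r\<close> points \<open>v\<close> with their multiplicities under \<open>Y\<close>.
  Comparing multiplicities of \<open>F \<circ> X = G \<circ> Y\<close> at \<open>v\<close>, with
  \<open>F\<close> of multiplicity at most two at \<open>u\<close>, gives
  \<open>b r \<le> 2 S\<close>, where \<open>S\<close> is the sum of the multiplicities of these
  points under \<open>X\<close>. Moreover \<open>S \<le> b\<close>: for \<open>x\<close> near
  \<open>u\<close> the points over \<open>x\<close> have distinct images under \<open>Y\<close>, all
  of them solutions of \<open>G y' = F x\<close>, and \<open>S\<close> of these solutions merge at
  \<open>y\<close> as \<open>x\<close> tends to \<open>u\<close>. The obstacle is the point at
  infinity. Multiplicities are orders of zeros of polynomials, which see finite points only, and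
  Riemann-Hurwitz becomes a statement on the degree of a Wronskian. For \<open>X\<close> an upper
  bound suffices, but for \<open>G\<close> the count must be exact, which holds once infinity is in
  general position; Moebius changes of coordinates achieve this.\<close>

lemma poly_eq_if_infinite:
  fixes p q :: "'a :: idom poly"
  assumes "infinite {z. poly p z = poly q z}"
  shows "p = q"
proof (rule ccontr)
  assume "p \<noteq> q"
  then have "finite {z. poly (p - q) z = 0}" by (intro poly_roots_finite) simp
  with assms show False by simp
qed

lemma no_common_root:
  fixes p q :: "complex poly"
  assumes "coprime p q" "poly p z = 0"
  shows "poly q z \<noteq> 0"
proof
  assume "poly q z = 0"
  then have "[:- z, 1:] dvd p" "[:- z, 1:] dvd q"
    using assms(2) by (simp_all add: poly_eq_0_iff_dvd)
  with assms(1) have "is_unit [:- z, 1:]" using coprime_common_divisor by blast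
  then show False by (simp add: is_unit_iff_degree)
qed

lemma coprime_if_no_common_root:
  fixes p q :: "complex poly"
  assumes "\<And>z. poly p z = 0 \<Longrightarrow> poly q z = 0 \<Longrightarrow> False"
  shows "coprime p q"
proof (rule coprimeI)
  fix c assume c: "c dvd p" "c dvd q"
  have nz: "poly c z \<noteq> 0" for z
    using c assms[of z] by (auto elim!: dvdE)
  have "constant (poly c)"
    using fundamental_theorem_of_algebra[of c] nz by blast
  then have "degree c = 0" by (simp add: constant_degree)
  moreover have "c \<noteq> 0" using nz by auto
  ultimately show "is_unit c" using is_unit_iff_degree by blast
qed

text \<open>The binary form of degree \<open>d\<close> attached to \<open>f\<close>. As
  \<open>d\<close> is only a formal degree, the form vanishes at \<open>(1, 0)\<close> when
  \<open>degree f < d\<close>; this lets infinity be treated like any other point.\<close>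

definition hval :: "nat \<Rightarrow> complex poly \<Rightarrow> complex \<Rightarrow> complex \<Rightarrow> complex" where
  "hval d f s t = (\<Sum>i\<le>d. coeff f i * s ^ i * t ^ (d - i))"

lemma hval_nonzero:
  assumes "degree f \<le> d" "t \<noteq> 0"
  shows "hval d f s t = t ^ d * poly f (s / t)"
proof -
  have "poly f (s / t) = (\<Sum>i\<le>d. coeff f i * (s / t) ^ i)"
    unfolding poly_altdef using assms(1)
    by (intro sum.mono_neutral_left) (auto simp: coeff_eq_0)
  also have "t ^ d * \<dots> = (\<Sum>i\<le>d. coeff f i * s ^ i * t ^ (d - i))"
    unfolding sum_distrib_left
    by (intro sum.cong) (use assms(2) in \<open>auto simp: field_simps power_diff\<close>)
  finally show ?thesis by (simp add: hval_def)
qed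

lemma hval_zero: "hval d f s 0 = coeff f d * s ^ d"
proof -
  have "hval d f s 0 = (\<Sum>i\<in>{d}. coeff f i * s ^ i * 0 ^ (d - i))"
    unfolding hval_def by (intro sum.mono_neutral_right) (auto simp: power_0_left)
  then show ?thesis by simp
qed

text \<open>This is \<open>b ^ d * f (a / b)\<close>, written so that it makes sense where
  \<open>b\<close> vanishes.\<close>

definition homog :: "nat \<Rightarrow> complex poly \<Rightarrow> complex poly \<Rightarrow> complex poly \<Rightarrow> complex poly" where
  "homog d f a b = (\<Sum>i\<le>d. smult (coeff f i) (a ^ i * b ^ (d - i)))"

lemma poly_homog: "poly (homog d f a b) z = hval d f (poly a z) (poly b z)"
  by (simp add: homog_def hval_def poly_sum mult.assoc)

lemma poly_homog_nonzero:
  assumes "degree f \<le> d" "poly b z \<noteq> 0"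
  shows "poly (homog d f a b) z = poly b z ^ d * poly f (poly a z / poly b z)"
  using assms by (simp add: poly_homog hval_nonzero)

lemma infinite_nonroots:
  fixes b :: "'a :: {idom, ring_char_0} poly"
  assumes "b \<noteq> 0"
  shows "infinite {z. poly b z \<noteq> 0}"
proof
  assume "finite {z. poly b z \<noteq> 0}"
  then have "finite ({z. poly b z \<noteq> 0} \<union> {z. poly b z = 0})"
    using poly_roots_finite[OF assms] by simp
  moreover have "{z. poly b z \<noteq> 0} \<union> {z. poly b z = 0} = UNIV" by auto
  ultimately show False by (simp add: infinite_UNIV_char_0)
qed

lemma homog_mult:
  assumes "b \<noteq> 0" "degree f \<le> d" "degree g \<le> e"
  shows "homog (d + e) (f * g) a b = homog d f a b * homog e g a b"
proof (rule poly_eq_if_infinite)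
  have "degree (f * g) \<le> d + e"
    using assms degree_mult_le[of f g] by linarith
  then have "{z. poly b z \<noteq> 0} \<subseteq>
      {z. poly (homog (d + e) (f * g) a b) z = poly (homog d f a b * homog e g a b) z}"
    using assms by (auto simp: poly_homog_nonzero power_add)
  then show "infinite \<dots>" using infinite_nonroots[OF assms(1)] finite_subset by blast
qed

lemma homog_linear: "homog 1 [:c, 1:] a b = a + smult c b"
  by (simp add: homog_def)

lemma homog_linear_power:
  assumes "b \<noteq> 0"
  shows "homog d ([:c, 1:] ^ d) a b = (a + smult c b) ^ d"
proof (induction d)
  case 0
  then show ?case by (simp add: homog_def)
next
  case (Suc d)
  have "homog (1 + d) ([:c, 1:] * [:c, 1:] ^ d) a b = homog 1 [:c, 1:] a b * homog d ([:c, 1:] ^ d) a b"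
    using assms by (intro homog_mult) (auto simp: degree_power_eq)
  then show ?case unfolding homog_linear using Suc by simp
qed

lemma order_power: "(p :: 'a :: idom poly) \<noteq> 0 \<Longrightarrow> order z (p ^ n) = n * order z p"
  by (induction n) (auto simp: order_mult)

text \<open>The chain rule for multiplicities. With \<open>x\<close> the value of
  \<open>a / b\<close> at \<open>z\<close>, a factor \<open>[:- x, 1:] ^ e\<close> of
  \<open>f\<close> becomes \<open>(a - smult x b) ^ e\<close>, and the cofactor stays nonzero at
  \<open>z\<close>.\<close>

lemma order_homog:
  assumes "poly b z \<noteq> 0" "f \<noteq> 0" "degree f \<le> d" "a - smult (poly a z / poly b z) b \<noteq> 0"
  shows "order z (homog d f a b) =
    order (poly a z / poly b z) f * order z (a - smult (poly a z / poly b z) b)"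
proof -
  define x where "x = poly a z / poly b z"
  define e where "e = order x f"
  obtain g where g: "f = [:- x, 1:] ^ e * g" "\<not> [:- x, 1:] dvd g"
    using order_decomp[OF assms(2)] e_def by blast
  have b0: "b \<noteq> 0" using assms(1) by auto
  have "e \<le> degree f" using assms(2) e_def order_degree by blast
  then have ed: "e \<le> d" using assms(3) by simp
  have g0: "g \<noteq> 0" using g assms(2) by auto
  have "degree f = e + degree g"
    unfolding g(1) using g0 by (subst degree_mult_eq) (auto simp: degree_power_eq)
  then have dg: "degree g \<le> d - e" using assms(3) by simp
  have "homog (e + (d - e)) ([:- x, 1:] ^ e * g) a b = homog e ([:- x, 1:] ^ e) a b * homog (d - e) g a b"
    using b0 dg by (intro homog_mult) (auto simp: degree_power_eq)
  then have eq: "homog d f a b = (a - smult x b) ^ e * homog (d - e) g a b"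
    using ed b0 g(1) by (simp add: homog_linear_power)
  have "poly g x \<noteq> 0" using g(2) by (simp add: poly_eq_0_iff_dvd)
  then have nz: "poly (homog (d - e) g a b) z \<noteq> 0"
    using dg assms(1) by (simp add: poly_homog_nonzero x_def)
  then have "homog (d - e) g a b \<noteq> 0" "order z (homog (d - e) g a b) = 0"
    by (auto simp: order_0I)
  then show ?thesis
    using assms(4) unfolding eq x_def[symmetric] e_def[symmetric]
    by (simp add: order_mult order_power)
qed

lemma coeff_mult_top:
  fixes p q :: "'a :: comm_semiring_0 poly"
  assumes "degree p \<le> m" "degree q \<le> n"
  shows "coeff (p * q) (m + n) = coeff p m * coeff q n"
proof (cases "degree p = m \<and> degree q = n")
  case True
  then show ?thesis using coeff_mult_degree_sum[of p q] by auto
next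
  case False
  then have "degree p < m \<or> degree q < n" using assms by linarith
  then have "coeff p m * coeff q n = 0" by (auto simp: coeff_eq_0)
  moreover have "degree (p * q) < m + n"
    using False assms degree_mult_le[of p q] by linarith
  ultimately show ?thesis by (simp add: coeff_eq_0)
qed

lemma coeff_power_top:
  fixes a :: "'a :: comm_semiring_1 poly"
  assumes "degree a \<le> j"
  shows "degree (a ^ i) \<le> i * j \<and> coeff (a ^ i) (i * j) = coeff a j ^ i"
proof (induction i)
  case (Suc i)
  have "degree (a * a ^ i) \<le> j + i * j"
    using Suc assms degree_mult_le[of a "a ^ i"] by linarith
  moreover have "coeff (a * a ^ i) (j + i * j) = coeff a j * coeff (a ^ i) (i * j)"
    using Suc assms by (intro coeff_mult_top) auto
  ultimately show ?case using Suc by simp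
qed simp

lemma degree_homog_le:
  assumes "degree a \<le> j" "degree b \<le> j"
  shows "degree (homog d f a b) \<le> d * j"
proof -
  have "degree (smult (coeff f i) (a ^ i * b ^ (d - i))) \<le> d * j" if "i \<le> d" for i
  proof -
    have "degree (a ^ i * b ^ (d - i)) \<le> i * j + (d - i) * j"
      using coeff_power_top[OF assms(1), of i] coeff_power_top[OF assms(2), of "d - i"]
        degree_mult_le[of "a ^ i" "b ^ (d - i)"] by linarith
    also have "\<dots> = d * j" using that by (metis add_mult_distrib le_add_diff_inverse)
    finally show ?thesis using degree_smult_le le_trans by blast
  qed
  then show ?thesis unfolding homog_def by (intro degree_sum_le) auto
qed

text \<open>The coefficient of the formal degree represents the value at infinity, so a composition
  can be evaluated at infinity in the same way as at finite points.\<close>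

lemma coeff_homog_top:
  assumes "degree a \<le> j" "degree b \<le> j"
  shows "coeff (homog d f a b) (d * j) = hval d f (coeff a j) (coeff b j)"
proof -
  have "coeff (a ^ i * b ^ (d - i)) (d * j) = coeff a j ^ i * coeff b j ^ (d - i)" if "i \<le> d" for i
  proof -
    have "d * j = i * j + (d - i) * j" using that by (metis add_mult_distrib le_add_diff_inverse)
    then show ?thesis
      using coeff_mult_top[of "a ^ i" "i * j" "b ^ (d - i)" "(d - i) * j"]
        coeff_power_top[OF assms(1), of i] coeff_power_top[OF assms(2), of "d - i"] by simp
  qed
  then show ?thesis by (simp add: homog_def hval_def coeff_sum mult.assoc)
qed

text \<open>The degree is a parameter because it serves as the formal degree for homogenisation, and
  this avoids the definite description in \<open>rat_degree\<close>. Constants are included, with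
  \<open>d = 0\<close>.\<close>

definition reduced :: "complex poly \<Rightarrow> complex poly \<Rightarrow> nat \<Rightarrow> bool" where
  "reduced p q d \<longleftrightarrow> coprime p q \<and> q \<noteq> 0 \<and> max (degree p) (degree q) = d"

lemma reducedD:
  assumes "reduced p q d"
  shows "coprime p q" "q \<noteq> 0" "degree p \<le> d" "degree q \<le> d"
  using assms by (auto simp: reduced_def)

lemma reduced_no_common_root: "reduced p q d \<Longrightarrow> poly p z = 0 \<Longrightarrow> poly q z \<noteq> 0"
  using no_common_root reducedD(1) by blast

lemma reduced_top_coeff:
  assumes "reduced p q d"
  shows "coeff p d \<noteq> 0 \<or> coeff q d \<noteq> 0"
proof (cases "degree q = d")
  case True
  then show ?thesis using reducedD(2)[OF assms] by auto
next
  case False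
  then have "degree p = d" "degree q < d" using assms by (auto simp: reduced_def max_def split: if_splits)
  then show ?thesis by (cases "p = 0") auto
qed

lemma reduced_hval_not_both:
  assumes "reduced p q d" "s \<noteq> 0 \<or> t \<noteq> 0" "hval d p s t = 0" "hval d q s t = 0"
  shows False
proof (cases "t = 0")
  case True
  then show False using assms reduced_top_coeff[OF assms(1)] by (auto simp: hval_zero)
next
  case False
  then have "poly p (s / t) = 0" "poly q (s / t) = 0"
    using assms reducedD[OF assms(1)] by (simp_all add: hval_nonzero)
  then show False using reduced_no_common_root[OF assms(1)] by blast
qed

text \<open>The point with homogeneous coordinates \<open>s\<close> and \<open>t\<close>; for
  \<open>s = t = 0\<close> the value \<open>None\<close> is a dummy.\<close>

definition proj_pt :: "complex \<Rightarrow> complex \<Rightarrow> sphere" where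
  "proj_pt s t = (if t = 0 then None else Some (s / t))"

lemma quot_map_Some: "quot_map p q (Some z) = proj_pt (poly p z) (poly q z)"
  by (simp add: quot_map_def proj_pt_def)

lemma quot_map_None: "reduced p q d \<Longrightarrow> quot_map p q None = proj_pt (coeff p d) (coeff q d)"
  by (auto simp: quot_map_def proj_pt_def reduced_def Let_def)

lemma quot_map_proj_pt:
  assumes "reduced p q d" "s \<noteq> 0 \<or> t \<noteq> 0"
  shows "quot_map p q (proj_pt s t) = proj_pt (hval d p s t) (hval d q s t)"
proof (cases "t = 0")
  case True
  then show ?thesis using assms
    by (auto simp: proj_pt_def quot_map_None[OF assms(1)] hval_zero)
next
  case False
  then show ?thesis using reducedD[OF assms(1)]
    by (simp add: proj_pt_def[of s t] quot_map_Some hval_nonzero) (simp add: proj_pt_def)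
qed

text \<open>The forms of \<open>p\<close> and \<open>q\<close> have no common zero on the projective
  line, and \<open>a\<close>, \<open>b\<close> never vanish together, not even at infinity. Hence
  the homogenisations have no common zero and one of them attains degree
  \<open>d * j\<close>.\<close>

lemma reduced_comp:
  assumes F: "reduced p q d" and X: "reduced a b j" and j: "j \<ge> 1"
  shows "reduced (homog d p a b) (homog d q a b) (d * j)"
    and "quot_map (homog d p a b) (homog d q a b) = quot_map p q \<circ> quot_map a b"
proof -
  have nb: "poly a z \<noteq> 0 \<or> poly b z \<noteq> 0" for z using reduced_no_common_root[OF X] by blast
  note nbt = reduced_top_coeff[OF X]
  note dX = reducedD(3,4)[OF X]
  have cop: "coprime (homog d p a b) (homog d q a b)"
    by (rule coprime_if_no_common_root) (use reduced_hval_not_both[OF F nb] in \<open>auto simp: poly_homog\<close>)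
  have top: "coeff (homog d p a b) (d * j) \<noteq> 0 \<or> coeff (homog d q a b) (d * j) \<noteq> 0"
    using reduced_hval_not_both[OF F nbt] by (auto simp: coeff_homog_top[OF dX])
  have deg: "max (degree (homog d p a b)) (degree (homog d q a b)) = d * j"
    using top degree_homog_le[OF dX] le_degree by (metis le_antisym max.absorb1 max.absorb2)
  \<comment> \<open>Here \<open>j \<ge> 1\<close> matters: a constant \<open>a / b\<close> could be
    a pole of \<open>p / q\<close>, and the constant infinity is not a \<open>quot_map\<close> with
    nonzero denominator.\<close>
  have "homog d q a b \<noteq> 0"
  proof (cases "d = 0")
    case True
    then show ?thesis using top F by (auto simp: homog_def reduced_def dest!: degree_0_id)
  next
    case False
    show ?thesis
    proof
      assume q0: "homog d q a b = 0"
      then have "is_unit (homog d p a b)" using cop by simp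
      then have "degree (homog d p a b) = 0" using is_unit_iff_degree by (metis not_is_unit_0)
      then show False using deg q0 False j by simp
    qed
  qed
  then show red: "reduced (homog d p a b) (homog d q a b) (d * j)"
    using cop deg by (simp add: reduced_def)
  show "quot_map (homog d p a b) (homog d q a b) = quot_map p q \<circ> quot_map a b"
  proof
    fix w
    show "quot_map (homog d p a b) (homog d q a b) w = (quot_map p q \<circ> quot_map a b) w"
    proof (cases w)
      case None
      then show ?thesis
        by (simp add: quot_map_None[OF red] quot_map_None[OF X] quot_map_proj_pt[OF F nbt] coeff_homog_top[OF dX])
    next
      case (Some z)
      then show ?thesis
        by (simp add: quot_map_Some quot_map_proj_pt[OF F nb] poly_homog)
    qed
  qed
qed

lemma rational_function_iff: "rational_function F \<longleftrightarrow> (\<exists>p q d. reduced p q d \<and> F = quot_map p q)"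
  by (auto simp: rational_function_def reduced_def)

lemma rat_degree_reduced: "reduced p q d \<Longrightarrow> rat_degree (quot_map p q) = d"
  using rat_degree_quot_map by (auto simp: reduced_def)

lemma rational_functionE:
  assumes "rational_function F"
  obtains p q where "reduced p q (rat_degree F)" "F = quot_map p q"
  using assms rat_degree_reduced unfolding rational_function_iff by metis

lemma rational_function_comp:
  assumes "rational_function F" "rational_function X" "rat_degree X \<ge> 1"
  shows "rational_function (F \<circ> X)" "rat_degree (F \<circ> X) = rat_degree F * rat_degree X"
proof -
  obtain p q where F: "reduced p q (rat_degree F)" "F = quot_map p q"
    using assms(1) by (rule rational_functionE)
  obtain a b where X: "reduced a b (rat_degree X)" "X = quot_map a b"
    using assms(2) by (rule rational_functionE)
  note c = reduced_comp[OF F(1) X(1) assms(3)]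
  have "F \<circ> X = quot_map (homog (rat_degree F) p a b) (homog (rat_degree F) q a b)"
    using c(2) F(2) X(2) by simp
  then show "rational_function (F \<circ> X)" "rat_degree (F \<circ> X) = rat_degree F * rat_degree X"
    using c(1) rational_function_iff rat_degree_reduced by metis+
qed

lemma rational_eqI:
  assumes "reduced p q d" "reduced p' q' d'"
    and "infinite {z. quot_map p q (Some z) = quot_map p' q' (Some z)}"
  shows "quot_map p q = quot_map p' q'"
proof -
  have "{z. quot_map p q (Some z) = quot_map p' q' (Some z)} \<subseteq> {z. poly (p * q') z = poly (p' * q) z}"
    by (auto simp: quot_map_def field_simps split: if_splits)
  then have "p * q' = p' * q" using assms(3) poly_eq_if_infinite finite_subset by blast
  then have e: "poly p z * poly q' z = poly p' z * poly q z" for z by (metis poly_mult)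
  have "quot_map p q (Some z) = quot_map p' q' (Some z)" for z
    using e[of z] reduced_no_common_root[OF assms(1), of z] reduced_no_common_root[OF assms(2), of z]
    by (auto simp: quot_map_def field_simps)
  moreover have "quot_map p q None = quot_map p' q' None"
  proof -
    have d: "d = d'"
    proof -
      have "q dvd p * q'" "q' dvd p' * q" "p dvd p' * q" "p' dvd p * q'"
        using \<open>p * q' = p' * q\<close> dvd_triv_left[of p q'] dvd_triv_left[of p' q]
          dvd_triv_right[of q' p] dvd_triv_right[of q p'] by simp_all
      then have "q dvd q'" "q' dvd q" "p dvd p'" "p' dvd p"
        using reducedD(1)[OF assms(1)] reducedD(1)[OF assms(2)]
        by (simp_all add: coprime_dvd_mult_left_iff coprime_dvd_mult_right_iff coprime_commute)
      then have "degree q' = degree q" "degree p' = degree p"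
        using reducedD(2)[OF assms(1)] reducedD(2)[OF assms(2)]
        by (simp_all add: dvd_imp_degree_le le_antisym)
          (metis dvd_0_left dvd_imp_degree_le le_antisym)
      then show ?thesis using assms by (simp add: reduced_def)
    qed
    have "coeff p d * coeff q' d = coeff p' d * coeff q d"
      using \<open>p * q' = p' * q\<close> coeff_mult_top[of p d q' d] coeff_mult_top[of p' d q d]
        reducedD[OF assms(1)] reducedD[OF assms(2)] d by simp
    then show ?thesis
      using reduced_top_coeff[OF assms(1)] reduced_top_coeff[OF assms(2)] d
      by (simp add: quot_map_None[OF assms(1)] quot_map_None[OF assms(2)] proj_pt_def)
        (auto simp: field_simps)
  qed
  ultimately show ?thesis by (metis not_Some_eq ext)
qed

section \<open>Fibres, ramification and Moebius maps\<close>

lemma sum_order_complex: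
  fixes f :: "complex poly"
  assumes "f \<noteq> 0"
  shows "(\<Sum>z | poly f z = 0. order z f) = degree f"
proof -
  have "degree f = (\<Sum>z\<in>set_mset (proots f). count (proots f) z)"
    by (simp only: size_proots_complex[symmetric] size_multiset_overloaded_eq)
  then show ?thesis using assms by simp
qed

text \<open>Throughout, \<open>a - smult x b\<close> stands for the fibre over \<open>x\<close>: its
  roots are the finite points of the fibre, their orders are the multiplicities, and its degree
  drops below \<open>j\<close> exactly when infinity lies over \<open>x\<close>.\<close>

lemma fib_nonzero:
  assumes "reduced a b j" "j \<ge> 1"
  shows "a - smult x b \<noteq> 0"
proof
  assume "a - smult x b = 0"
  then have a: "a = smult x b" by simp
  then have "b dvd a" by (simp add: dvd_smult)
  then have "is_unit b" using coprime_common_divisor[OF reducedD(1)[OF assms(1)]] by simp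
  then have "degree b = 0" using is_unit_iff_degree[OF reducedD(2)[OF assms(1)]] by blast
  then have "degree a = 0" using a by simp
  with \<open>degree b = 0\<close> assms show False by (simp add: reduced_def)
qed

lemma fib_root:
  assumes "reduced a b j" "poly (a - smult x b) z = 0"
  shows "poly b z \<noteq> 0" "poly a z / poly b z = x"
proof -
  show "poly b z \<noteq> 0" using assms(2) reduced_no_common_root[OF assms(1), of z] by auto
  then show "poly a z / poly b z = x" using assms(2) by (auto simp: field_simps)
qed

lemma quot_map_Some_eq_Some_iff:
  assumes "reduced a b j"
  shows "quot_map a b (Some z) = Some x \<longleftrightarrow> poly (a - smult x b) z = 0"
  using reduced_no_common_root[OF assms, of z] by (auto simp: quot_map_def field_simps)

lemma quot_map_None_eq_Some_iff:
  assumes "reduced a b j"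
  shows "quot_map a b None = Some x \<longleftrightarrow> coeff (a - smult x b) j = 0"
  using reduced_top_coeff[OF assms]
  by (auto simp: quot_map_None[OF assms] proj_pt_def field_simps)

lemma degree_fib_le: "reduced a b j \<Longrightarrow> degree (a - smult x b) \<le> j"
  using reducedD(3,4) by (metis degree_diff_le degree_smult_le le_trans)

lemma degree_fib:
  assumes "reduced a b j" "quot_map a b None \<noteq> Some x"
  shows "degree (a - smult x b) = j"
  using assms degree_fib_le[OF assms(1)] quot_map_None_eq_Some_iff[OF assms(1)]
  by (simp add: le_antisym le_degree)

text \<open>The numerator of the derivative of \<open>a / b\<close>; its zeros are the finite
  ramification points.\<close>

definition wronskian :: "complex poly \<Rightarrow> complex poly \<Rightarrow> complex poly" where
  "wronskian a b = pderiv a * b - a * pderiv b"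

lemma wronskian_fib: "wronskian (a - smult x b) b = wronskian a b"
  by (simp add: wronskian_def pderiv_diff pderiv_smult algebra_simps)

text \<open>The coefficient of degree \<open>2 * j - 1\<close> cancels, since both products
  contribute \<open>j\<close> times the product of the top coefficients. This is the Riemann-Hurwitz
  bound.\<close>

lemma degree_wronskian_le:
  assumes "degree a \<le> j" "degree b \<le> j" "j \<ge> 1"
  shows "degree (wronskian a b) \<le> 2 * j - 2"
proof (rule degree_le, intro allI impI)
  fix i assume i: "2 * j - 2 < i"
  have da: "degree (pderiv a) \<le> j - 1" "degree (pderiv b) \<le> j - 1"
    using assms by (auto simp: degree_pderiv)
  show "coeff (wronskian a b) i = 0"
  proof (cases "i = j - 1 + j")
    case True
    have "coeff (pderiv a * b) i = coeff (pderiv a) (j - 1) * coeff b j"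
      unfolding True by (rule coeff_mult_top[OF da(1) assms(2)])
    moreover have "coeff (a * pderiv b) i = coeff a j * coeff (pderiv b) (j - 1)"
      using coeff_mult_top[OF assms(1) da(2)] True by (simp add: add.commute)
    ultimately show ?thesis using assms(3) by (simp add: wronskian_def coeff_pderiv)
  next
    case False
    then have "degree (pderiv a * b) < i" "degree (a * pderiv b) < i"
      using i da assms degree_mult_le[of "pderiv a" b] degree_mult_le[of a "pderiv b"] by linarith+
    then show ?thesis by (simp add: wronskian_def coeff_eq_0)
  qed
qed

text \<open>If it vanished, coprimality would make \<open>b\<close> divide its own derivative, so
  \<open>b\<close> and then \<open>a\<close> would be constant.\<close>

lemma wronskian_nonzero:
  assumes "reduced a b j" "j \<ge> 1"
  shows "wronskian a b \<noteq> 0"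
proof
  assume "wronskian a b = 0"
  then have eq: "pderiv a * b = a * pderiv b" by (simp add: wronskian_def)
  then have "b dvd a * pderiv b" by (metis dvd_triv_right)
  then have "b dvd pderiv b"
    using reducedD(1)[OF assms(1)] by (simp add: coprime_dvd_mult_right_iff coprime_commute)
  then have "pderiv b = 0"
    by (metis degree_pderiv diff_less dvd_imp_degree_le less_one not_le pderiv_eq_0_iff gr0I)
  moreover from this eq reducedD(2)[OF assms(1)] have "pderiv a = 0" by simp
  ultimately have "degree a = 0" "degree b = 0" by (simp_all add: pderiv_eq_0_iff)
  then show False using assms by (simp add: reduced_def)
qed

text \<open>Replacing \<open>a\<close> by \<open>f = a - smult x b\<close> does not change the
  Wronskian. As \<open>b\<close> is nonzero at \<open>z\<close>, the term
  \<open>pderiv f * b\<close> has order one less than \<open>f\<close>, and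
  \<open>f * pderiv b\<close> vanishes to higher order.\<close>

lemma order_wronskian:
  assumes X: "reduced a b j" "j \<ge> 1" and z: "poly (a - smult x b) z = 0"
  shows "Suc (order z (wronskian a b)) = order z (a - smult x b)"
proof -
  define f where "f = a - smult x b"
  have f0: "f \<noteq> 0" using fib_nonzero[OF X] f_def by simp
  have bz: "poly b z \<noteq> 0" using fib_root[OF X(1) z] by simp
  have fz: "poly f z = 0" using z f_def by simp
  then have o0: "order z f \<noteq> 0" using f0 by (simp add: order_root)
  have pf0: "pderiv f \<noteq> 0"
  proof
    assume "pderiv f = 0"
    then have "degree f = 0" by (simp add: pderiv_eq_0_iff)
    then obtain c where "f = [:c:]" by (rule degree_eq_zeroE)
    then show False using f0 fz by simp
  qed
  have o: "order z f = Suc (order z (pderiv f))" by (rule order_pderiv[OF f0 fz])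
  define e where "e = order z (pderiv f)"
  have w: "wronskian a b = pderiv f * b - f * pderiv b" using wronskian_fib[of a x b] f_def wronskian_def by simp
  have w0: "wronskian a b \<noteq> 0" using wronskian_nonzero[OF X] .
  have b0: "b \<noteq> 0" "order z b = 0" using bz by (auto simp: order_0I)
  have "[:- z, 1:] ^ Suc e dvd f * pderiv b"
    using o e_def by (metis dvd_mult2 order_1)
  moreover have "\<not> [:- z, 1:] ^ Suc e dvd pderiv f * b"
  proof -
    have "order z (pderiv f * b) = e" using pf0 b0 by (simp add: order_mult e_def)
    then show ?thesis using pf0 b0 by (simp add: order_divides del: power_Suc)
  qed
  ultimately have "\<not> [:- z, 1:] ^ Suc e dvd wronskian a b"
    unfolding w using dvd_add[of "[:- z, 1:] ^ Suc e" "pderiv f * b - f * pderiv b" "f * pderiv b"] by auto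
  moreover have "[:- z, 1:] ^ e dvd wronskian a b"
  proof -
    have "[:- z, 1:] ^ e dvd f"
      using dvd_trans[OF le_imp_power_dvd[of e "order z f" "[:- z, 1:]"] order_1] o e_def by simp
    then show ?thesis
      unfolding w using order_1[of z "pderiv f"] e_def by (intro dvd_diff dvd_mult2) auto
  qed
  ultimately have "order z (wronskian a b) = e" using w0 order_unique_lemma by metis
  then show ?thesis using o e_def f_def by simp
qed

text \<open>A generic value: neither critical nor taken at infinity.\<close>

definition good_value :: "complex poly \<Rightarrow> complex poly \<Rightarrow> nat \<Rightarrow> complex \<Rightarrow> bool" where
  "good_value a b j x \<longleftrightarrow> degree (a - smult x b) = j \<and>
     (\<forall>z. poly (a - smult x b) z = 0 \<longrightarrow> order z (a - smult x b) = 1)"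

lemma good_value_card:
  assumes "reduced a b j" "j \<ge> 1" "good_value a b j x"
  shows "card {z. poly (a - smult x b) z = 0} = j"
  using sum_order_complex[OF fib_nonzero[OF assms(1,2)], of x] assms(3)
  by (simp add: good_value_def)

lemma finite_bad_values:
  assumes "reduced a b j" "j \<ge> 1"
  shows "finite {x. \<not> good_value a b j x}"
proof -
  have "{x. \<not> good_value a b j x} \<subseteq>
      {x. quot_map a b None = Some x} \<union> (\<lambda>z. poly a z / poly b z) ` {z. poly (wronskian a b) z = 0}"
  proof (intro subsetI, rule ccontr)
    fix x assume x: "x \<in> {x. \<not> good_value a b j x}"
      and n: "x \<notin> {x. quot_map a b None = Some x} \<union> (\<lambda>z. poly a z / poly b z) ` {z. poly (wronskian a b) z = 0}"
    have "order z (a - smult x b) = 1" if z: "poly (a - smult x b) z = 0" for z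
    proof -
      have "poly (wronskian a b) z \<noteq> 0" using n fib_root[OF assms(1) z] by auto
      then show ?thesis using order_wronskian[OF assms z] by (simp add: order_0I)
    qed
    then show False using x n degree_fib[OF assms(1)] by (auto simp: good_value_def)
  qed
  moreover have "finite {x. quot_map a b None = Some x}"
    by (rule finite_subset[of _ "{the (quot_map a b None)}"]) auto
  ultimately show ?thesis
    using poly_roots_finite[OF wronskian_nonzero[OF assms]] finite_subset by blast
qed

lemma finite_vimage_rational:
  assumes "reduced a b j" "j \<ge> 1" "finite S"
  shows "finite (quot_map a b -` S)"
proof -
  have sub: "quot_map a b -` S \<subseteq> {None} \<union> Some ` ({z. poly b z = 0} \<union>
      (\<Union>x\<in>{x. Some x \<in> S}. {z. poly (a - smult x b) z = 0}))"
  proof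
    fix w assume w: "w \<in> quot_map a b -` S"
    show "w \<in> {None} \<union> Some ` ({z. poly b z = 0} \<union>
      (\<Union>x\<in>{x. Some x \<in> S}. {z. poly (a - smult x b) z = 0}))"
    proof (cases w)
      case (Some z)
      then show ?thesis
      proof (cases "poly b z = 0")
        case False
        then have "quot_map a b w = Some (poly a z / poly b z)" using Some by (simp add: quot_map_def)
        then have "Some (poly a z / poly b z) \<in> S" using w by simp
        moreover have "poly (a - smult (poly a z / poly b z) b) z = 0" using False by simp
        ultimately have "z \<in> (\<Union>x\<in>{x. Some x \<in> S}. {z. poly (a - smult x b) z = 0})" by blast
        then show ?thesis using Some by blast
      qed simp
    qed simp
  qed
  have "finite {x. Some x \<in> S}"
    using finite_vimageI[OF assms(3), of Some] by (simp add: vimage_def)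
  then have "finite ({None} \<union> Some ` ({z. poly b z = 0} \<union>
      (\<Union>x\<in>{x. Some x \<in> S}. {z. poly (a - smult x b) z = 0})))"
    using poly_roots_finite[OF fib_nonzero[OF assms(1,2)]] poly_roots_finite[OF reducedD(2)[OF assms(1)]]
    by (intro finite_UnI finite_imageI finite_UN_I) auto
  then show ?thesis using sub finite_subset by blast
qed

lemma surj_rational:
  assumes "reduced a b j" "j \<ge> 1"
  shows "surj (quot_map a b)"
proof -
  have "\<exists>w. quot_map a b w = y" for y
  proof (cases y)
    case None
    show ?thesis
    proof (cases "degree b = 0")
      case True
      then have "coeff b j = 0" using assms(2) by (simp add: coeff_eq_0)
      then have "quot_map a b None = None" by (simp add: quot_map_None[OF assms(1)] proj_pt_def)
      then show ?thesis using None by blast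
    next
      case False
      then obtain z where "poly b z = 0"
        using fundamental_theorem_of_algebra[of b] by (auto simp: constant_degree)
      then have "quot_map a b (Some z) = None" by (simp add: quot_map_def)
      then show ?thesis using None by blast
    qed
  next
    case (Some x)
    show ?thesis
    proof (cases "degree (a - smult x b) = 0")
      case True
      then have "quot_map a b None = Some x"
        using assms(2) coeff_eq_0[of "a - smult x b" j] by (simp add: quot_map_None_eq_Some_iff[OF assms(1)])
      then show ?thesis using Some by blast
    next
      case False
      then obtain z where "poly (a - smult x b) z = 0"
        using fundamental_theorem_of_algebra[of "a - smult x b"] by (auto simp: constant_degree)
      then show ?thesis using Some quot_map_Some_eq_Some_iff[OF assms(1)] by blast
    qed
  qed
  then show ?thesis by (metis surjI)
qed

section \<open>Moebius transformations as the rational functions of degree one\<close>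

lemma degree_le_1:
  fixes p :: "complex poly"
  assumes "degree p \<le> 1"
  shows "\<exists>b a. p = [:b, a:]"
proof -
  have "p = [:coeff p 0, coeff p 1:]"
    by (rule poly_eqI) (use assms in \<open>auto simp: coeff_pCons coeff_eq_0 split: nat.split\<close>)
  then show ?thesis by blast
qed

lemma reduced_moebius:
  assumes "a * d - b * c \<noteq> 0"
  shows "reduced [:b, a:] [:d, c:] 1"
proof -
  have "coprime [:b, a:] [:d, c:]"
  proof (rule coprime_if_no_common_root)
    fix z assume "poly [:b, a:] z = 0" "poly [:d, c:] z = 0"
    then have "b = - a * z" "d = - c * z" by (simp_all add: eq_neg_iff_add_eq_0 mult.commute)
    then show False using assms by (simp add: algebra_simps)
  qed
  then show ?thesis using assms by (auto simp: reduced_def)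
qed

lemma moebius_iff: "moebius \<mu> \<longleftrightarrow> rational_function \<mu> \<and> rat_degree \<mu> = 1"
proof
  assume "moebius \<mu>"
  then show "rational_function \<mu> \<and> rat_degree \<mu> = 1"
    using reduced_moebius rat_degree_reduced rational_function_iff unfolding moebius_def by metis
next
  assume *: "rational_function \<mu> \<and> rat_degree \<mu> = 1"
  then obtain p q where pq: "reduced p q 1" "\<mu> = quot_map p q" using rational_functionE by metis
  obtain b a where p: "p = [:b, a:]"
    using degree_le_1[OF reducedD(3)[OF pq(1)]] by blast
  obtain d c where q: "q = [:d, c:]"
    using degree_le_1[OF reducedD(4)[OF pq(1)]] by blast
  have "a * d - b * c \<noteq> 0"
  proof
    assume D: "a * d - b * c = 0"
    show False
    proof (cases "c = 0")
      case True
      then have "a \<noteq> 0" "d \<noteq> 0" using reduced_top_coeff[OF pq(1)] reducedD(2)[OF pq(1)] p q by auto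
      then show False using D True by simp
    next
      case False
      then have "poly q (- d / c) = 0" "poly p (- d / c) = 0" using D by (simp_all add: p q field_simps)
      then show False using reduced_no_common_root[OF pq(1)] by blast
    qed
  qed
  then show "moebius \<mu>" using p q pq(2) unfolding moebius_def by blast
qed

lemma moebius_id: "moebius id"
proof -
  have "quot_map [:0, 1:] [:1, 0:] = id"
    by (auto simp: quot_map_def fun_eq_iff split: option.splits)
  then show ?thesis unfolding moebius_def by (intro exI[of _ 1] exI[of _ 0]) simp
qed

lemma moebius_inverse:
  assumes "moebius \<mu>"
  shows "bij \<mu>" "moebius (inv \<mu>)"
proof -
  obtain a b c d where D: "a * d - b * c \<noteq> 0" and mu: "\<mu> = quot_map [:b, a:] [:d, c:]"
    using assms unfolding moebius_def by blast
  \<comment> \<open>The adjugate matrix: its product with the matrix of \<open>\<mu>\<close> is the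
    determinant times the identity, which is invisible in homogeneous coordinates.\<close>
  define \<nu> where "\<nu> = quot_map [:- b, d:] [:a, - c:]"
  have D': "d * a - (- b) * (- c) \<noteq> 0" using D by (simp add: algebra_simps)
  note r = reduced_moebius[OF D] and r' = reduced_moebius[OF D']
  have rep: "\<exists>s t. (s \<noteq> 0 \<or> t \<noteq> 0) \<and> w = proj_pt s t" for w
  proof (cases w)
    case None
    then show ?thesis by (intro exI[of _ 1] exI[of _ 0]) (simp add: proj_pt_def)
  next
    case (Some z)
    then show ?thesis by (intro exI[of _ z] exI[of _ 1]) (simp add: proj_pt_def)
  qed
  have h: "hval 1 [:b, a:] s t = b * t + a * s" for a b s t
    by (simp add: hval_def)
  have key: "quot_map [:b, a:] [:d, c:] (quot_map [:- b, d:] [:a, - c:] w) = w"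
    if D: "a * d - b * c \<noteq> 0" for a b c d w
  proof -
    obtain s t where st: "s \<noteq> 0 \<or> t \<noteq> 0" "w = proj_pt s t" using rep by blast
    have D': "d * a - (- b) * (- c) \<noteq> 0" using D by (simp add: algebra_simps)
    note r = reduced_moebius[OF D] and r' = reduced_moebius[OF D']
    have nb: "- b * t + d * s \<noteq> 0 \<or> a * t + (- c) * s \<noteq> 0"
      using reduced_hval_not_both[OF r' st(1)] unfolding h by blast
    have "quot_map [:b, a:] [:d, c:] (quot_map [:- b, d:] [:a, - c:] w) =
        proj_pt (b * (a * t + (- c) * s) + a * (- b * t + d * s)) (d * (a * t + (- c) * s) + c * (- b * t + d * s))"
      unfolding st(2) quot_map_proj_pt[OF r' st(1)] h using quot_map_proj_pt[OF r nb] unfolding h .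
    also have "b * (a * t + (- c) * s) + a * (- b * t + d * s) = (a * d - b * c) * s"
      by (simp add: algebra_simps)
    also have "d * (a * t + (- c) * s) + c * (- b * t + d * s) = (a * d - b * c) * t"
      by (simp add: algebra_simps)
    also have "proj_pt ((a * d - b * c) * s) ((a * d - b * c) * t) = w"
      using D st(2) by (simp add: proj_pt_def)
    finally show ?thesis .
  qed
  have "\<mu> (\<nu> w) = w" for w using key[OF D] mu \<nu>_def by simp
  moreover have "\<nu> (\<mu> w) = w" for w using key[OF D', of w] mu \<nu>_def by simp
  ultimately have c: "\<mu> \<circ> \<nu> = id" "\<nu> \<circ> \<mu> = id" by auto
  then show "bij \<mu>" using o_bij by blast
  have "inv \<mu> = \<nu>" using inv_unique_comp[OF c] .
  then show "moebius (inv \<mu>)" using D' unfolding moebius_def \<nu>_def by blast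
qed

section \<open>Factoring one rational function through another\<close>

lemma proportional_if_proots_eq:
  fixes f g :: "complex poly"
  assumes "proots f = proots g"
  shows "smult (lead_coeff g) f = smult (lead_coeff f) g"
proof -
  have "smult (lead_coeff g) (smult (lead_coeff f) (\<Prod>x\<in>#proots f. [:- x, 1:])) =
      smult (lead_coeff f) (smult (lead_coeff g) (\<Prod>x\<in>#proots g. [:- x, 1:]))"
    by (simp add: assms mult.commute)
  then show ?thesis by (simp only: complex_poly_decompose_multiset)
qed

lemma homog_add: "homog d (f + g) a b = homog d f a b + homog d g a b"
  by (simp add: homog_def smult_add_left sum.distrib)

lemma homog_smult: "homog d (smult c f) a b = smult c (homog d f a b)"
proof -
  have "smult c (\<Sum>i\<in>A. h i) = (\<Sum>i\<in>A. smult c (h i))" for h :: "nat \<Rightarrow> complex poly" and A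
    by (induction A rule: infinite_finite_induct) (simp_all add: smult_add_right)
  then show ?thesis by (simp add: homog_def)
qed

lemma homog_prod_linear:
  assumes "q \<noteq> 0" "finite Y"
  shows "homog (card Y) (\<Prod>y\<in>Y. [:- y, 1:]) p q = (\<Prod>y\<in>Y. p - smult y q)"
  using assms(2)
proof (induction Y)
  case empty
  then show ?case by (simp add: homog_def)
next
  case (insert y Y)
  have "degree (\<Prod>y\<in>Y. [:- y, 1:]) \<le> card Y"
    using degree_prod_sum_le[OF insert(1), of "\<lambda>y. [:- y, 1:]"] by simp
  then have "homog (1 + card Y) ([:- y, 1:] * (\<Prod>y\<in>Y. [:- y, 1:])) p q =
      homog 1 [:- y, 1:] p q * homog (card Y) (\<Prod>y\<in>Y. [:- y, 1:]) p q"
    using assms(1) by (intro homog_mult) auto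
  then show ?case using insert unfolding homog_linear by simp
qed

text \<open>The fibre over \<open>x\<close> is a union of whole fibres of \<open>p / q\<close>, and
  all roots are simple. So both sides have the same roots with the same orders and agree up to a
  constant.\<close>

lemma fib_eq_prod:
  assumes X: "reduced a b j" "j \<ge> 1" and Y: "reduced p q d" "d \<ge> 1"
    and x: "good_value a b j x"
    and v: "\<And>v. poly (a - smult x b) v = 0 \<Longrightarrow>
        poly q v \<noteq> 0 \<and> good_value p q d (poly p v / poly q v) \<and>
        (\<forall>z. poly (p - smult (poly p v / poly q v) q) z = 0 \<longrightarrow> poly (a - smult x b) z = 0)"
  shows "\<exists>c Y. finite Y \<and> card Y * d = j \<and> a - smult x b = smult c (\<Prod>y\<in>Y. p - smult y q)"
proof -
  define f where "f = a - smult x b"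
  define Z where "Z = (\<lambda>v. poly p v / poly q v) ` {v. poly f v = 0}"
  define g where "g = (\<Prod>y\<in>Z. p - smult y q)"
  have f0: "f \<noteq> 0" using fib_nonzero[OF X] f_def by simp
  have finZ: "finite Z" using poly_roots_finite[OF f0] Z_def by simp
  have g0: "g \<noteq> 0" using finZ fib_nonzero[OF Y] by (simp add: g_def)
  have Zgood: "good_value p q d y" if "y \<in> Z" for y using that v by (auto simp: Z_def f_def)
  have ord_g: "order z g = (\<Sum>y\<in>Z. order z (p - smult y q))" for z
  proof -
    have "(\<Sum>y\<in>Z. count (proots (p - smult y q)) z) = count (proots g) z"
      using proots_prod[of Z "\<lambda>y. p - smult y q"] fib_nonzero[OF Y] by (simp add: g_def count_sum)
    then show ?thesis using g0 fib_nonzero[OF Y] by simp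
  qed
  have ord_eq: "order z g = order z f" for z
  proof (cases "poly f z = 0")
    case True
    then have qz: "poly q z \<noteq> 0" and yz: "poly p z / poly q z \<in> Z"
      using v by (auto simp: Z_def f_def)
    have "order z (p - smult y q) = (if y = poly p z / poly q z then 1 else 0)" if "y \<in> Z" for y
    proof (cases "y = poly p z / poly q z")
      case True
      then have "poly (p - smult y q) z = 0" using qz by simp
      then show ?thesis using Zgood[OF that] True by (simp add: good_value_def)
    next
      case False
      then have "poly (p - smult y q) z \<noteq> 0" using qz by (auto simp: field_simps)
      then show ?thesis using False by (simp add: order_0I)
    qed
    then have "order z g = (\<Sum>y\<in>Z. if y = poly p z / poly q z then 1 else 0)"
      unfolding ord_g by (intro sum.cong) auto
    also have "\<dots> = 1" using yz finZ by simp
    finally show ?thesis using x True by (simp add: good_value_def f_def)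
  next
    case False
    have "poly (p - smult y q) z \<noteq> 0" if "y \<in> Z" for y
      using that v False by (auto simp: Z_def f_def)
    then have "order z g = 0" unfolding ord_g by (simp add: order_0I)
    then show ?thesis using False by (simp add: order_0I)
  qed
  have "proots f = proots g"
    by (rule multiset_eqI) (use f0 g0 ord_eq in simp)
  then have eq: "smult (lead_coeff g) f = smult (lead_coeff f) g" by (rule proportional_if_proots_eq)
  have lg: "lead_coeff g \<noteq> 0" using g0 by simp
  have "f = smult (1 / lead_coeff g) (smult (lead_coeff g) f)" using lg by simp
  also have "\<dots> = smult (lead_coeff f / lead_coeff g) g" unfolding eq by simp
  finally have fg: "f = smult (lead_coeff f / lead_coeff g) g" .
  have "degree g = (\<Sum>y\<in>Z. degree (p - smult y q))"
    unfolding g_def by (rule degree_prod_eq_sum_degree) (use fib_nonzero[OF Y] in auto)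
  also have "\<dots> = card Z * d" using Zgood by (simp add: good_value_def)
  finally have dg: "degree g = card Z * d" .
  have "degree (smult (lead_coeff g) f) = degree (smult (lead_coeff f) g)" by (simp only: eq)
  moreover have "lead_coeff f \<noteq> 0" using f0 by simp
  ultimately have "degree f = degree g" using lg by (metis degree_smult_eq)
  then have "card Z * d = j" using dg x by (simp add: f_def good_value_def)
  then show ?thesis using fg finZ unfolding g_def f_def by (intro exI[of _ Z] exI conjI)
qed

text \<open>For generic \<open>x\<close> the polynomial \<open>a - smult x b\<close> is a form in
  \<open>p\<close> and \<open>q\<close>, because \<open>a / b\<close> is constant on generic fibres
  of \<open>p / q\<close>. Two such values of \<open>x\<close> suffice to recover \<open>a\<close>
  and \<open>b\<close> themselves as forms in \<open>p\<close> and \<open>q\<close>.\<close>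

lemma factor_through:
  assumes X: "reduced a b j" "j \<ge> 1" and Y: "reduced p q d" "d \<ge> 1"
    and fin: "finite {w. \<exists>z. quot_map p q (Some z) = quot_map p q (Some w) \<and>
                quot_map a b (Some z) \<noteq> quot_map a b (Some w)}" (is "finite ?B")
  shows "\<exists>r s e. reduced r s e \<and> quot_map a b = quot_map r s \<circ> quot_map p q"
proof -
  define V where "V = ?B \<union> {v. poly q v = 0} \<union>
    {v. quot_map p q (Some v) \<in> Some ` {y. \<not> good_value p q d y}}"
  define Bad where "Bad = {x. \<not> good_value a b j x} \<union> (\<lambda>v. poly a v / poly b v) ` V"
  have "finite (Some -` (quot_map p q -` (Some ` {y. \<not> good_value p q d y})))"
    by (rule finite_vimageI[OF finite_vimage_rational[OF Y finite_imageI[OF finite_bad_values[OF Y]]]]) simp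
  then have "finite V"
    using fin poly_roots_finite[OF reducedD(2)[OF Y(1)]] by (simp add: V_def vimage_def)
  then have finBad: "finite Bad" using finite_bad_values[OF X] by (simp add: Bad_def)
  have good: "\<exists>c Z. finite Z \<and> card Z * d = j \<and> a - smult x b = smult c (\<Prod>y\<in>Z. p - smult y q)"
    if x: "x \<notin> Bad" for x
  proof (rule fib_eq_prod[OF X Y])
    show "good_value a b j x" using x by (simp add: Bad_def)
    fix v assume v: "poly (a - smult x b) v = 0"
    have xv: "x = poly a v / poly b v" using fib_root[OF X(1) v] by simp
    then have "v \<notin> V" using x by (auto simp: Bad_def)
    then have vB: "v \<notin> ?B" and qv: "poly q v \<noteq> 0"
      and gv': "quot_map p q (Some v) \<notin> Some ` {y. \<not> good_value p q d y}"
      unfolding V_def by blast+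
    have gv: "good_value p q d (poly p v / poly q v)"
      using gv' qv by (simp add: quot_map_def image_iff)
    have "poly (a - smult x b) z = 0" if z: "poly (p - smult (poly p v / poly q v) q) z = 0" for z
    proof -
      have "quot_map p q (Some z) = quot_map p q (Some v)"
        using z qv quot_map_Some_eq_Some_iff[OF Y(1), of z] by (simp add: quot_map_def)
      then have "quot_map a b (Some z) = quot_map a b (Some v)" using vB by blast
      then show ?thesis using v quot_map_Some_eq_Some_iff[OF X(1)] by metis
    qed
    then show "poly q v \<noteq> 0 \<and> good_value p q d (poly p v / poly q v) \<and>
        (\<forall>z. poly (p - smult (poly p v / poly q v) q) z = 0 \<longrightarrow> poly (a - smult x b) z = 0)"
      using qv gv by blast
  qed
  obtain x0 where x0: "x0 \<notin> Bad"
    using finBad ex_new_if_finite infinite_UNIV_char_0 by metis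
  obtain x1 where x1: "x1 \<notin> insert x0 Bad"
    using finBad ex_new_if_finite[OF infinite_UNIV_char_0, of "insert x0 Bad"] by auto
  obtain c0 Z0 where 0: "finite Z0" "card Z0 * d = j" "a - smult x0 b = smult c0 (\<Prod>y\<in>Z0. p - smult y q)"
    using good[OF x0] by blast
  obtain c1 Z1 where 1: "finite Z1" "card Z1 * d = j" "a - smult x1 b = smult c1 (\<Prod>y\<in>Z1. p - smult y q)"
    using good x1 by blast
  define m where "m = card Z0"
  have m: "card Z1 = m" "m * d = j" using 0 1 Y(2) by (auto simp: m_def)
  define R0 R1 where "R0 = (\<Prod>y\<in>Z0. [:- y, 1:])" and "R1 = (\<Prod>y\<in>Z1. [:- y, 1:] :: complex poly)"
  have H0: "homog m R0 p q = (\<Prod>y\<in>Z0. p - smult y q)"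
    using homog_prod_linear[OF reducedD(2)[OF Y(1)] 0(1)] by (simp add: m_def R0_def)
  have H1: "homog m R1 p q = (\<Prod>y\<in>Z1. p - smult y q)"
    using homog_prod_linear[OF reducedD(2)[OF Y(1)] 1(1)] m by (simp add: R1_def)
  \<comment> \<open>Solves the two linear equations \<open>a - x0 b = c0 R0(p, q)\<close> and
    \<open>a - x1 b = c1 R1(p, q)\<close> for \<open>a\<close> and \<open>b\<close>.\<close>
  define s where "s = smult (c0 / (x1 - x0)) R0 + smult (- c1 / (x1 - x0)) R1"
  define r where "r = smult x1 s + smult c1 R1"
  have ne: "x1 - x0 \<noteq> 0" using x1 by auto
  have hs: "homog m s p q = b"
  proof -
    have "homog m s p q = smult (1 / (x1 - x0)) (smult c0 (homog m R0 p q) - smult c1 (homog m R1 p q))"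
      unfolding s_def homog_add homog_smult by (simp add: smult_diff_right)
    also have "\<dots> = smult (1 / (x1 - x0)) ((a - smult x0 b) - (a - smult x1 b))"
      unfolding H0 H1 0(3) 1(3) ..
    also have "(a - smult x0 b) - (a - smult x1 b) = smult (x1 - x0) b"
      by (simp add: smult_diff_left)
    finally show ?thesis using ne by simp
  qed
  have hr: "homog m r p q = a"
    unfolding r_def homog_add homog_smult hs H1 1(3)[symmetric] by simp
  have dR: "degree R0 \<le> m" "degree R1 \<le> m"
    using degree_prod_sum_le[OF 0(1), of "\<lambda>y. [:- y, 1:]"] degree_prod_sum_le[OF 1(1), of "\<lambda>y. [:- y, 1:]"] m
    by (simp_all add: R0_def R1_def m_def)
  have ds: "degree s \<le> m" unfolding s_def
    using dR by (intro degree_add_le) (auto intro: le_trans[OF degree_smult_le])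
  have dr: "degree r \<le> m" unfolding r_def
    using dR ds by (intro degree_add_le) (auto intro: le_trans[OF degree_smult_le])
  have s0: "s \<noteq> 0" using hs reducedD(2)[OF X(1)] by (auto simp: homog_def)
  have cop: "coprime r s"
  proof (rule coprime_if_no_common_root)
    fix y assume y: "poly r y = 0" "poly s y = 0"
    obtain w where w: "quot_map p q w = Some y" using surj_rational[OF Y] by (metis surjD)
    show False
    proof (cases w)
      case (Some z)
      then have "poly (p - smult y q) z = 0" using w quot_map_Some_eq_Some_iff[OF Y(1)] by simp
      then have "poly q z \<noteq> 0" "poly p z / poly q z = y" using fib_root[OF Y(1)] by blast+
      then have "poly a z = 0" "poly b z = 0"
        using y poly_homog_nonzero[OF dr, of q z p] poly_homog_nonzero[OF ds, of q z p] hs hr by simp_all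
      then show False using reduced_no_common_root[OF X(1)] by blast
    next
      case None
      then have e: "coeff q d \<noteq> 0" "coeff p d / coeff q d = y"
        using w by (auto simp: quot_map_None[OF Y(1)] proj_pt_def split: if_splits)
      have "coeff a j = 0" "coeff b j = 0"
        using y e coeff_homog_top[OF reducedD(3,4)[OF Y(1)], of m r] coeff_homog_top[OF reducedD(3,4)[OF Y(1)], of m s]
          hval_nonzero[OF dr e(1), of "coeff p d"] hval_nonzero[OF ds e(1), of "coeff p d"] hs hr m by simp_all
      then show False using reduced_top_coeff[OF X(1)] by blast
    qed
  qed
  \<comment> \<open>Homogenisations in the actual degree \<open>e\<close> and in \<open>m\<close>
    differ by a power of \<open>q\<close>, which cancels in the quotient where \<open>q\<close> is
    nonzero. Agreement at these infinitely many points is enough.\<close>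
  define e where "e = max (degree r) (degree s)"
  have red: "reduced r s e" using cop s0 by (simp add: reduced_def e_def)
  note c = reduced_comp[OF red Y]
  have "quot_map a b = quot_map (homog e r p q) (homog e s p q)"
  proof (rule rational_eqI[OF X(1) c(1)])
    have "quot_map a b (Some z) = quot_map (homog e r p q) (homog e s p q) (Some z)" if "poly q z \<noteq> 0" for z
      using that poly_homog_nonzero[OF dr, of q z p] poly_homog_nonzero[OF ds, of q z p] hs hr
        poly_homog_nonzero[OF reducedD(3)[OF red], of q z p] poly_homog_nonzero[OF reducedD(4)[OF red], of q z p]
      by (simp add: quot_map_def)
    then show "infinite {z. quot_map a b (Some z) = quot_map (homog e r p q) (homog e s p q) (Some z)}"
      using infinite_nonroots[OF reducedD(2)[OF Y(1)]] by (auto elim!: infinite_super[rotated])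
  qed
  then have "quot_map a b = quot_map r s \<circ> quot_map p q" using c(2) by simp
  then show ?thesis using red by blast
qed

text \<open>Bezout over the field of fractions of the coefficient ring, with denominators cleared:
  \<open>D\<close> is the primitive part and \<open>c\<close> the content of a nonzero element of
  least degree in the ideal.\<close>

lemma ideal_generator:
  fixes f g :: "complex poly poly"
  assumes "g \<noteq> 0"
  shows "\<exists>D u v c. c \<noteq> 0 \<and> D dvd f \<and> D dvd g \<and> u * f + v * g = smult c D"
proof -
  define I where "I h \<longleftrightarrow> h \<noteq> 0 \<and> (\<exists>u v. h = u * f + v * g)" for h
  have "I g" unfolding I_def using assms by (auto intro: exI[of _ 0] exI[of _ 1])
  then obtain h where h: "I h" "\<And>h'. I h' \<Longrightarrow> degree h \<le> degree h'"
    using ex_has_least_nat[of I g degree] by blast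
  obtain u v where uv: "h = u * f + v * g" and h0: "h \<noteq> 0" using h(1) I_def by blast
  define D where "D = primitive_part h"
  have hD: "smult (content h) D = h" by (simp add: D_def)
  have D1: "content D = 1" using h0 by (simp add: D_def)
  have dvd: "D dvd k" if k: "\<exists>u v. k = u * f + v * g" for k
  proof -
    obtain u' v' where uv': "k = u' * f + v' * g" using k by blast
    obtain \<alpha> Q where aQ: "\<alpha> \<noteq> 0" "smult \<alpha> k = h * Q + pseudo_mod k h"
      using pseudo_mod(1)[OF h0] by blast
    have "pseudo_mod k h = (smult \<alpha> u' - Q * u) * f + (smult \<alpha> v' - Q * v) * g"
    proof -
      have "pseudo_mod k h = smult \<alpha> k - h * Q" using aQ(2) by simp
      also have "\<dots> = (smult \<alpha> u' - Q * u) * f + (smult \<alpha> v' - Q * v) * g"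
        unfolding uv' uv by (simp add: algebra_simps smult_add_right)
      finally show ?thesis .
    qed
    then have "pseudo_mod k h \<noteq> 0 \<Longrightarrow> I (pseudo_mod k h)" unfolding I_def by blast
    \<comment> \<open>A nonzero pseudo-remainder would be an element of the ideal of smaller degree
      than \<open>h\<close>.\<close>
    then have "pseudo_mod k h = 0" using h(2) pseudo_mod(2)[OF h0, of k] by fastforce
    then have "smult \<alpha> k = D * smult (content h) Q" using aQ(2) hD by (metis add.right_neutral mult_smult_left mult_smult_right)
    \<comment> \<open>Over the field of fractions \<open>\<alpha>\<close> is a unit, so
      \<open>D\<close> divides \<open>k\<close> there; as \<open>D\<close> is primitive, Gauss's
      lemma transfers this back.\<close>
    then have "fract_poly (smult \<alpha> k) = fract_poly D * fract_poly (smult (content h) Q)" by (metis fract_poly_mult)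
    then have "fract_poly D dvd smult (to_fract \<alpha>) (fract_poly k)" by (metis dvd_triv_left fract_poly_smult)
    then have "fract_poly D dvd fract_poly k" using aQ(1) by (simp add: dvd_smult_iff)
    then show ?thesis using D1 fract_poly_dvdD by blast
  qed
  have "D dvd f" by (rule dvd) (auto intro: exI[of _ 1] exI[of _ 0])
  moreover have "D dvd g" by (rule dvd) (auto intro: exI[of _ 1] exI[of _ 0])
  moreover have "content h \<noteq> 0" using h0 by simp
  ultimately show ?thesis using uv hD by metis
qed

section \<open>Common right factors\<close>

lemma quot_map_eq_iff_cross:
  assumes "reduced a b j"
  shows "quot_map a b (Some w) = quot_map a b (Some z) \<longleftrightarrow> poly a w * poly b z = poly a z * poly b w"
  using reduced_no_common_root[OF assms, of w] reduced_no_common_root[OF assms, of z]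
  by (auto simp: quot_map_def field_simps)

lemma card_roots_of_divisor:
  fixes f g :: "complex poly"
  assumes "f dvd g" "g \<noteq> 0" and g: "\<And>z. poly g z = 0 \<Longrightarrow> order z g = 1"
  shows "proots f = mset_set {z. poly f z = 0}" "card {z. poly f z = 0} = degree f"
proof -
  have f0: "f \<noteq> 0" using assms by auto
  have o: "order z f = 1" if "poly f z = 0" for z
  proof -
    have "poly g z = 0" using assms(1) that by (auto elim!: dvdE)
    then have "order z f \<le> 1" using dvd_imp_order_le[OF assms(2,1)] g by metis
    then show ?thesis using that f0 by (metis le_antisym less_one not_le order_root)
  qed
  show "proots f = mset_set {z. poly f z = 0}"
    by (rule multiset_eqI) (use f0 o poly_roots_finite[OF f0] in \<open>auto simp: count_mset_set' order_0I\<close>)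
  show "card {z. poly f z = 0} = degree f"
    using sum_order_complex[OF f0] o by simp
qed

text \<open>The outer variable is thought of as \<open>z\<close>, the variable of the coefficients
  as \<open>w\<close>. This map specialises \<open>w\<close>, whereas evaluation at
  \<open>[:z:]\<close> specialises \<open>z\<close>.\<close>

definition eval_inner :: "complex \<Rightarrow> complex poly poly \<Rightarrow> complex poly" where
  "eval_inner w f = map_poly (\<lambda>c. poly c w) f"

lemma coeff_eval_inner: "coeff (eval_inner w f) i = poly (coeff f i) w"
  by (simp add: eval_inner_def coeff_map_poly)

lemma poly_eval_inner: "poly (eval_inner w f) z = poly (poly f [:z:]) w"
  by (induction f) (simp_all add: eval_inner_def map_poly_pCons)

lemma eval_inner_mult: "eval_inner w (f * g) = eval_inner w f * eval_inner w g"
  by (rule poly_eq_if_infinite) (simp add: poly_eval_inner infinite_UNIV_char_0)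

text \<open>The polynomial \<open>b(w) a(z) - a(w) b(z)\<close>; for coprime \<open>a\<close>,
  \<open>b\<close> its zeros are the pairs with the same image under \<open>a / b\<close>.\<close>

definition pencil :: "complex poly \<Rightarrow> complex poly \<Rightarrow> complex poly poly" where
  "pencil a b = smult b (map_poly (\<lambda>c. [:c:]) a) - smult a (map_poly (\<lambda>c. [:c:]) b)"

lemma poly_lift_const: "poly (map_poly (\<lambda>c. [:c:]) a) [:z:] = [:poly a z:]"
  by (induction a) (simp_all add: map_poly_pCons mult.commute)

lemma poly_pencil: "poly (pencil a b) [:z:] = smult (poly a z) b - smult (poly b z) a"
  by (simp add: pencil_def poly_lift_const)

lemma eval_inner_pencil: "eval_inner w (pencil a b) = smult (poly b w) a - smult (poly a w) b"
  by (rule poly_eq_if_infinite) (simp add: poly_eval_inner poly_pencil infinite_UNIV_char_0 mult.commute)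

text \<open>A pencil is antisymmetric, so specialising either variable to \<open>w\<close> gives a
  nonzero multiple of the polynomial of the fibre through \<open>w\<close>.\<close>

lemma pencil_value:
  assumes "reduced p q k" "k \<ge> 1" "poly q w \<noteq> 0" "good_value p q k (poly p w / poly q w)"
    and g: "g = smult (poly q w) p - smult (poly p w) q \<or> g = smult (poly p w) q - smult (poly q w) p"
  shows "g \<noteq> 0" "poly g z = 0 \<Longrightarrow> order z g = 1"
proof -
  define f where "f = p - smult (poly p w / poly q w) q"
  have f0: "f \<noteq> 0" using fib_nonzero[OF assms(1,2)] f_def by simp
  have "smult (poly q w) p - smult (poly p w) q = smult (poly q w) f"
    using assms(3) by (simp add: f_def smult_diff_right)
  moreover have "smult (poly p w) q - smult (poly q w) p = smult (- poly q w) f"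
    using assms(3) by (simp add: f_def smult_diff_right)
  ultimately obtain c where c: "c \<noteq> 0" "g = smult c f" using g assms(3) by (metis neg_equal_0_iff_equal)
  show "g \<noteq> 0" using c f0 by simp
  show "order z g = 1" if "poly g z = 0"
    using that c assms(4) by (simp add: order_smult good_value_def f_def)
qed

text \<open>The pairs \<open>(w, z)\<close> with the same image under both maps form the zero locus of a polynomial
  \<open>D\<close>, the greatest common divisor of the two pencils. The coefficients of \<open>D\<close> with respect to \<open>z\<close>
  are polynomials in \<open>w\<close>, and a nonconstant quotient of two of them is a common right factor.\<close>

lemma common_right_factor:
  assumes X: "reduced a b j" "j \<ge> 1" and Y: "reduced p q k" "k \<ge> 1"
    and inf: "infinite {w. \<exists>z. z \<noteq> w \<and> quot_map a b (Some z) = quot_map a b (Some w) \<and>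
                quot_map p q (Some z) = quot_map p q (Some w)}"
  shows "\<exists>r s d. reduced r s d \<and> d \<ge> 2 \<and>
    finite {w. \<exists>z. quot_map r s (Some z) = quot_map r s (Some w) \<and>
      (quot_map a b (Some z) \<noteq> quot_map a b (Some w) \<or> quot_map p q (Some z) \<noteq> quot_map p q (Some w))}"
proof -
  define E where "E w = {z. quot_map a b (Some z) = quot_map a b (Some w) \<and>
      quot_map p q (Some z) = quot_map p q (Some w)}" for w
  have E_eq: "E z = E w" if "z \<in> E w" for z w using that by (auto simp: E_def)
  have E_sym: "z \<in> E w \<longleftrightarrow> w \<in> E z" for z w by (auto simp: E_def)
  have E_refl: "w \<in> E w" for w by (simp add: E_def)
  have E_fin: "finite (E w)" for w
  proof -
    have "finite (Some -` (quot_map p q -` {quot_map p q (Some w)}))"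
      by (rule finite_vimageI[OF finite_vimage_rational[OF Y]]) simp_all
    then show ?thesis by (rule finite_subset[rotated]) (auto simp: E_def)
  qed
  define A B where "A = pencil a b" and "B = pencil p q"
  have E_iff: "z \<in> E w \<longleftrightarrow> poly (eval_inner w A) z = 0 \<and> poly (eval_inner w B) z = 0" for z w
    unfolding E_def A_def B_def eval_inner_pencil
    using quot_map_eq_iff_cross[OF X(1), of z w] quot_map_eq_iff_cross[OF Y(1), of z w]
    by (auto simp: mult.commute)
  define N0 where "N0 = {w. poly q w = 0} \<union> {w. poly q w \<noteq> 0 \<and> \<not> good_value p q k (poly p w / poly q w)}"
  have finN0: "finite N0"
  proof -
    have "finite (Some -` (quot_map p q -` (Some ` {y. \<not> good_value p q k y})))"
      by (rule finite_vimageI[OF finite_vimage_rational[OF Y finite_imageI[OF finite_bad_values[OF Y]]]]) simp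
    moreover have "{w. poly q w \<noteq> 0 \<and> \<not> good_value p q k (poly p w / poly q w)} \<subseteq>
        Some -` (quot_map p q -` (Some ` {y. \<not> good_value p q k y}))"
      by (auto simp: quot_map_def)
    ultimately show ?thesis
      unfolding N0_def using poly_roots_finite[OF reducedD(2)[OF Y(1)]] finite_subset by blast
  qed
  have N0: "poly q w \<noteq> 0" "good_value p q k (poly p w / poly q w)" if "w \<notin> N0" for w
    using that by (auto simp: N0_def)
  have evB: "eval_inner w B \<noteq> 0" "\<And>z. poly (eval_inner w B) z = 0 \<Longrightarrow> order z (eval_inner w B) = 1"
    and Bz: "poly B [:w:] \<noteq> 0" "\<And>z. poly (poly B [:w:]) z = 0 \<Longrightarrow> order z (poly B [:w:]) = 1"
    if "w \<notin> N0" for w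
    unfolding B_def eval_inner_pencil poly_pencil
    using pencil_value[OF Y N0[OF that] disjI1[OF refl]] pencil_value[OF Y N0[OF that] disjI2[OF refl]]
    by blast+
  obtain w0 where "w0 \<notin> N0" using finN0 ex_new_if_finite infinite_UNIV_char_0 by metis
  then have B0: "B \<noteq> 0" using evB(1) by (auto simp: eval_inner_def)
  obtain D u v c where D: "c \<noteq> 0" "D dvd A" "D dvd B" "u * A + v * B = smult c D"
    using ideal_generator[OF B0, of A] by blast
  have D0: "D \<noteq> 0" using D(3) B0 by auto
  define \<delta> where "\<delta> = degree D"
  define h where "h i = coeff D i" for i
  have h\<delta>: "h \<delta> \<noteq> 0" using D0 by (simp add: h_def \<delta>_def)
  have ev_dvd: "eval_inner w f dvd eval_inner w g" if "f dvd g" for f g w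
    using that by (auto simp: eval_inner_mult elim!: dvdE)
  have root_imp_E: "z \<in> E w" if "poly (eval_inner w D) z = 0" for z w
    using that ev_dvd[OF D(2), of w] ev_dvd[OF D(3), of w] unfolding E_iff by (auto elim!: dvdE)
  have E_imp_root: "poly (eval_inner w D) z = 0" if "z \<in> E w" "poly c w \<noteq> 0" for z w
  proof -
    have "poly (poly (smult c D) [:z:]) w = 0"
      using that(1) unfolding D(4)[symmetric] E_iff poly_eval_inner by simp
    then show ?thesis using that(2) by (simp add: poly_eval_inner)
  qed
  \<comment> \<open>Outside \<open>N\<close> the Bezout identity can be divided by \<open>c\<close>
    and the leading coefficient survives, so \<open>D\<close> specialises to a polynomial whose
    roots are exactly the \<open>\<delta>\<close> points of \<open>E w\<close>, all simple.\<close>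
  define N where "N = N0 \<union> {w. poly c w = 0} \<union> {w. poly (h \<delta>) w = 0}"
  have finN: "finite N" using finN0 poly_roots_finite[OF D(1)] poly_roots_finite[OF h\<delta>] by (simp add: N_def)
  have roots_D: "{z. poly (eval_inner w D) z = 0} = E w" if "w \<notin> N" for w
    using that root_imp_E E_imp_root by (auto simp: N_def)
  have deg_ev: "degree (eval_inner w D) = \<delta>" "lead_coeff (eval_inner w D) = poly (h \<delta>) w" if "w \<notin> N" for w
  proof -
    have "degree (eval_inner w D) \<le> \<delta>" by (rule degree_le) (simp add: coeff_eval_inner \<delta>_def coeff_eq_0)
    moreover have "coeff (eval_inner w D) \<delta> \<noteq> 0" using that by (simp add: coeff_eval_inner N_def h_def)
    ultimately show *: "degree (eval_inner w D) = \<delta>" using le_degree le_antisym by blast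
    show "lead_coeff (eval_inner w D) = poly (h \<delta>) w" unfolding * by (simp add: coeff_eval_inner h_def)
  qed
  have proots_D: "proots (eval_inner w D) = mset_set (E w)" and card_E: "card (E w) = \<delta>" if w: "w \<notin> N" for w
  proof -
    have "w \<notin> N0" using w by (simp add: N_def)
    note c = card_roots_of_divisor[OF ev_dvd[OF D(3)] evB[OF this]]
    show "proots (eval_inner w D) = mset_set (E w)" "card (E w) = \<delta>"
      using c roots_D[OF w] deg_ev[OF w] by simp_all
  qed
  \<comment> \<open>Equivalent points have the same class, so the specialisations of
    \<open>D\<close> at \<open>w\<close> and at \<open>z\<close> are proportional: quotients of the
    \<open>h i\<close> are constant on generic classes.\<close>
  have hprop: "poly (h i) z * poly (h \<delta>) w = poly (h i) w * poly (h \<delta>) z"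
    if "w \<notin> N" "z \<notin> N" "z \<in> E w" for i w z
  proof -
    have "proots (eval_inner z D) = proots (eval_inner w D)" using proots_D that E_eq by simp
    from proportional_if_proots_eq[OF this]
    have "smult (poly (h \<delta>) w) (eval_inner z D) = smult (poly (h \<delta>) z) (eval_inner w D)" using deg_ev that by simp
    from arg_cong[OF this, of "\<lambda>f. coeff f i"] show ?thesis by (simp add: coeff_eval_inner h_def mult.commute)
  qed
  \<comment> \<open>Now \<open>z\<close> is fixed and roots in \<open>w\<close> are counted. For
    generic \<open>z\<close> they are simple and lie in the class of \<open>z\<close>, which has
    \<open>\<delta>\<close> points; this bounds the degree of \<open>D\<close> in
    \<open>w\<close>.\<close>
  have deg_h: "degree (h i) \<le> \<delta>" for i
  proof (cases "h i = 0")
    case False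
    define n where "n = degree (h i)"
    define t where "t = map_poly (\<lambda>c. coeff c n) D"
    have "coeff t i \<noteq> 0" using False by (simp add: t_def coeff_map_poly h_def n_def)
    then have "t \<noteq> 0" by auto
    then have "finite (N \<union> {z. poly t z = 0})" using finN poly_roots_finite by blast
    then obtain z where z: "z \<notin> N \<union> {z. poly t z = 0}" using ex_new_if_finite infinite_UNIV_char_0 by metis
    have coeff_t: "coeff (poly D' [:z:]) n = poly (map_poly (\<lambda>c. coeff c n) D') z" for D'
      by (induction D') (simp_all add: map_poly_pCons)
    have "n \<le> degree (poly D [:z:])" using z coeff_t[of D] by (intro le_degree) (simp add: t_def)
    also have "\<dots> = card {w. poly (poly D [:z:]) w = 0}"
    proof -
      have "poly D [:z:] dvd poly B [:z:]" using D(3) by (auto elim!: dvdE)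
      then show ?thesis using card_roots_of_divisor(2) Bz[of z] z by (auto simp: N_def)
    qed
    also have "\<dots> \<le> card (E z)"
      by (rule card_mono[OF E_fin]) (use root_imp_E E_sym in \<open>auto simp: poly_eval_inner\<close>)
    also have "\<dots> = \<delta>" using card_E z by simp
    finally show ?thesis by (simp add: n_def)
  qed simp
  obtain w1 where w1: "w1 \<notin> N" using finN ex_new_if_finite infinite_UNIV_char_0 by metis
  \<comment> \<open>Otherwise all specialisations of \<open>D\<close> would be proportional to the
    one at \<open>w1\<close>, and every \<open>w\<close> outside \<open>N\<close> would be among its
    finitely many roots.\<close>
  have "\<exists>i w2. poly (h i) w2 * poly (h \<delta>) w1 \<noteq> poly (h i) w1 * poly (h \<delta>) w2"
  proof (rule ccontr)
    assume "\<nexists>i w2. poly (h i) w2 * poly (h \<delta>) w1 \<noteq> poly (h i) w1 * poly (h \<delta>) w2"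
    then have eq: "poly (h i) w * poly (h \<delta>) w1 = poly (h i) w1 * poly (h \<delta>) w" for i w by blast
    have ev_eq: "smult (poly (h \<delta>) w1) (eval_inner w D) = smult (poly (h \<delta>) w) (eval_inner w1 D)" for w
      by (rule poly_eqI) (use eq[of _ w] in \<open>simp add: coeff_eval_inner h_def mult.commute\<close>)
    have "- N \<subseteq> {z. poly (eval_inner w1 D) z = 0}"
    proof
      fix w assume w: "w \<in> - N"
      then have "poly (eval_inner w D) w = 0" using roots_D E_refl by blast
      moreover have "poly (h \<delta>) w \<noteq> 0" using w by (simp add: N_def)
      ultimately show "w \<in> {z. poly (eval_inner w1 D) z = 0}"
        using arg_cong[OF ev_eq[of w], of "\<lambda>f. poly f w"] by simp
    qed
    then have "infinite {z. poly (eval_inner w1 D) z = 0}"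
      using finN finite_subset finite_compl infinite_UNIV_char_0 by metis
    then have "eval_inner w1 D = 0" using poly_roots_finite by blast
    then show False using deg_ev(2)[OF w1] w1 by (simp add: N_def)
  qed
  then obtain i w2 where iw: "poly (h i) w2 * poly (h \<delta>) w1 \<noteq> poly (h i) w1 * poly (h \<delta>) w2" by blast
  define g r s d where "g = gcd (h i) (h \<delta>)" and "r = h i div g" and "s = h \<delta> div g"
    and "d = max (degree r) (degree s)"
  have g0: "g \<noteq> 0" using h\<delta> by (simp add: g_def)
  have rg: "h i = r * g" and sg: "h \<delta> = s * g" by (simp_all add: r_def s_def g_def)
  have s0: "s \<noteq> 0" using sg h\<delta> by auto
  have cop: "coprime r s" unfolding r_def s_def g_def using div_gcd_coprime h\<delta> by blast
  have red: "reduced r s d" using cop s0 by (simp add: reduced_def d_def)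
  have "degree r \<le> degree (h i)"
    using rg g0 by (cases "r = 0") (simp_all add: degree_mult_eq)
  moreover have "degree s \<le> degree (h \<delta>)" using sg g0 s0 by (simp add: degree_mult_eq)
  ultimately have d\<delta>: "d \<le> \<delta>" using deg_h[of i] deg_h[of \<delta>] by (simp add: d_def)
  have d1: "d \<ge> 1"
  proof (rule ccontr)
    assume "\<not> d \<ge> 1"
    then have "degree r = 0" "degree s = 0" by (simp_all add: d_def)
    then obtain r0 s0 where "r = [:r0:]" "s = [:s0:]" by (meson degree_eq_zeroE)
    then show False using iw by (simp add: rg sg)
  qed
  \<comment> \<open>Enlarged by equivalent points: the class of a point outside \<open>M\<close>
    avoids \<open>N\<close> entirely.\<close>
  define M where "M = N \<union> (\<Union>z\<in>N. E z)"
  have finM: "finite M" using finN E_fin by (simp add: M_def)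
  have fibre: "{z. poly (r - smult (poly r w / poly s w) s) z = 0} = E w \<and> \<delta> \<le> d \<and> poly s w \<noteq> 0"
    if w: "w \<notin> M" for w
  proof -
    have wN: "w \<notin> N" using w by (simp add: M_def)
    have sw: "poly s w \<noteq> 0" using wN by (auto simp: N_def sg)
    define f where "f = r - smult (poly r w / poly s w) s"
    have f0: "f \<noteq> 0" using fib_nonzero[OF red d1] f_def by simp
    have sub: "E w \<subseteq> {z. poly f z = 0}"
    proof
      fix z assume z: "z \<in> E w"
      then have zN: "z \<notin> N" using w E_sym by (auto simp: M_def)
      have "poly g z \<noteq> 0" "poly g w \<noteq> 0" using zN wN by (auto simp: N_def sg)
      then have "poly r z * poly s w = poly r w * poly s z"
        using hprop[OF wN zN z, of i] by (simp add: rg sg)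
      then show "z \<in> {z. poly f z = 0}" using sw by (simp add: f_def field_simps)
    qed
    have "card {z. poly f z = 0} \<le> degree f" using card_poly_roots_bound[OF f0] .
    also have "\<dots> \<le> d" using degree_fib_le[OF red] f_def by simp
    finally have le: "card {z. poly f z = 0} \<le> d" .
    have ge: "\<delta> \<le> card {z. poly f z = 0}"
      using card_mono[OF poly_roots_finite[OF f0] sub] card_E[OF wN] by simp
    \<comment> \<open>The class has \<open>\<delta>\<close> points and the fibre containing it at
      most \<open>d \<le> \<delta>\<close>, so they coincide.\<close>
    have "E w = {z. poly f z = 0}"
      by (rule card_seteq[OF poly_roots_finite[OF f0] sub]) (use card_E[OF wN] le d\<delta> in simp)
    then show ?thesis using le ge sw by (simp add: f_def)
  qed
  have d2: "d \<ge> 2"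
  proof -
    have "infinite ({w. \<exists>z. z \<noteq> w \<and> quot_map a b (Some z) = quot_map a b (Some w) \<and>
                quot_map p q (Some z) = quot_map p q (Some w)} - M)"
      using inf finM by (simp add: Diff_infinite_finite)
    then obtain w z where w: "w \<notin> M" and z: "z \<noteq> w" "z \<in> E w"
      by (auto simp: E_def dest!: infinite_imp_nonempty)
    then have "card {z, w} \<le> card (E w)" using E_fin E_refl by (intro card_mono) auto
    also have "\<dots> = \<delta>" using card_E w by (simp add: M_def)
    also have "\<dots> \<le> d" using fibre w by blast
    finally show ?thesis using z by simp
  qed
  have "{w. \<exists>z. quot_map r s (Some z) = quot_map r s (Some w) \<and>
      (quot_map a b (Some z) \<noteq> quot_map a b (Some w) \<or> quot_map p q (Some z) \<noteq> quot_map p q (Some w))} \<subseteq> M"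
  proof (rule subsetI, rule ccontr)
    fix w assume w: "w \<in> {w. \<exists>z. quot_map r s (Some z) = quot_map r s (Some w) \<and>
      (quot_map a b (Some z) \<noteq> quot_map a b (Some w) \<or> quot_map p q (Some z) \<noteq> quot_map p q (Some w))}"
      and wM: "w \<notin> M"
    then obtain z where z: "quot_map r s (Some z) = quot_map r s (Some w)" "z \<notin> E w"
      by (auto simp: E_def)
    then have "quot_map r s (Some z) = Some (poly r w / poly s w)"
      using fibre[OF wM] by (simp add: quot_map_def)
    then have "poly (r - smult (poly r w / poly s w) s) z = 0"
      using quot_map_Some_eq_Some_iff[OF red] by blast
    then show False using fibre[OF wM] z(2) by blast
  qed
  then show ?thesis using red d2 finM finite_subset by blast
qed


text \<open>The map \<open>z \<mapsto> (X z, Y z)\<close> is birational onto its image.\<close>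

definition gen_inj :: "(sphere \<Rightarrow> sphere) \<Rightarrow> (sphere \<Rightarrow> sphere) \<Rightarrow> bool" where
  "gen_inj X Y \<longleftrightarrow> finite {w. \<exists>z. z \<noteq> w \<and> X z = X w \<and> Y z = Y w}"

text \<open>Induction on the degree of \<open>Y\<close>: as long as infinitely many points have a
  partner, a common right factor of degree at least two splits off from both maps and the degree of
  \<open>Y\<close> drops.\<close>

lemma gen_inj_factorisation:
  assumes "rational_function X" "rat_degree X \<ge> 1" "rational_function Y" "rat_degree Y \<ge> 1"
  shows "\<exists>W X1 Y1. rational_function W \<and> rational_function X1 \<and> rat_degree X1 \<ge> 1 \<and>
    rational_function Y1 \<and> rat_degree Y1 \<ge> 1 \<and> rat_degree W \<ge> 1 \<and>
    X = X1 \<circ> W \<and> Y = Y1 \<circ> W \<and> gen_inj X1 Y1"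
  using assms
proof (induction "rat_degree Y" arbitrary: X Y rule: less_induct)
  case less
  show ?case
  proof (cases "gen_inj X Y")
    case True
    then show ?thesis using moebius_id[unfolded moebius_iff] less.prems by (intro exI[of _ id] exI[of _ X] exI[of _ Y]) simp
  next
    case False
    obtain a b where X: "reduced a b (rat_degree X)" "X = quot_map a b"
      using less.prems(1) by (rule rational_functionE)
    obtain p q where Y: "reduced p q (rat_degree Y)" "Y = quot_map p q"
      using less.prems(3) by (rule rational_functionE)
    define T where "T = {w. \<exists>z. z \<noteq> w \<and> quot_map a b (Some z) = quot_map a b (Some w) \<and>
                quot_map p q (Some z) = quot_map p q (Some w)}"
    \<comment> \<open>Pairs involving infinity account for only finitely many
      \<open>w\<close>.\<close>
    have "{w. \<exists>z. z \<noteq> w \<and> X z = X w \<and> Y z = Y w} \<subseteq> Some ` T \<union> {None} \<union> Y -` {Y None}"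
    proof
      fix w assume "w \<in> {w. \<exists>z. z \<noteq> w \<and> X z = X w \<and> Y z = Y w}"
      then obtain z where z: "z \<noteq> w" "X z = X w" "Y z = Y w" by blast
      then show "w \<in> Some ` T \<union> {None} \<union> Y -` {Y None}"
      proof (cases "w = None \<or> z = None")
        case False
        then obtain w' z' where "w = Some w'" "z = Some z'" by auto
        then show ?thesis using z by (auto simp: T_def X(2) Y(2))
      qed auto
    qed
    moreover have "finite (Y -` {Y None})"
      using finite_vimage_rational[OF Y(1) less.prems(4)] Y(2) by blast
    ultimately have infT: "infinite T" using False finite_subset unfolding gen_inj_def by blast
    obtain r s d where W: "reduced r s d" "d \<ge> 2" and
      fin: "finite {w. \<exists>z. quot_map r s (Some z) = quot_map r s (Some w) \<and>
        (quot_map a b (Some z) \<noteq> quot_map a b (Some w) \<or> quot_map p q (Some z) \<noteq> quot_map p q (Some w))}"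
      using common_right_factor[OF X(1) less.prems(2) Y(1) less.prems(4)] infT unfolding T_def by blast
    define W where "W = quot_map r s"
    have rW: "rational_function W" "rat_degree W = d"
      using W(1) rational_function_iff rat_degree_reduced unfolding W_def by blast+
    have "finite {w. \<exists>z. quot_map r s (Some z) = quot_map r s (Some w) \<and>
        quot_map a b (Some z) \<noteq> quot_map a b (Some w)}"
      "finite {w. \<exists>z. quot_map r s (Some z) = quot_map r s (Some w) \<and>
        quot_map p q (Some z) \<noteq> quot_map p q (Some w)}"
      by (rule finite_subset[OF _ fin], blast)+
    then obtain X' Y' where XY: "rational_function X'" "X = X' \<circ> W" "rational_function Y'" "Y = Y' \<circ> W"
      using factor_through[OF X(1) less.prems(2) W(1)] factor_through[OF Y(1) less.prems(4) W(1)] W(2)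
        rational_function_iff X(2) Y(2) unfolding W_def by (metis one_le_numeral order_trans)
    have deg: "rat_degree X = rat_degree X' * d" "rat_degree Y = rat_degree Y' * d"
      using rational_function_comp(2)[OF XY(1) rW(1)] rational_function_comp(2)[OF XY(3) rW(1)] rW(2) W(2) XY
      by simp_all
    have deg': "rat_degree X' \<ge> 1" "rat_degree Y' \<ge> 1"
      using deg less.prems by (auto simp: Suc_le_eq intro: gr0I)
    then have "rat_degree Y' < rat_degree Y" using deg(2) W(2) by simp
    from less.hyps[OF this XY(1) deg'(1) XY(3) deg'(2)]
    obtain W' X1 Y1 where *: "rational_function W'" "rational_function X1" "rat_degree X1 \<ge> 1"
      "rational_function Y1" "rat_degree Y1 \<ge> 1" "rat_degree W' \<ge> 1"
      "X' = X1 \<circ> W'" "Y' = Y1 \<circ> W'" "gen_inj X1 Y1" by blast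
    have "rational_function (W' \<circ> W)" "rat_degree (W' \<circ> W) \<ge> 1"
      using rational_function_comp[OF *(1) rW(1)] rW(2) W(2) *(6) by simp_all
    moreover have "X = X1 \<circ> (W' \<circ> W)" "Y = Y1 \<circ> (W' \<circ> W)" using XY * by (simp_all add: comp_assoc)
    ultimately show ?thesis using * by blast
  qed
qed

section \<open>A bound for coincident fibre points\<close>

text \<open>Induction on the degree bound: division by \<open>y - y0\<close> yields difference
  quotients of smaller degree, which converge at the remaining points of \<open>S\<close>.\<close>

lemma tendsto_poly_if_tendsto_pointwise:
  fixes f :: "'x \<Rightarrow> complex poly"
  assumes "\<And>x. degree (f x) \<le> N" "finite S" "card S > N"
    and "\<And>y. y \<in> S \<Longrightarrow> \<exists>l. ((\<lambda>x. poly (f x) y) \<longlongrightarrow> l) F"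
  shows "\<exists>g. \<forall>y. ((\<lambda>x. poly (f x) y) \<longlongrightarrow> poly g y) F"
  using assms
proof (induction N arbitrary: f S)
  case 0
  then obtain y0 where y0: "y0 \<in> S" by fastforce
  then obtain l where l: "((\<lambda>x. poly (f x) y0) \<longlongrightarrow> l) F" using 0(4) by blast
  have "poly (f x) y = poly (f x) y0" for x y
    using 0(1)[of x] by (auto elim!: degree_eq_zeroE)
  then have "(\<lambda>x. poly (f x) y) = (\<lambda>x. poly (f x) y0)" for y by (intro ext)
  then have "((\<lambda>x. poly (f x) y) \<longlongrightarrow> poly [:l:] y) F" for y using l by (metis poly_const_conv)
  then show ?case by blast
next
  case (Suc N)
  then obtain y0 where y0: "y0 \<in> S" by fastforce
  then obtain l where l: "((\<lambda>x. poly (f x) y0) \<longlongrightarrow> l) F" using Suc.prems(4) by blast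
  define h where "h x = synthetic_div (f x) y0" for x
  have f: "poly (f x) y = (y - y0) * poly (h x) y + poly (f x) y0" for x y
    using arg_cong[OF synthetic_div_correct'[of y0 "f x"], of "\<lambda>p. poly p y"] by (simp add: h_def algebra_simps)
  have "\<exists>g. \<forall>y. ((\<lambda>x. poly (h x) y) \<longlongrightarrow> poly g y) F"
  proof (rule Suc.IH)
    show "degree (h x) \<le> N" for x using Suc.prems(1)[of x] by (simp add: h_def degree_synthetic_div)
    show "finite (S - {y0})" "N < card (S - {y0})" using Suc.prems y0 by simp_all
    fix y assume y: "y \<in> S - {y0}"
    then obtain l' where l': "((\<lambda>x. poly (f x) y) \<longlongrightarrow> l') F" using Suc.prems(4) by blast
    have "poly (h x) y = (poly (f x) y - poly (f x) y0) / (y - y0)" for x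
      using f[of x y] y by simp
    then show "\<exists>l. ((\<lambda>x. poly (h x) y) \<longlongrightarrow> l) F"
      using tendsto_divide[OF tendsto_diff[OF l' l] tendsto_const, of "y - y0"] y by auto
  qed
  then obtain g where g: "\<And>y. ((\<lambda>x. poly (h x) y) \<longlongrightarrow> poly g y) F" by blast
  have "((\<lambda>x. poly (f x) y) \<longlongrightarrow> poly ([:- y0, 1:] * g + [:l:]) y) F" for y
  proof -
    have "(\<lambda>x. poly (f x) y) = (\<lambda>x. (y - y0) * poly (h x) y + poly (f x) y0)"
      by (intro ext) (rule f)
    moreover have "poly ([:- y0, 1:] * g + [:l:]) y = (y - y0) * poly g y + l"
      by (simp add: algebra_simps)
    ultimately show ?thesis using tendsto_add[OF tendsto_mult[OF tendsto_const g] l] by simp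
  qed
  then show ?case by blast
qed

lemma prod_linear_dvd:
  fixes g :: "'a :: idom poly"
  assumes "finite S" "\<And>y. y \<in> S \<Longrightarrow> poly g y = 0"
  shows "(\<Prod>y\<in>S. [:- y, 1:]) dvd g"
  using assms
proof (induction S arbitrary: g)
  case (insert y S)
  from insert.prems[of y] obtain g' where g': "g = [:- y, 1:] * g'"
    unfolding poly_eq_0_iff_dvd by (auto elim: dvdE)
  have "poly g' y' = 0" if "y' \<in> S" for y'
    using insert.prems[of y'] insert.hyps that g' by auto
  then have "(\<Prod>y\<in>S. [:- y, 1:]) dvd g'" by (rule insert.IH)
  then have "[:- y, 1:] * (\<Prod>y\<in>S. [:- y, 1:]) dvd g" unfolding g' by (rule mult_dvd_mono[OF dvd_refl])
  then show ?case using insert.hyps by simp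
qed simp

lemma poly_prod_mset_image: "poly (\<Prod>v\<in>#P. f v) y = (\<Prod>v\<in>#P. poly (f v) y)"
  by (induction P) simp_all

lemma poly_eq_prod_proots:
  fixes g :: "complex poly"
  shows "poly g v = lead_coeff g * (\<Prod>w\<in>#proots g. v - w)"
proof -
  have "poly g v = poly (smult (lead_coeff g) (\<Prod>x\<in>#proots g. [:- x, 1:])) v"
    by (simp only: complex_poly_decompose_multiset)
  then show ?thesis by (simp add: poly_prod_mset_image)
qed

lemma prod_mset_const_mult:
  fixes c :: "'a :: comm_monoid_mult"
  shows "(\<Prod>v\<in>#P. c * f v) = c ^ size P * (\<Prod>v\<in>#P. f v)"
  by (induction P) (simp_all add: ac_simps)

text \<open>Both sides are the resultant, a product of differences over all pairs of roots. It
  trades a product over the moving roots of \<open>f\<close> for one over the roots of a fixed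
  \<open>g\<close>.\<close>

lemma resultant_swap_proots:
  fixes f g :: "complex poly"
  shows "lead_coeff f ^ degree g * (\<Prod>v\<in>#proots f. poly g v) =
    (- 1) ^ (degree f * degree g) * (lead_coeff g ^ degree f * (\<Prod>w\<in>#proots g. poly f w))"
proof -
  have 1: "(\<Prod>v\<in>#proots f. poly g v) =
      lead_coeff g ^ degree f * (\<Prod>v\<in>#proots f. \<Prod>w\<in>#proots g. v - w)"
    unfolding poly_eq_prod_proots[of g] prod_mset_const_mult size_proots_complex ..
  have 2: "(\<Prod>w\<in>#proots g. poly f w) =
      lead_coeff f ^ degree g * (\<Prod>w\<in>#proots g. \<Prod>v\<in>#proots f. w - v)"
    unfolding poly_eq_prod_proots[of f] prod_mset_const_mult size_proots_complex ..
  have "(\<Prod>v\<in>#proots f. w - v) = (- 1) ^ degree f * (\<Prod>v\<in>#proots f. v - w)" for w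
    using prod_mset_const_mult[of "- 1" "\<lambda>v. v - w" "proots f"] by (simp add: size_proots_complex)
  then have "(\<Prod>w\<in>#proots g. \<Prod>v\<in>#proots f. w - v) =
      ((- 1) ^ degree f) ^ degree g * (\<Prod>w\<in>#proots g. \<Prod>v\<in>#proots f. v - w)"
    by (simp add: prod_mset_const_mult size_proots_complex)
  also have "(\<Prod>w\<in>#proots g. \<Prod>v\<in>#proots f. v - w) = (\<Prod>v\<in>#proots f. \<Prod>w\<in>#proots g. v - w)"
    by (rule prod_mset.swap)
  finally have "(\<Prod>w\<in>#proots g. \<Prod>v\<in>#proots f. w - v) =
      (- 1) ^ (degree f * degree g) * (\<Prod>v\<in>#proots f. \<Prod>w\<in>#proots g. v - w)"
    by (simp only: power_mult)
  moreover have "(- 1 :: complex) ^ (degree f * degree g) * (- 1) ^ (degree f * degree g) = 1"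
    by (simp flip: power_add)
  ultimately show ?thesis unfolding 1 2 by (simp add: ac_simps)
qed

text \<open>A factor with \<open>\<beta> v = 0\<close> is a nonzero constant: such a
  \<open>v\<close> is sent to infinity and contributes no root.\<close>

lemma order_prod_linear:
  fixes \<alpha> \<beta> :: "complex \<Rightarrow> complex"
  assumes "\<And>v. v \<in># P \<Longrightarrow> \<beta> v = 0 \<Longrightarrow> \<alpha> v \<noteq> 0"
  shows "(\<Prod>v\<in>#P. [:\<alpha> v, - \<beta> v:]) \<noteq> 0 \<and>
    order y (\<Prod>v\<in>#P. [:\<alpha> v, - \<beta> v:]) = size {#v \<in># P. \<alpha> v = y * \<beta> v#}"
  using assms
proof (induction P)
  case (add v P)
  define M where "M = (\<Prod>v\<in>#P. [:\<alpha> v, - \<beta> v:])"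
  have IH: "M \<noteq> 0" "order y M = size {#v \<in># P. \<alpha> v = y * \<beta> v#}" using add by (auto simp: M_def)
  have nz: "[:\<alpha> v, - \<beta> v:] \<noteq> 0" using add.prems by auto
  have "order y [:\<alpha> v, - \<beta> v:] = (if \<alpha> v = y * \<beta> v then 1 else 0)"
  proof (cases "\<alpha> v = y * \<beta> v")
    case True
    then have b: "\<beta> v \<noteq> 0" using add.prems by auto
    have "[:\<alpha> v, - \<beta> v:] = smult (- \<beta> v) [:- y, 1:]" using True by simp
    then have "order y [:\<alpha> v, - \<beta> v:] = order y [:- y, 1:]" using b order_smult by (metis neg_equal_0_iff_equal)
    then show ?thesis using order_power_n_n[of y 1] True by simp
  qed (simp add: order_0I)
  moreover have "order y ([:\<alpha> v, - \<beta> v:] * M) = order y [:\<alpha> v, - \<beta> v:] + order y M"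
    using nz IH(1) by (intro order_mult) (metis mult_eq_0_iff)
  ultimately show ?case using IH nz by (simp add: M_def[symmetric] del: mult_pCons_left)
qed simp

text \<open>For generic \<open>x\<close> the polynomial with roots \<open>Y v\<close>, \<open>v \<in> X\<^sup>-\<^sup>1 x\<close>, divides the numerator of
  \<open>G y - F x\<close>; the divisibility persists in the limit \<open>x \<rightarrow> u\<close>, where it compares multiplicities.\<close>

lemma sum_order_le_order:
  assumes F: "reduced A B m" and G: "reduced C E n" "n \<ge> 1"
    and X: "reduced a b j" "j \<ge> 1" and Y: "reduced p q k" "k \<ge> 1"
    and comm: "quot_map A B \<circ> quot_map a b = quot_map C E \<circ> quot_map p q"
    and inj: "gen_inj (quot_map a b) (quot_map p q)"
    and u: "quot_map a b None \<noteq> Some u" "poly B u \<noteq> 0"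
  shows "(\<Sum>v | poly (a - smult u b) v = 0 \<and> poly (p - smult y q) v = 0. order v (a - smult u b))
    \<le> order y (C - smult (poly A u / poly B u) E)"
proof -
  define M where "M x = (\<Prod>v\<in>#proots (a - smult x b). [:poly p v, - poly q v:])" for x
  define \<Psi> where "\<Psi> x = smult (poly A x) E - smult (poly B x) C" for x
  define Bad0 where "Bad0 = {v. poly q v = 0} \<union> {w. \<exists>z. z \<noteq> Some w \<and>
    quot_map a b z = quot_map a b (Some w) \<and> quot_map p q z = quot_map p q (Some w)}"
  have "finite Bad0"
  proof -
    have "finite (Some -` {w. \<exists>z. z \<noteq> w \<and> quot_map a b z = quot_map a b w \<and> quot_map p q z = quot_map p q w})"
      using inj unfolding gen_inj_def by (rule finite_vimageI) simp
    then show ?thesis using poly_roots_finite[OF reducedD(2)[OF Y(1)]] by (simp add: Bad0_def vimage_def)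
  qed
  define Bad where "Bad = {x. \<not> good_value a b j x} \<union> (\<lambda>v. poly a v / poly b v) ` Bad0"
  have finBad: "finite Bad" using \<open>finite Bad0\<close> finite_bad_values[OF X] by (simp add: Bad_def)
  have M0: "M x \<noteq> 0" and ordM: "order y (M x) = size {#v \<in># proots (a - smult x b). poly p v = y * poly q v#}" for x y
    using order_prod_linear[of "proots (a - smult x b)" "poly q" "poly p" y]
      reduced_no_common_root[OF Y(1)] unfolding M_def by blast+
  have dvd: "M x dvd \<Psi> x" if x: "x \<notin> Bad" for x
  proof -
    define R where "R = {v. poly (a - smult x b) v = 0}"
    define \<eta> where "\<eta> v = poly p v / poly q v" for v
    have gx: "good_value a b j x" using x by (simp add: Bad_def)
    have f0: "a - smult x b \<noteq> 0" by (rule fib_nonzero[OF X])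
    have finR: "finite R" unfolding R_def by (rule poly_roots_finite[OF f0])
    have pr: "proots (a - smult x b) = mset_set R"
      using card_roots_of_divisor(1)[OF dvd_refl f0] gx by (simp add: R_def good_value_def)
    have R0: "v \<notin> Bad0" if "v \<in> R" for v
    proof
      assume "v \<in> Bad0"
      then have "poly a v / poly b v \<in> Bad" by (simp add: Bad_def)
      then show False using that x fib_root(2)[OF X(1)] by (simp add: R_def)
    qed
    then have q0: "poly q v \<noteq> 0" if "v \<in> R" for v using that by (auto simp: Bad0_def)
    have XR: "quot_map a b (Some v) = Some x" if "v \<in> R" for v
      using that quot_map_Some_eq_Some_iff[OF X(1)] by (simp add: R_def)
    have inj\<eta>: "inj_on \<eta> R"
    proof (rule inj_onI, rule ccontr)
      fix v w assume vw: "v \<in> R" "w \<in> R" "\<eta> v = \<eta> w" "v \<noteq> w"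
      have "quot_map a b (Some v) = quot_map a b (Some w)"
        using XR[OF vw(1)] XR[OF vw(2)] by simp
      moreover have "quot_map p q (Some v) = quot_map p q (Some w)"
        using vw q0 by (simp add: quot_map_def \<eta>_def)
      ultimately have "w \<in> Bad0" using vw by (auto simp: Bad0_def)
      then show False using R0 vw by blast
    qed
    have root: "poly (\<Psi> x) (\<eta> v) = 0" if v: "v \<in> R" for v
    proof -
      have "quot_map a b (Some v) = Some x" by (rule XR[OF v])
      moreover have "quot_map p q (Some v) = Some (\<eta> v)" using q0[OF v] by (simp add: quot_map_def \<eta>_def)
      ultimately have "quot_map A B (Some x) = quot_map C E (Some (\<eta> v))"
        using fun_cong[OF comm, of "Some v"] by simp
      then show ?thesis
        using reduced_no_common_root[OF F, of x] reduced_no_common_root[OF G(1), of "\<eta> v"]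
        by (auto simp: \<Psi>_def quot_map_def field_simps split: if_splits)
    qed
    have "M x = (\<Prod>v\<in>R. [:poly p v, - poly q v:])" by (simp add: M_def pr prod_unfold_prod_mset)
    also have "\<dots> = (\<Prod>v\<in>R. [:- poly q v:] * [:- \<eta> v, 1:])"
      using q0 by (intro prod.cong) (auto simp: \<eta>_def)
    also have "\<dots> = (\<Prod>v\<in>R. [:- poly q v:]) * (\<Prod>y\<in>\<eta> ` R. [:- y, 1:])"
      by (simp only: prod.distrib prod.reindex[OF inj\<eta>] comp_def)
    finally have Mx: "M x = (\<Prod>v\<in>R. [:- poly q v:]) * (\<Prod>y\<in>\<eta> ` R. [:- y, 1:])" .
    have "(\<Prod>v\<in>R. [:- poly q v:]) = [:\<Prod>v\<in>R. - poly q v:]"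
      by (induction R rule: infinite_finite_induct) (simp_all add: one_pCons)
    moreover have "(\<Prod>v\<in>R. - poly q v) \<noteq> 0" using q0 finR by simp
    ultimately have "is_unit (\<Prod>v\<in>R. [:- poly q v:])" by (simp add: is_unit_const_poly_iff dvd_field_iff)
    moreover have "(\<Prod>y\<in>\<eta> ` R. [:- y, 1:]) dvd \<Psi> x"
      by (rule prod_linear_dvd) (use finR root in auto)
    ultimately show ?thesis unfolding Mx by (simp add: mult_unit_dvd_iff')
  qed
  \<comment> \<open>The roots of \<open>a - smult x b\<close> need not be followed as
    \<open>x\<close> moves: by the resultant identity \<open>poly (M x) y\<close> is a product over
    the fixed fibre above \<open>y\<close>, hence a rational function of \<open>x\<close> that is
    continuous at \<open>u\<close>.\<close>
  have limM: "((\<lambda>x. poly (M x) y) \<longlongrightarrow> poly (M u) y) (at u)" if y: "quot_map p q None \<noteq> Some y" for y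
  proof -
    define P where "P = (\<Prod>w\<in>#proots (p - smult y q). [:poly a w, - poly b w:])"
    define K where "K = (- 1) ^ (j * k) * lead_coeff (p - smult y q) ^ j"
    have dk: "degree (p - smult y q) = k" by (rule degree_fib[OF Y(1) y])
    have form: "poly (M x) y = K * poly P x / (coeff a j - x * coeff b j) ^ k"
      if "coeff a j - x * coeff b j \<noteq> 0" for x
    proof -
      have dj: "degree (a - smult x b) = j"
        using that degree_fib_le[OF X(1), of x] by (intro le_antisym le_degree) simp_all
      have "(coeff a j - x * coeff b j) ^ k * poly (M x) y = K * poly P x"
        using resultant_swap_proots[of "a - smult x b" "p - smult y q"]
        by (simp add: dj dk M_def P_def K_def poly_prod_mset_image mult.assoc)
      then show ?thesis using that by (simp add: field_simps)
    qed
    have nz: "coeff a j - u * coeff b j \<noteq> 0"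
      using u(1) quot_map_None_eq_Some_iff[OF X(1)] by simp
    have "((\<lambda>x. K * poly P x / (coeff a j - x * coeff b j) ^ k) \<longlongrightarrow>
        K * poly P u / (coeff a j - u * coeff b j) ^ k) (at u)"
      using nz by (intro tendsto_intros) simp
    moreover have "\<forall>\<^sub>F x in at u. coeff a j - x * coeff b j \<noteq> 0"
      by (rule tendsto_imp_eventually_ne[OF _ nz]) (intro tendsto_intros)
    then have "\<forall>\<^sub>F x in at u. K * poly P x / (coeff a j - x * coeff b j) ^ k = poly (M x) y"
      by eventually_elim (simp add: form)
    ultimately show ?thesis unfolding form[OF nz] by (rule Lim_transform_eventually)
  qed
  \<comment> \<open>The value \<open>0\<close> at exceptional \<open>x\<close> keeps the degree
    bound valid for every \<open>x\<close>.\<close>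
  define Q where "Q x = (if x \<in> Bad then 0 else \<Psi> x div M x)" for x
  have QM: "\<Psi> x = M x * Q x" if "x \<notin> Bad" for x using dvd[OF that] that by (simp add: Q_def)
  have degQ: "degree (Q x) \<le> n" for x
  proof (cases "x \<in> Bad \<or> Q x = 0")
    case False
    then have "degree (\<Psi> x) = degree (M x) + degree (Q x)" using QM M0 by (simp add: degree_mult_eq)
    moreover have "degree (\<Psi> x) \<le> n" unfolding \<Psi>_def
      by (intro degree_diff_le) (metis degree_smult_le le_trans reducedD(3,4)[OF G(1)])+
    ultimately show ?thesis by simp
  qed (auto simp: Q_def)
  have "open (- (Bad - {u}))" using finBad by (intro open_Compl finite_imp_closed) simp
  then have nBad: "\<forall>\<^sub>F x in at u. x \<notin> Bad"
    unfolding eventually_at_topological by (intro exI[of _ "- (Bad - {u})"]) simp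
  have lim\<Psi>: "((\<lambda>x. poly (\<Psi> x) y) \<longlongrightarrow> poly (\<Psi> u) y) (at u)" for y
    unfolding \<Psi>_def by (simp, intro tendsto_intros)
  define H where "H = {y. poly (M u) y \<noteq> 0} - {y. quot_map p q None = Some y}"
  have infH: "infinite H"
  proof -
    have "finite {y. quot_map p q None = Some y}"
      by (rule finite_subset[of _ "{the (quot_map p q None)}"]) auto
    then show ?thesis unfolding H_def using infinite_nonroots[OF M0] by (rule Diff_infinite_finite)
  qed
  have limQ: "((\<lambda>x. poly (Q x) y) \<longlongrightarrow> poly (\<Psi> u) y / poly (M u) y) (at u)" if y: "y \<in> H" for y
  proof -
    have My: "poly (M u) y \<noteq> 0" and yN: "quot_map p q None \<noteq> Some y" using y by (auto simp: H_def)
    have lim: "((\<lambda>x. poly (\<Psi> x) y / poly (M x) y) \<longlongrightarrow> poly (\<Psi> u) y / poly (M u) y) (at u)"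
      by (rule tendsto_divide[OF lim\<Psi> limM[OF yN] My])
    have "\<forall>\<^sub>F x in at u. poly (M x) y \<noteq> 0" by (rule tendsto_imp_eventually_ne[OF limM[OF yN] My])
    then have "\<forall>\<^sub>F x in at u. poly (\<Psi> x) y / poly (M x) y = poly (Q x) y"
      using nBad by eventually_elim (simp add: QM)
    with lim show ?thesis by (rule Lim_transform_eventually)
  qed
  \<comment> \<open>The quotients have degree at most \<open>n\<close>, so convergence at
    \<open>Suc n\<close> points forces convergence to a polynomial.\<close>
  obtain S where S: "S \<subseteq> H" "finite S" "card S = Suc n"
    using infinite_arbitrarily_large[OF infH] by blast
  have "\<exists>g. \<forall>y. ((\<lambda>x. poly (Q x) y) \<longlongrightarrow> poly g y) (at u)"
    by (rule tendsto_poly_if_tendsto_pointwise[OF degQ S(2)]) (use S limQ in auto)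
  then obtain g where g: "\<And>y. ((\<lambda>x. poly (Q x) y) \<longlongrightarrow> poly g y) (at u)" by blast
  have "\<Psi> u = M u * g"
  proof (rule poly_eq_if_infinite)
    have "H \<subseteq> {z. poly (\<Psi> u) z = poly (M u * g) z}"
    proof
      fix y assume y: "y \<in> H"
      have "poly g y = poly (\<Psi> u) y / poly (M u) y"
        by (rule tendsto_unique[OF _ g limQ[OF y]]) simp
      then show "y \<in> {z. poly (\<Psi> u) z = poly (M u * g) z}" using y by (simp add: H_def)
    qed
    then show "infinite {z. poly (\<Psi> u) z = poly (M u * g) z}" using infH finite_subset by blast
  qed
  then have dvdu: "M u dvd \<Psi> u" by simp
  have \<Psi>u: "\<Psi> u = smult (- poly B u) (C - smult (poly A u / poly B u) E)"
    using u(2) by (simp add: \<Psi>_def smult_diff_right)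
  have G0: "C - smult (poly A u / poly B u) E \<noteq> 0" by (rule fib_nonzero[OF G])
  have "order y (M u) \<le> order y (\<Psi> u)"
    by (rule dvd_imp_order_le[OF _ dvdu]) (use \<Psi>u u(2) G0 in simp)
  also have "\<dots> = order y (C - smult (poly A u / poly B u) E)"
    unfolding \<Psi>u using u(2) by (intro order_smult) simp
  also have "order y (M u) = (\<Sum>v | poly (a - smult u b) v = 0 \<and> poly (p - smult y q) v = 0. order v (a - smult u b))"
  proof -
    have f0: "a - smult u b \<noteq> 0" by (rule fib_nonzero[OF X])
    have "order y (M u) = (\<Sum>v\<in>set_mset {#v \<in># proots (a - smult u b). poly p v = y * poly q v#}.
        count {#v \<in># proots (a - smult u b). poly p v = y * poly q v#} v)"
      unfolding ordM by (rule size_multiset_overloaded_eq)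
    also have "\<dots> = (\<Sum>v | poly (a - smult u b) v = 0 \<and> poly (p - smult y q) v = 0. order v (a - smult u b))"
      using f0 by (intro sum.cong) auto
    finally show ?thesis .
  qed
  finally show ?thesis .
qed

section \<open>Ramification count over a simple function\<close>

lemma sum_order_on_le_degree:
  fixes f :: "complex poly"
  assumes "f \<noteq> 0" "finite S"
  shows "(\<Sum>v\<in>S. order v f) \<le> degree f"
proof -
  have "(\<Sum>v\<in>S. order v f) = (\<Sum>v\<in>S \<inter> {v. poly f v = 0}. order v f)"
    using assms(2) by (intro sum.mono_neutral_right) (auto simp: order_0I)
  also have "\<dots> \<le> (\<Sum>v | poly f v = 0. order v f)"
    using poly_roots_finite[OF assms(1)] by (intro sum_mono2) auto
  also have "\<dots> = degree f" by (rule sum_order_complex[OF assms(1)])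
  finally show ?thesis .
qed

lemma sum_sum_order_le_degree:
  fixes f :: "complex poly" and S :: "'i \<Rightarrow> complex set"
  assumes "f \<noteq> 0" "finite R" "\<And>y. y \<in> R \<Longrightarrow> finite (S y)"
    "\<And>y y' v. y \<in> R \<Longrightarrow> y' \<in> R \<Longrightarrow> v \<in> S y \<Longrightarrow> v \<in> S y' \<Longrightarrow> y = y'"
  shows "(\<Sum>y\<in>R. \<Sum>v\<in>S y. order v f) \<le> degree f"
proof -
  have "(\<Sum>y\<in>R. \<Sum>v\<in>S y. order v f) = (\<Sum>v\<in>(\<Union>y\<in>R. S y). order v f)"
    using assms by (intro sum.UNION_disjoint[symmetric]) blast+
  also have "\<dots> \<le> degree f" using assms by (intro sum_order_on_le_degree) auto
  finally show ?thesis .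
qed

lemma order_eq_1_if_card_roots:
  fixes f :: "complex poly"
  assumes "f \<noteq> 0" "degree f \<le> card {z. poly f z = 0}" "poly f z = 0"
  shows "order z f = 1"
proof (rule ccontr)
  assume *: "order z f \<noteq> 1"
  have pos: "1 \<le> order v f" if "poly f v = 0" for v
    using that assms(1) by (simp add: order_gt_0_iff Suc_le_eq)
  have "1 < order z f" using * pos[OF assms(3)] by simp
  then have "(\<Sum>v | poly f v = 0. 1) < (\<Sum>v | poly f v = 0. order v f)"
    using pos assms(3) poly_roots_finite[OF assms(1)] by (intro sum_strict_mono_ex1) auto
  then show False using assms(2) sum_order_complex[OF assms(1)] by simp
qed

lemma card_vimage_Some:
  assumes "reduced a b j" "j \<ge> 1"
  shows "card (quot_map a b -` {Some x}) =
    card {z. poly (a - smult x b) z = 0} + (if quot_map a b None = Some x then 1 else 0)"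
proof -
  have fin: "finite {z. poly (a - smult x b) z = 0}" by (rule poly_roots_finite[OF fib_nonzero[OF assms]])
  have "quot_map a b -` {Some x} = Some ` {z. poly (a - smult x b) z = 0} \<union>
      (if quot_map a b None = Some x then {None} else {})" (is "?L = ?R")
  proof (intro set_eqI)
    fix w show "w \<in> ?L \<longleftrightarrow> w \<in> ?R"
    proof (cases w)
      case (Some z)
      have "Some z \<in> Some ` {z. poly (a - smult x b) z = 0} \<longleftrightarrow> poly (a - smult x b) z = 0" by blast
      then show ?thesis using quot_map_Some_eq_Some_iff[OF assms(1), of z x] Some by auto
    qed auto
  qed
  then have "card (quot_map a b -` {Some x}) = card (Some ` {z. poly (a - smult x b) z = 0}) +
      (if quot_map a b None = Some x then 1 else 0)"
    using fin by auto
  then show ?thesis by (simp add: card_image)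
qed

lemma homog_fib: "homog d (f - smult c g) a b = homog d f a b - smult c (homog d g a b)"
proof -
  have "f - smult c g = f + smult (- c) g" by simp
  then have "homog d (f - smult c g) a b = homog d f a b + smult (- c) (homog d g a b)"
    by (simp only: homog_add homog_smult)
  then show ?thesis by simp
qed

lemma quadratic_poly_eq:
  fixes p :: "complex poly"
  assumes "degree p \<le> 2"
  shows "p = [:coeff p 0, coeff p 1, coeff p 2:]"
proof (rule poly_eqI)
  fix i show "coeff p i = coeff [:coeff p 0, coeff p 1, coeff p 2:] i"
  proof (cases "i \<le> 2")
    case True
    then have "i = 0 \<or> i = 1 \<or> i = 2" by linarith
    then show ?thesis by (auto simp: numeral_2_eq_2)
  next
    case False
    then show ?thesis using assms by (simp add: coeff_eq_0 coeff_pCons split: nat.split)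
  qed
qed

text \<open>The involution \<open>z \<mapsto> - (\<beta> z + \<gamma>) / (\<alpha> z + \<beta>)\<close> of a quadratic map \<open>p / q\<close>.\<close>

lemma quadratic_involution:
  assumes Y: "reduced p q 2"
  obtains \<alpha> \<beta> \<gamma> where
    "\<And>z w. poly p z * poly q w - poly p w * poly q z = (z - w) * (\<alpha> * z * w + \<beta> * (z + w) + \<gamma>)"
    "\<alpha> \<noteq> 0 \<or> \<beta> \<noteq> 0"
    "\<And>w. coeff p 2 * poly q w - poly p w * coeff q 2 = \<alpha> * w + \<beta>"
proof -
  \<comment> \<open>The 2 by 2 minors of the coefficients of \<open>p\<close> and \<open>q\<close>.
    The expression \<open>poly p z * poly q w - poly p w * poly q z\<close> is antisymmetric, hence
    divisible by \<open>z - w\<close>, with a symmetric quotient of degree at most one in each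
    variable.\<close>
  define \<alpha> where "\<alpha> = coeff p 2 * coeff q 1 - coeff p 1 * coeff q 2"
  define \<beta> where "\<beta> = coeff p 2 * coeff q 0 - coeff p 0 * coeff q 2"
  define \<gamma> where "\<gamma> = coeff p 1 * coeff q 0 - coeff p 0 * coeff q 1"
  have p: "poly p z = coeff p 0 + coeff p 1 * z + coeff p 2 * z ^ 2" for z
    using arg_cong[OF quadratic_poly_eq[OF reducedD(3)[OF Y]], of "\<lambda>f. poly f z"]
    by (simp add: power2_eq_square algebra_simps)
  have q: "poly q z = coeff q 0 + coeff q 1 * z + coeff q 2 * z ^ 2" for z
    using arg_cong[OF quadratic_poly_eq[OF reducedD(4)[OF Y]], of "\<lambda>f. poly f z"]
    by (simp add: power2_eq_square algebra_simps)
  have 1: "poly p z * poly q w - poly p w * poly q z = (z - w) * (\<alpha> * z * w + \<beta> * (z + w) + \<gamma>)" for z w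
    unfolding p q \<alpha>_def \<beta>_def \<gamma>_def by algebra
  have 2: "coeff p 2 * poly q w - poly p w * coeff q 2 = \<alpha> * w + \<beta>" for w
    unfolding p q \<alpha>_def \<beta>_def by algebra
  have 3: "\<alpha> \<noteq> 0 \<or> \<beta> \<noteq> 0"
  proof (rule ccontr)
    assume "\<not> (\<alpha> \<noteq> 0 \<or> \<beta> \<noteq> 0)"
    then have eq: "coeff p 2 * poly q w = poly p w * coeff q 2" for w using 2[of w] by simp
    show False
    proof (cases "coeff q 2 = 0")
      case True
      then have "coeff p 2 \<noteq> 0" using reduced_top_coeff[OF Y] by blast
      then have "q = 0" using eq True by (intro poly_eq_if_infinite) (simp add: infinite_UNIV_char_0)
      then show False using reducedD(2)[OF Y] by simp
    next
      case False
      then have "poly (p - smult (coeff p 2 / coeff q 2) q) w = 0" for w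
        using eq[of w] by (simp add: field_simps)
      then have "p - smult (coeff p 2 / coeff q 2) q = 0" using poly_all_0_iff_0 by blast
      then show False using fib_nonzero[OF Y] by simp
    qed
  qed
  show ?thesis using that[OF 1 3 2] .
qed

text \<open>No critical value of \<open>G = C / E\<close>, and no point over one, is the point at infinity.\<close>

locale normalised_square =
  fixes A B C E a b p q :: "complex poly" and m n j k :: nat
  assumes F: "reduced A B m" and G: "reduced C E n" and X: "reduced a b j" and Y: "reduced p q k"
    and m4: "m \<ge> 4" and n2: "n \<ge> 2" and j1: "j \<ge> 1" and k2: "k \<ge> 2"
    and comm: "quot_map A B \<circ> quot_map a b = quot_map C E \<circ> quot_map p q"
    and inj: "gen_inj (quot_map a b) (quot_map p q)"
    and simple: "\<And>w. m - 1 \<le> card (quot_map A B -` {w})"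
    and crit: "\<And>c. card (quot_map C E -` {c}) < n \<Longrightarrow>
      c \<noteq> None \<and> quot_map C E None \<noteq> c \<and> quot_map A B None \<noteq> c \<and> quot_map A B (quot_map a b None) \<noteq> c"
    and G_inf: "quot_map C E None \<noteq> None"
begin

lemma n1: "n \<ge> 1" and k1: "k \<ge> 1" and m1: "m \<ge> 1" using n2 k2 m4 by simp_all

lemmas F0 = fib_nonzero[OF F m1] and G0 = fib_nonzero[OF G n1]
  and X0 = fib_nonzero[OF X j1] and Y0 = fib_nonzero[OF Y k1]

lemma degrees: "m * j = n * k"
  using reduced_comp[OF F X j1] reduced_comp[OF G Y k1] comm rat_degree_reduced by metis

text \<open>By the normalisation all ramification points of \<open>C / E\<close> are finite, so
  \<open>ram\<close> contains them all. \<open>val\<close> and \<open>img\<close> are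
  \<open>C / E\<close> and \<open>a / b\<close> on finite points; at poles they are dummies, but
  \<open>ram\<close> contains no pole of the former and the fibres over \<open>ram\<close> no pole
  of the latter.\<close>

definition ram :: "complex set" where "ram = {y. poly (wronskian C E) y = 0}"
definition val :: "complex \<Rightarrow> complex" where "val y = poly C y / poly E y"
definition e_G :: "complex \<Rightarrow> nat" where "e_G y = order y (C - smult (val y) E)"
definition fibre :: "complex \<Rightarrow> complex set" where "fibre y = {v. poly (p - smult y q) v = 0}"
definition img :: "complex \<Rightarrow> complex" where "img v = poly a v / poly b v"
definition e_X :: "complex \<Rightarrow> nat" where "e_X v = order v (a - smult (img v) b)"

lemma finite_ram: "finite ram"
  unfolding ram_def by (rule poly_roots_finite[OF wronskian_nonzero[OF G n1]])

lemma finite_fibre: "finite (fibre y)"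
  unfolding fibre_def by (rule poly_roots_finite[OF Y0])

lemma fibre_disjoint: "v \<in> fibre y \<Longrightarrow> v \<in> fibre y' \<Longrightarrow> y = y'"
  using fib_root(2)[OF Y] unfolding fibre_def by blast

text \<open>At a zero of \<open>E\<close> the Wronskian reduces to \<open>- C * pderiv E\<close>, so
  \<open>y\<close> would be a multiple zero of \<open>E\<close>. But \<open>crit\<close> is absurd
  for \<open>c = None\<close>, so infinity is no critical value and the zeros of \<open>E\<close>
  are simple.\<close>

lemma ram_finite_value:
  assumes "y \<in> ram"
  shows "poly E y \<noteq> 0"
proof
  assume Ey: "poly E y = 0"
  have Cy: "poly C y \<noteq> 0" using Ey reduced_no_common_root[OF G, of y] by blast
  have dE: "poly (pderiv E) y = 0" using assms Ey Cy by (simp add: ram_def wronskian_def)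
  have E0: "E \<noteq> 0" using reducedD(2)[OF G] .
  have "quot_map C E -` {None} = Some ` {z. poly E z = 0}"
  proof (intro set_eqI)
    fix w show "w \<in> quot_map C E -` {None} \<longleftrightarrow> w \<in> Some ` {z. poly E z = 0}"
      using G_inf by (cases w) (auto simp: quot_map_def image_iff)
  qed
  then have "card (quot_map C E -` {None}) = card {z. poly E z = 0}" by (simp add: card_image)
  moreover have "n \<le> card (quot_map C E -` {None})" using crit[of None] by force
  ultimately have "degree E \<le> card {z. poly E z = 0}" using reducedD(4)[OF G] by simp
  then have "order y E = 1" using order_eq_1_if_card_roots[OF E0 _ Ey] by simp
  then have "order y (pderiv E) = 0" using order_pderiv[OF E0 Ey] by simp
  moreover have "pderiv E \<noteq> 0"
  proof
    assume "pderiv E = 0"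
    then have "degree E = 0" by (simp add: pderiv_eq_0_iff)
    then obtain t where "E = [:t:]" by (rule degree_eq_zeroE)
    then show False using Ey E0 by simp
  qed
  ultimately show False using dE by (simp add: order_root)
qed

lemma ram_root: "y \<in> ram \<Longrightarrow> poly (C - smult (val y) E) y = 0"
  using ram_finite_value by (simp add: val_def)

lemma e_G_wronskian: "y \<in> ram \<Longrightarrow> Suc (order y (wronskian C E)) = e_G y"
  unfolding e_G_def by (rule order_wronskian[OF G n1 ram_root])

lemma e_G_ge2: "y \<in> ram \<Longrightarrow> e_G y \<ge> 2"
  using e_G_wronskian[of y] wronskian_nonzero[OF G n1] order_gt_0_iff[of "wronskian C E" y] by (simp add: ram_def)

lemma val_critical:
  assumes y: "y \<in> ram"
  shows "card (quot_map C E -` {Some (val y)}) < n"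
proof -
  define f where "f = C - smult (val y) E"
  have "\<not> degree f \<le> card {z. poly f z = 0}"
    using order_eq_1_if_card_roots[OF G0 _ ram_root[OF y]] e_G_ge2[OF y] by (auto simp: f_def e_G_def)
  \<comment> \<open>If infinity lies over \<open>val y\<close>, it adds one point but lowers the
    degree of \<open>f\<close> by at least one.\<close>
  moreover have "degree f + (if quot_map C E None = Some (val y) then 1 else 0) \<le> n"
  proof (cases "quot_map C E None = Some (val y)")
    case True
    then have "coeff f n = 0" using quot_map_None_eq_Some_iff[OF G] f_def by simp
    then have "degree f \<noteq> n" using G0 n1 unfolding f_def by (metis leading_coeff_0_iff)
    then show ?thesis using True degree_fib_le[OF G, of "val y"] f_def by simp
  qed (use degree_fib_le[OF G] f_def in simp)
  ultimately show ?thesis unfolding card_vimage_Some[OF G n1] f_def[symmetric] by linarith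
qed

lemmas val_generic = crit[OF val_critical]

text \<open>The exact form of Riemann-Hurwitz. With \<open>g\<close> the value at infinity and
  \<open>f = C - smult g E\<close>, infinity is unramified, so \<open>f\<close> has degree
  \<open>n - 1\<close>; the coefficient of degree \<open>2 * n - 2\<close> then carries the factor
  \<open>(n - 1) - n = - 1\<close>.\<close>

lemma degree_wronskian_G: "degree (wronskian C E) = 2 * n - 2"
proof -
  obtain g where g: "quot_map C E None = Some g" using G_inf by blast
  define f where "f = C - smult g E"
  have f0: "f \<noteq> 0" using G0 f_def by simp
  have "n \<le> card (quot_map C E -` {Some g})" using crit[of "Some g"] g by force
  then have "n \<le> Suc (card {z. poly f z = 0})" using g by (simp add: card_vimage_Some[OF G n1] f_def)
  also have "card {z. poly f z = 0} \<le> degree f" by (rule card_poly_roots_bound[OF f0])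
  finally have "n - 1 \<le> degree f" by simp
  moreover have "coeff f n = 0" using g quot_map_None_eq_Some_iff[OF G] f_def by simp
  then have "degree f \<noteq> n" using f0 by (metis leading_coeff_0_iff)
  ultimately have df: "degree f = n - 1" using degree_fib_le[OF G, of g] f_def by simp
  have En: "coeff E n \<noteq> 0" using G_inf by (auto simp: quot_map_None[OF G] proj_pt_def)
  have fn: "coeff f (n - 1) \<noteq> 0" using f0 df by (metis leading_coeff_0_iff)
  have w: "wronskian C E = wronskian f E" unfolding f_def by (rule wronskian_fib[symmetric])
  have "coeff (pderiv f * E) (n - 2 + n) = coeff (pderiv f) (n - 2) * coeff E n"
    using df reducedD(4)[OF G] by (intro coeff_mult_top) (simp_all add: degree_pderiv)
  moreover have "coeff (f * pderiv E) (n - 1 + (n - 1)) = coeff f (n - 1) * coeff (pderiv E) (n - 1)"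
    using df reducedD(4)[OF G] by (intro coeff_mult_top) (simp_all add: degree_pderiv)
  moreover have "n - 2 + n = 2 * n - 2" "n - 1 + (n - 1) = 2 * n - 2" "Suc (n - 2) = n - 1" "Suc (n - 1) = n"
    using n2 by simp_all
  ultimately have "coeff (wronskian f E) (2 * n - 2) =
      of_nat (n - 1) * coeff f (n - 1) * coeff E n - coeff f (n - 1) * (of_nat n * coeff E n)"
    by (simp add: wronskian_def coeff_pderiv)
  also have "\<dots> = - (coeff f (n - 1) * coeff E n)"
    using n1 by (simp add: of_nat_diff algebra_simps)
  finally have "coeff (wronskian C E) (2 * n - 2) \<noteq> 0" using En fn w by simp
  then show ?thesis using degree_wronskian_le[OF reducedD(3,4)[OF G] n1] le_degree le_antisym by blast
qed

lemma sum_e_G: "(\<Sum>y\<in>ram. e_G y - 1) = 2 * n - 2"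
proof -
  have "(\<Sum>y\<in>ram. e_G y - 1) = (\<Sum>y\<in>ram. order y (wronskian C E))"
    using e_G_wronskian by (intro sum.cong) (auto simp flip: e_G_wronskian)
  then show ?thesis using sum_order_complex[OF wronskian_nonzero[OF G n1]] degree_wronskian_G by (simp add: ram_def)
qed

text \<open>At least \<open>m - 1\<close> distinct points share the total multiplicity
  \<open>m\<close>, so at most one of them is not simple, and that one is double.\<close>

lemma ex_double_point:
  assumes y: "y \<in> ram"
  shows "\<exists>u. \<forall>x. order x (A - smult (val y) B) \<le> (if x = u then 2 else 1)"
proof -
  define f where "f = A - smult (val y) B"
  have f0: "f \<noteq> 0" using F0 f_def by simp
  define Z where "Z = {x. poly f x = 0}"
  have finZ: "finite Z" unfolding Z_def by (rule poly_roots_finite[OF f0])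
  have pos: "1 \<le> order x f" if "x \<in> Z" for x
    using that f0 by (simp add: Z_def order_gt_0_iff Suc_le_eq)
  have "degree f = m" unfolding f_def by (rule degree_fib[OF F]) (use val_generic[OF y] in blast)
  moreover have "m - 1 \<le> card Z"
    using simple[of "Some (val y)"] val_generic[OF y] by (simp add: card_vimage_Some[OF F m1] Z_def f_def)
  moreover have "(\<Sum>x\<in>Z. order x f) = (\<Sum>x\<in>Z. (order x f - 1) + 1)"
    using pos by (intro sum.cong) force+
  then have "(\<Sum>x\<in>Z. order x f) = (\<Sum>x\<in>Z. order x f - 1) + card Z" by (simp only: sum.distrib card_eq_sum)
  ultimately have le: "(\<Sum>x\<in>Z. order x f - 1) \<le> 1"
    using sum_order_complex[OF f0] Z_def by simp
  show ?thesis
  proof (cases "\<exists>u\<in>Z. order u f \<ge> 2")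
    case True
    then obtain u where u: "u \<in> Z" "order u f \<ge> 2" by blast
    have sum: "(\<Sum>x\<in>Z. order x f - 1) = (order u f - 1) + (\<Sum>x\<in>Z - {u}. order x f - 1)"
      using finZ u(1) by (rule sum.remove)
    then have rest: "(\<Sum>x\<in>Z - {u}. order x f - 1) = 0" "order u f \<le> 2" using le u(2) by linarith+
    have "order x f \<le> 1" if "x \<noteq> u" for x
    proof (cases "x \<in> Z")
      case True
      then show ?thesis using rest(1) that finZ by simp
    next
      case False
      then show ?thesis by (simp add: Z_def order_0I)
    qed
    then show ?thesis using rest(2) f_def by auto
  next
    case False
    have le1: "order x f \<le> 1" for x
    proof (cases "x \<in> Z")
      case True
      then show ?thesis using False by force
    qed (simp add: Z_def order_0I)
    have "order x f \<le> (if x = 0 then 2 else 1)" for x using le1[of x] by auto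
    then show ?thesis unfolding f_def by blast
  qed
qed

text \<open>If all points over \<open>val y\<close> are simple, this is an arbitrary number; only
  the two bounds in \<open>dbl\<close> matter.\<close>

definition dbl :: "complex \<Rightarrow> complex" where
  "dbl y = (SOME u. \<forall>x. order x (A - smult (val y) B) \<le> (if x = u then 2 else 1))"

lemma dbl:
  assumes "y \<in> ram"
  shows "order x (A - smult (val y) B) \<le> 2" "x \<noteq> dbl y \<Longrightarrow> order x (A - smult (val y) B) \<le> 1"
  using someI_ex[OF ex_double_point[OF assms], folded dbl_def] by (auto split: if_splits dest!: spec[of _ x])

lemma sum_e_Y:
  assumes y: "y \<in> ram"
  shows "(\<Sum>v\<in>fibre y. order v (p - smult y q)) = k"
proof -
  have "quot_map p q None \<noteq> Some y"
  proof
    assume "quot_map p q None = Some y"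
    then have "quot_map A B (quot_map a b None) = quot_map C E (Some y)"
      using fun_cong[OF comm, of None] by simp
    also have "\<dots> = Some (val y)" using ram_finite_value[OF y] by (simp add: quot_map_def val_def)
    finally show False using val_generic[OF y] by blast
  qed
  then show ?thesis using degree_fib[OF Y] sum_order_complex[OF Y0] by (simp add: fibre_def)
qed

text \<open>The last claim is the chain rule for multiplicities, applied at \<open>v\<close> to both
  sides of \<open>comm\<close>; \<open>crit\<close> keeps all points involved finite.\<close>

lemma fibre_point:
  assumes y: "y \<in> ram" and v: "v \<in> fibre y"
  shows "poly b v \<noteq> 0" "poly (a - smult (img v) b) v = 0" "poly q v \<noteq> 0" "poly p v / poly q v = y"
    "poly B (img v) \<noteq> 0" "poly A (img v) / poly B (img v) = val y"
    "poly (A - smult (val y) B) (img v) = 0"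
    "order (img v) (A - smult (val y) B) * e_X v = e_G y * order v (p - smult y q)"
proof -
  have qv: "poly q v \<noteq> 0" "poly p v / poly q v = y" using v fib_root[OF Y] by (auto simp: fibre_def)
  then show "poly q v \<noteq> 0" "poly p v / poly q v = y" .
  have eq: "quot_map A B (quot_map a b (Some v)) = Some (val y)"
  proof -
    have "quot_map p q (Some v) = Some y" using qv by (simp add: quot_map_def)
    then show ?thesis using fun_cong[OF comm, of "Some v"] ram_finite_value[OF y]
      by (simp add: quot_map_def[of C E] val_def)
  qed
  then have "quot_map a b (Some v) \<noteq> None" using val_generic[OF y] by metis
  then show bv: "poly b v \<noteq> 0" by (auto simp: quot_map_def)
  then show "poly (a - smult (img v) b) v = 0" by (simp add: img_def)
  have "quot_map a b (Some v) = Some (img v)" using bv by (simp add: quot_map_def img_def)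
  then show root: "poly (A - smult (val y) B) (img v) = 0"
    using eq quot_map_Some_eq_Some_iff[OF F] by metis
  show Bv: "poly B (img v) \<noteq> 0" "poly A (img v) / poly B (img v) = val y" using fib_root[OF F root] .
  define HA HB HC HE where "HA = homog m A a b" and "HB = homog m B a b"
    and "HC = homog n C p q" and "HE = homog n E p q"
  note cF = reduced_comp[OF F X j1, folded HA_def HB_def] and cG = reduced_comp[OF G Y k1, folded HC_def HE_def]
  have cross: "HA * HE = HC * HB"
    by (rule quot_map_eq_imp_cross_eq) (use cF cG comm reducedD(2) in auto)
  \<comment> \<open>The denominators \<open>HB\<close> and \<open>HE\<close> do not vanish at
    \<open>v\<close>, so the two numerators have the same order there.\<close>
  have "(HA - smult (val y) HB) * HE = HB * (HC - smult (val y) HE)"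
    using cross by (simp add: algebra_simps)
  moreover have nz: "poly HB v \<noteq> 0" "poly HE v \<noteq> 0"
    using bv Bv qv ram_finite_value[OF y] poly_homog_nonzero[OF reducedD(4)[OF F] bv, of a]
      poly_homog_nonzero[OF reducedD(4)[OF G] qv(1), of p]
    by (simp_all add: HB_def HE_def img_def)
  moreover have "HA - smult (val y) HB \<noteq> 0" "HC - smult (val y) HE \<noteq> 0"
    using fib_nonzero[OF cF(1)] fib_nonzero[OF cG(1)] m1 j1 n1 k1 by simp_all
  moreover have "HB \<noteq> 0" "HE \<noteq> 0" using nz by auto
  ultimately have "order v (HA - smult (val y) HB) + order v HE = order v HB + order v (HC - smult (val y) HE)"
    by (metis order_mult mult_eq_0_iff)
  then have "order v (HA - smult (val y) HB) = order v (HC - smult (val y) HE)"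
    using nz by (simp add: order_0I)
  moreover have "HA - smult (val y) HB = homog m (A - smult (val y) B) a b"
    by (simp add: HA_def HB_def homog_fib)
  moreover have "HC - smult (val y) HE = homog n (C - smult (val y) E) p q"
    by (simp add: HC_def HE_def homog_fib)
  moreover have "order v (homog m (A - smult (val y) B) a b) = order (img v) (A - smult (val y) B) * e_X v"
    using order_homog[OF bv F0 degree_fib_le[OF F] X0] by (simp add: img_def e_X_def)
  moreover have "order v (homog n (C - smult (val y) E) p q) = e_G y * order v (p - smult y q)"
    using order_homog[OF qv(1) G0 degree_fib_le[OF G] Y0, of "val y"] by (simp add: qv(2) e_G_def)
  ultimately show "order (img v) (A - smult (val y) B) * e_X v = e_G y * order v (p - smult y q)" by simp
qed

text \<open>The number \<open>r\<close> of the overview, counted with multiplicity under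
  \<open>p / q\<close>.\<close>

definition dbl_mult :: "complex \<Rightarrow> nat" where
  "dbl_mult y = (\<Sum>v\<in>{v \<in> fibre y. img v = dbl y}. order v (p - smult y q))"

lemma dbl_mult_split:
  assumes "y \<in> ram"
  shows "dbl_mult y + (\<Sum>v\<in>{v \<in> fibre y. img v \<noteq> dbl y}. order v (p - smult y q)) = k"
proof -
  have "fibre y = {v \<in> fibre y. img v = dbl y} \<union> {v \<in> fibre y. img v \<noteq> dbl y}" by auto
  then have "(\<Sum>v\<in>fibre y. order v (p - smult y q)) = dbl_mult y + (\<Sum>v\<in>{v \<in> fibre y. img v \<noteq> dbl y}. order v (p - smult y q))"
    unfolding dbl_mult_def using finite_fibre[of y] by (subst sum.union_disjoint[symmetric]) auto
  then show ?thesis using sum_e_Y[OF assms] by simp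
qed

text \<open>Let \<open>v\<close> over \<open>y\<close> have multiplicity \<open>t\<close> under
  \<open>p / q\<close> and not be sent to \<open>dbl y\<close>. The chain rule gives
  \<open>e_X v = e_G y * t\<close>, so the Wronskian of \<open>a / b\<close> has order
  \<open>e_G y * t - 1\<close> at \<open>v\<close>, which is at least
  \<open>(e_G y - 1) * t\<close>.\<close>

lemma ramification_X: "(\<Sum>y\<in>ram. (e_G y - 1) * (k - dbl_mult y)) \<le> 2 * j - 2"
proof -
  have "(\<Sum>y\<in>ram. (e_G y - 1) * (k - dbl_mult y)) \<le> (\<Sum>y\<in>ram. \<Sum>v\<in>{v \<in> fibre y. img v \<noteq> dbl y}. order v (wronskian a b))"
  proof (rule sum_mono)
    fix y assume y: "y \<in> ram"
    have "(e_G y - 1) * (k - dbl_mult y) = (\<Sum>v\<in>{v \<in> fibre y. img v \<noteq> dbl y}. (e_G y - 1) * order v (p - smult y q))"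
    proof -
      have "k - dbl_mult y = (\<Sum>v\<in>{v \<in> fibre y. img v \<noteq> dbl y}. order v (p - smult y q))"
        using dbl_mult_split[OF y] by linarith
      then show ?thesis by (simp only: sum_distrib_left)
    qed
    also have "\<dots> \<le> (\<Sum>v\<in>{v \<in> fibre y. img v \<noteq> dbl y}. order v (wronskian a b))"
    proof (rule sum_mono)
      fix v assume v: "v \<in> {v \<in> fibre y. img v \<noteq> dbl y}"
      then have vy: "v \<in> fibre y" and nd: "img v \<noteq> dbl y" by auto
      note fp = fibre_point[OF y vy]
      have "order (img v) (A - smult (val y) B) = 1"
        using dbl(2)[OF y nd] fp(7) F0 by (metis le_antisym less_one not_le order_root)
      then have "e_X v = e_G y * order v (p - smult y q)" using fp(8) by simp
      moreover have "Suc (order v (wronskian a b)) = e_X v" unfolding e_X_def by (rule order_wronskian[OF X j1 fp(2)])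
      moreover have "order v (p - smult y q) \<ge> 1"
        using vy Y0 by (simp add: fibre_def order_gt_0_iff Suc_le_eq)
      moreover have "(e_G y - 1) * order v (p - smult y q) = e_G y * order v (p - smult y q) - order v (p - smult y q)"
        by (simp add: diff_mult_distrib)
      ultimately show "(e_G y - 1) * order v (p - smult y q) \<le> order v (wronskian a b)" by linarith
    qed
    finally show "(e_G y - 1) * (k - dbl_mult y) \<le> (\<Sum>v\<in>{v \<in> fibre y. img v \<noteq> dbl y}. order v (wronskian a b))" .
  qed
  also have "\<dots> \<le> degree (wronskian a b)"
    by (rule sum_sum_order_le_degree[OF wronskian_nonzero[OF X j1] finite_ram])
      (use finite_fibre fibre_disjoint in auto)
  also have "\<dots> \<le> 2 * j - 2" by (rule degree_wronskian_le[OF reducedD(3,4)[OF X] j1])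
  finally show ?thesis .
qed

text \<open>By the chain rule \<open>e_G y * dbl_mult y\<close> is at most twice the sum of
  \<open>e_X\<close> over the points above \<open>y\<close> sent to \<open>dbl y\<close>, and
  \<open>sum_order_le_order\<close> bounds that sum by \<open>e_G y\<close>.\<close>

lemma dbl_mult_le_2:
  assumes y: "y \<in> ram"
  shows "dbl_mult y \<le> 2"
proof (cases "{v \<in> fibre y. img v = dbl y} = {}")
  case True
  then show ?thesis unfolding dbl_mult_def by (simp only: sum.empty)
next
  case False
  then obtain v0 where v0: "v0 \<in> fibre y" "img v0 = dbl y" by blast
  define u where "u = dbl y"
  define S where "S = {v \<in> fibre y. img v = dbl y}"
  note fp0 = fibre_point[OF y v0(1), unfolded v0(2), folded u_def]
  have "quot_map a b None \<noteq> Some u"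
  proof
    assume "quot_map a b None = Some u"
    then have "quot_map A B (quot_map a b None) = Some (val y)" using fp0(5,6) by (simp add: quot_map_def)
    then show False using val_generic[OF y] by blast
  qed
  from sum_order_le_order[OF F G n1 X j1 Y k1 comm inj this fp0(5), of y]
  have "(\<Sum>v | poly (a - smult u b) v = 0 \<and> poly (p - smult y q) v = 0. order v (a - smult u b)) \<le> e_G y"
    unfolding fp0(6) e_G_def .
  moreover have "{v. poly (a - smult u b) v = 0 \<and> poly (p - smult y q) v = 0} = S"
  proof (intro set_eqI iffI)
    fix v assume "v \<in> {v. poly (a - smult u b) v = 0 \<and> poly (p - smult y q) v = 0}"
    then have "poly (a - smult u b) v = 0" "v \<in> fibre y" by (simp_all add: fibre_def)
    then show "v \<in> S" using fib_root(2)[OF X, of u v] by (simp add: S_def img_def u_def)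
  next
    fix v assume v: "v \<in> S"
    then have "poly (a - smult (img v) b) v = 0" "img v = u" "poly (p - smult y q) v = 0"
      using fibre_point(2)[OF y, of v] by (auto simp: S_def u_def fibre_def)
    then show "v \<in> {v. poly (a - smult u b) v = 0 \<and> poly (p - smult y q) v = 0}" by simp
  qed
  moreover have "(\<Sum>v\<in>S. order v (a - smult u b)) = (\<Sum>v\<in>S. e_X v)"
    by (intro sum.cong) (auto simp: S_def e_X_def u_def)
  ultimately have le: "(\<Sum>v\<in>S. e_X v) \<le> e_G y" by simp
  have "e_G y * dbl_mult y = (\<Sum>v\<in>S. e_G y * order v (p - smult y q))"
    by (simp add: dbl_mult_def S_def sum_distrib_left)
  also have "\<dots> = (\<Sum>v\<in>S. order u (A - smult (val y) B) * e_X v)"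
  proof (rule sum.cong[OF refl])
    fix v assume "v \<in> S"
    then have "v \<in> fibre y" "img v = u" by (simp_all add: S_def u_def)
    then show "e_G y * order v (p - smult y q) = order u (A - smult (val y) B) * e_X v"
      using fibre_point(8)[OF y, of v] by simp
  qed
  also have "\<dots> \<le> 2 * e_G y"
    unfolding sum_distrib_left[symmetric] using dbl(1)[OF y] le by (intro mult_mono) auto
  finally show ?thesis using e_G_ge2[OF y] by simp
qed

lemma k_eq_2: "k = 2"
proof (rule ccontr)
  assume "k \<noteq> 2"
  then have k3: "k \<ge> 3" using k2 by simp
  have "(2 * n - 2) * (k - 2) = (\<Sum>y\<in>ram. (e_G y - 1) * (k - 2))"
    unfolding sum_e_G[symmetric] by (rule sum_distrib_right)
  also have "\<dots> \<le> (\<Sum>y\<in>ram. (e_G y - 1) * (k - dbl_mult y))"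
    using dbl_mult_le_2 by (intro sum_mono mult_left_mono) (auto simp: diff_le_mono2)
  also have "\<dots> \<le> 2 * j - 2" by (rule ramification_X)
  finally have le: "(2 * n - 2) * (k - 2) \<le> 2 * j - 2" .
  \<comment> \<open>The substitutions remove truncated subtraction: \<open>4 * j\<close> is at most
    \<open>6 + 3 n' + 2 k' + n' k'\<close>, but at least
    \<open>8 + 4 n' + 4 k' + 4 n' k'\<close>.\<close>
  obtain n' where n': "n = 2 + n'" using n2 le_Suc_ex by blast
  obtain k' where k': "k = 3 + k'" using k3 le_Suc_ex by blast
  have "4 * j \<le> m * j" using m4 by simp
  then have "4 * j \<le> (2 + n') * (3 + k')" using degrees n' k' by simp
  moreover have "2 * (1 + n') * (1 + k') + 2 \<le> 2 * j"
    using le j1 by (simp add: n' k')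
  ultimately show False by (simp add: algebra_simps)
qed

text \<open>The chain rule summed over a fibre sent entirely to \<open>dbl y\<close>: the
  multiplicity there is at most two, and this factor cancels against \<open>k = 2\<close>.\<close>

lemma sum_e_X_double_fibre:
  assumes y: "y \<in> ram" and all: "\<And>v. v \<in> fibre y \<Longrightarrow> img v = dbl y"
  shows "e_G y \<le> (\<Sum>v\<in>fibre y. e_X v)"
proof -
  have "e_G y * k = (\<Sum>v\<in>fibre y. e_G y * order v (p - smult y q))"
    by (simp add: sum_e_Y[OF y] flip: sum_distrib_left)
  also have "\<dots> = (\<Sum>v\<in>fibre y. order (dbl y) (A - smult (val y) B) * e_X v)"
  proof (rule sum.cong[OF refl])
    fix v assume v: "v \<in> fibre y"
    then show "e_G y * order v (p - smult y q) = order (dbl y) (A - smult (val y) B) * e_X v"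
      using fibre_point(8)[OF y v] all[OF v] by simp
  qed
  also have "\<dots> \<le> 2 * (\<Sum>v\<in>fibre y. e_X v)"
    unfolding sum_distrib_left[symmetric] using dbl(1)[OF y] by (intro mult_mono) auto
  finally show ?thesis by (simp add: k_eq_2)
qed

text \<open>\<open>Z\<close> is the numerator of the difference of \<open>a / b\<close> composed
  with \<open>\<sigma>\<close> and \<open>a / b\<close>. A fibre with \<open>dbl_mult y = 2\<close>
  contributes at least \<open>e_G y\<close> to the orders of zeros of \<open>Z\<close>, whose degree
  is at most \<open>2 * j\<close>; the other ramification points are bounded by
  \<open>ramification_X\<close>.\<close>

lemma contradiction: False
proof -
  have Y2: "reduced p q 2" using Y k_eq_2 by simp
  obtain \<alpha> \<beta> \<gamma> where
    L: "\<And>z w. poly p z * poly q w - poly p w * poly q z = (z - w) * (\<alpha> * z * w + \<beta> * (z + w) + \<gamma>)"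
    and \<alpha>\<beta>: "\<alpha> \<noteq> 0 \<or> \<beta> \<noteq> 0"
    and lead: "\<And>w. coeff p 2 * poly q w - poly p w * coeff q 2 = \<alpha> * w + \<beta>"
    using quadratic_involution[OF Y2] by blast
  define N D where "N = [:- \<gamma>, - \<beta>:]" and "D = [:\<beta>, \<alpha>:]"
  define a' b' where "a' = homog j a N D" and "b' = homog j b N D"
  define Z where "Z = b * a' - a * b'"
  define \<sigma> where "\<sigma> w = poly N w / poly D w" for w
  have D0: "D \<noteq> 0" using \<alpha>\<beta> by (auto simp: D_def)
  have fact: "poly p z * poly q w - poly p w * poly q z = (z - w) * poly D w * (z - \<sigma> w)" if "poly D w \<noteq> 0" for z w
  proof -
    have "poly D w * (z - \<sigma> w) = poly D w * z - poly N w" using that by (simp add: \<sigma>_def right_diff_distrib)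
    also have "\<dots> = \<alpha> * z * w + \<beta> * (z + w) + \<gamma>" by (simp add: N_def D_def algebra_simps)
    finally show ?thesis by (simp add: L mult.assoc)
  qed
  have Z0: "Z \<noteq> 0"
  proof
    assume Z: "Z = 0"
    \<comment> \<open>Its roots are the fixed points of \<open>\<sigma>\<close>. Away from them and
      from the pole of \<open>\<sigma>\<close>, \<open>Z = 0\<close> would make
      \<open>\<sigma> w\<close> a genuine partner of \<open>w\<close>, against generic
      injectivity.\<close>
    define fixp where "fixp = [:\<gamma>, 2 * \<beta>, \<alpha>:]"
    have fixp0: "fixp \<noteq> 0" using \<alpha>\<beta> by (auto simp: fixp_def)
    have "{w. poly (D * fixp) w \<noteq> 0} \<subseteq>
        Some -` {w. \<exists>z. z \<noteq> w \<and> quot_map a b z = quot_map a b w \<and> quot_map p q z = quot_map p q w}"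
    proof
      fix w assume "w \<in> {w. poly (D * fixp) w \<noteq> 0}"
      then have Dw: "poly D w \<noteq> 0" and fw: "poly fixp w \<noteq> 0" by auto
      have "\<sigma> w \<noteq> w"
      proof
        assume "\<sigma> w = w"
        then have "poly N w = w * poly D w" using Dw by (simp add: \<sigma>_def field_simps)
        moreover have "poly fixp w = w * poly D w - poly N w"
          by (simp add: N_def D_def fixp_def algebra_simps)
        ultimately have "poly fixp w = 0" by simp
        then show False using fw by simp
      qed
      moreover have "quot_map p q (Some (\<sigma> w)) = quot_map p q (Some w)"
        unfolding quot_map_eq_iff_cross[OF Y] using fact[OF Dw, of "\<sigma> w"] by simp
      moreover have "quot_map a b (Some (\<sigma> w)) = quot_map a b (Some w)"
      proof -
        have "poly a' w = poly D w ^ j * poly a (\<sigma> w)" "poly b' w = poly D w ^ j * poly b (\<sigma> w)"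
          using poly_homog_nonzero[OF reducedD(3)[OF X] Dw, of N] poly_homog_nonzero[OF reducedD(4)[OF X] Dw, of N]
          by (simp_all add: a'_def b'_def \<sigma>_def)
        moreover have "poly Z w = 0" using Z by simp
        ultimately have "poly D w ^ j * (poly b w * poly a (\<sigma> w) - poly a w * poly b (\<sigma> w)) = 0"
          by (simp add: Z_def algebra_simps)
        then show ?thesis unfolding quot_map_eq_iff_cross[OF X] using Dw by (simp add: mult.commute)
      qed
      ultimately show "w \<in> Some -` {w. \<exists>z. z \<noteq> w \<and> quot_map a b z = quot_map a b w \<and> quot_map p q z = quot_map p q w}"
        by (auto intro: exI[of _ "Some (\<sigma> w)"])
    qed
    moreover have "finite (Some -` {w. \<exists>z. z \<noteq> w \<and> quot_map a b z = quot_map a b w \<and> quot_map p q z = quot_map p q w})"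
      using inj unfolding gen_inj_def by (rule finite_vimageI) simp
    ultimately have "finite {w. poly (D * fixp) w \<noteq> 0}" by (rule finite_subset)
    moreover have "D * fixp \<noteq> 0" using D0 fixp0 by (metis mult_eq_0_iff)
    ultimately show False using infinite_nonroots by metis
  qed
  have degN: "degree N \<le> 1" "degree D \<le> 1" by (simp_all add: N_def D_def)
  have degZ: "degree Z \<le> 2 * j"
  proof -
    have "degree a' \<le> j" "degree b' \<le> j"
      using degree_homog_le[OF degN] by (simp_all add: a'_def b'_def)
    then have "degree (b * a') \<le> 2 * j" "degree (a * b') \<le> 2 * j"
      using degree_mult_le[of b a'] degree_mult_le[of a b'] reducedD(3,4)[OF X] by linarith+
    then show ?thesis unfolding Z_def by (rule degree_diff_le)
  qed
  define R where "R = {y \<in> ram. dbl_mult y = 2}"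
  have finR: "finite R" using finite_ram by (simp add: R_def)
  have img_dbl: "img v = dbl y" if y: "y \<in> R" and v: "v \<in> fibre y" for v y
  proof (rule ccontr)
    assume "img v \<noteq> dbl y"
    then have "v \<in> {v \<in> fibre y. img v \<noteq> dbl y}" using v by simp
    moreover have "(\<Sum>v\<in>{v \<in> fibre y. img v \<noteq> dbl y}. order v (p - smult y q)) = 0"
      using dbl_mult_split[of y] y k_eq_2 by (simp add: R_def)
    ultimately have "order v (p - smult y q) = 0"
      using finite_fibre[of y] by simp
    then show False using v Y0[of y] order_root[of "p - smult y q" v] by (simp only: fibre_def mem_Collect_eq) simp
  qed
  have ordZ: "e_X v \<le> order v Z" if yR: "y \<in> R" and v: "v \<in> fibre y" for v y
  proof -
    have y: "y \<in> ram" using yR by (simp add: R_def)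
    note fv = fibre_point[OF y v]
    have deg2: "degree (p - smult y q) = 2"
      using sum_e_Y[OF y] sum_order_complex[OF Y0] k_eq_2 by (simp add: fibre_def)
    have c2: "coeff (p - smult y q) 2 \<noteq> 0" using deg2 Y0 by (metis leading_coeff_0_iff)
    \<comment> \<open>No pole of \<open>\<sigma>\<close> lies over \<open>y\<close>: there
      \<open>D\<close> equals \<open>q\<close> times the leading coefficient of the quadratic
      \<open>p - smult y q\<close>.\<close>
    have Dnz: "poly D w \<noteq> 0" if "poly q w \<noteq> 0" "poly p w = y * poly q w" for w
    proof -
      have "poly D w = poly q w * coeff (p - smult y q) 2"
        using lead[of w] that(2) by (simp add: D_def algebra_simps)
      then show ?thesis using that(1) c2 by simp
    qed
    have pv: "poly p v = y * poly q v" using fv(3,4) by (simp add: field_simps)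
    have Dv: "poly D v \<noteq> 0" by (rule Dnz[OF fv(3) pv])
    define v' where "v' = \<sigma> v"
    have eq: "p - smult y q = smult (poly D v / poly q v) ([:- v, 1:] * [:- v', 1:])"
    proof (rule poly_eq_if_infinite)
      have "poly (p - smult y q) z = poly (smult (poly D v / poly q v) ([:- v, 1:] * [:- v', 1:])) z" for z
      proof -
        have "poly q v * poly (p - smult y q) z = (z - v) * poly D v * (z - v')"
          using fact[OF Dv, of z] pv by (simp add: v'_def algebra_simps)
        then show ?thesis using fv(3) by (simp add: field_simps)
      qed
      then show "infinite {z. poly (p - smult y q) z =
          poly (smult (poly D v / poly q v) ([:- v, 1:] * [:- v', 1:])) z}"
        by (simp add: infinite_UNIV_char_0 del: poly_smult poly_mult poly_diff)
    qed
    have v': "v' \<in> fibre y" unfolding fibre_def eq by (simp del: mult_pCons_left mult_pCons_right)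
    note fv' = fibre_point[OF y v']
    have pv': "poly p v' = y * poly q v'" using fv'(3,4) by (simp add: field_simps)
    have Dv': "poly D v' \<noteq> 0" by (rule Dnz[OF fv'(3) pv'])
    have lin: "order w ([:- v, 1:] * [:- v', 1:]) = (if w = v then 1 else 0) + (if w = v' then 1 else 0)" for w
    proof -
      have "order w [:- t, 1:] = (if w = t then 1 else 0)" for t
        using order_power_n_n[of t 1] by (auto simp: order_0I)
      then show ?thesis by (subst order_mult) auto
    qed
    have lc: "poly D v / poly q v \<noteq> 0" using Dv fv(3) by simp
    \<comment> \<open>Both points of the fibre (possibly equal) have the same multiplicity under
      \<open>p / q\<close> and the same image under \<open>a / b\<close>, so the chain rule gives
      them the same multiplicity under \<open>a / b\<close>.\<close>
    have "order v (p - smult y q) = order v' (p - smult y q)"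
      unfolding eq order_smult[OF lc] lin by simp
    moreover have img: "img v' = img v" using img_dbl[OF yR] v v' by simp
    ultimately have "order (img v) (A - smult (val y) B) * e_X v = order (img v) (A - smult (val y) B) * e_X v'"
      using fv(8) fv'(8) by simp
    moreover have "order (img v) (A - smult (val y) B) \<noteq> 0"
      using fv(7) F0[of "val y"] order_root[of "A - smult (val y) B" "img v"] by metis
    ultimately have eX: "e_X v' = e_X v" by simp
    define u where "u = img v"
    have au: "a' - smult u b' = homog j (a - smult u b) N D" by (simp add: a'_def b'_def homog_fib)
    have ND0: "N - smult v' D \<noteq> 0"
    proof -
      have "coeff (N - smult v' D) 1 = - poly D v'" by (simp add: N_def D_def)
      then show ?thesis using Dv' by auto
    qed
    have "poly (N - smult v' D) v = 0" using Dv by (simp add: v'_def \<sigma>_def)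
    then have ord1: "1 \<le> order v (N - smult v' D)" using ND0 by (simp add: order_gt_0_iff Suc_le_eq)
    have "order v (a' - smult u b') = order v' (a - smult u b) * order v (N - smult v' D)"
      unfolding au using order_homog[OF Dv X0 degree_fib_le[OF X], of N u] ND0 by (simp add: v'_def \<sigma>_def)
    also have "order v' (a - smult u b) = e_X v" using eX img by (simp add: e_X_def u_def)
    finally have "e_X v \<le> order v (a' - smult u b')" using ord1 by simp
    then have 1: "[:- v, 1:] ^ e_X v dvd b * (a' - smult u b')"
      by (intro dvd_mult) (simp add: order_divides)
    have 2: "[:- v, 1:] ^ e_X v dvd (a - smult u b) * b'"
      by (intro dvd_mult2) (simp add: order_divides e_X_def u_def)
    \<comment> \<open>Subtracting the common value \<open>u\<close> exhibits \<open>Z\<close> as a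
      difference of two terms, each vanishing at \<open>v\<close> to order at least
      \<open>e_X v\<close>.\<close>
    have "Z = b * (a' - smult u b') - (a - smult u b) * b'" by (simp add: Z_def algebra_simps)
    then have "[:- v, 1:] ^ e_X v dvd Z" using dvd_diff[OF 1 2] by simp
    then show ?thesis using Z0 by (simp add: order_divides)
  qed
  have "(\<Sum>y\<in>R. e_G y) \<le> (\<Sum>y\<in>R. \<Sum>v\<in>fibre y. order v Z)"
  proof (rule sum_mono)
    fix y assume y: "y \<in> R"
    then have "e_G y \<le> (\<Sum>v\<in>fibre y. e_X v)"
      using sum_e_X_double_fibre[of y] img_dbl by (simp add: R_def)
    also have "\<dots> \<le> (\<Sum>v\<in>fibre y. order v Z)" using ordZ[OF y] by (rule sum_mono)
    finally show "e_G y \<le> (\<Sum>v\<in>fibre y. order v Z)" .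
  qed
  also have "\<dots> \<le> degree Z"
    by (rule sum_sum_order_le_degree[OF Z0 finR finite_fibre fibre_disjoint])
  finally have upper: "(\<Sum>y\<in>R. e_G y) \<le> 2 * j" using degZ by simp
  have "(\<Sum>y\<in>R. e_G y) = (\<Sum>y\<in>R. (e_G y - 1) + 1)"
    using e_G_ge2 by (intro sum.cong) (fastforce simp: R_def)+
  then have sumR: "(\<Sum>y\<in>R. e_G y) = (\<Sum>y\<in>R. e_G y - 1) + card R" by (simp only: sum.distrib card_eq_sum)
  have "(\<Sum>y\<in>ram - R. e_G y - 1) \<le> (\<Sum>y\<in>ram - R. (e_G y - 1) * (k - dbl_mult y))"
  proof (rule sum_mono)
    fix y assume "y \<in> ram - R"
    then have "1 \<le> k - dbl_mult y" using dbl_mult_le_2[of y] k_eq_2 by (auto simp: R_def)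
    then show "e_G y - 1 \<le> (e_G y - 1) * (k - dbl_mult y)" by simp
  qed
  also have "\<dots> \<le> (\<Sum>y\<in>ram. (e_G y - 1) * (k - dbl_mult y))"
    using finite_ram by (intro sum_mono2) auto
  also have "\<dots> \<le> 2 * j - 2" by (rule ramification_X)
  finally have rest: "(\<Sum>y\<in>ram - R. e_G y - 1) \<le> 2 * j - 2" .
  have "R \<subseteq> ram" by (auto simp: R_def)
  then have "(\<Sum>y\<in>ram. e_G y - 1) = (\<Sum>y\<in>ram - R. e_G y - 1) + (\<Sum>y\<in>R. e_G y - 1)"
    using finite_ram by (intro sum.subset_diff)
  then have lower: "2 * n - 2 \<le> (2 * j - 2) + (\<Sum>y\<in>R. e_G y - 1)"
    using sum_e_G rest by linarith
  \<comment> \<open>This yields \<open>2 * j \<le> n\<close>. If \<open>R\<close> were empty,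
    \<open>lower\<close> would read \<open>2 * n - 2 \<le> 2 * j - 2\<close>, which is impossible.
    Otherwise \<open>upper\<close> bounds the sum over \<open>R\<close> by
    \<open>2 * j - card R\<close>, so
    \<open>2 * n - 2 \<le> 4 * j - 2 - card R < 2 * n - 2\<close>.\<close>
  have "4 * j \<le> m * j" using m4 by simp
  then have jn: "2 * j \<le> n" using degrees k_eq_2 by simp
  then have "R \<noteq> {}" using lower n2 j1 by auto
  then have "card R \<ge> 1" using finR by (simp add: Suc_le_eq card_gt_0_iff)
  then show False using upper sumR lower jn n2 j1 by linarith
qed

end

section \<open>Decompositions of iterates\<close>

lemma finite_critical_values:
  assumes "reduced C E n" "n \<ge> 1"
  shows "finite {c. card (quot_map C E -` {c}) < n}"
proof -
  have "{c. card (quot_map C E -` {c}) < n} \<subseteq> insert None (Some ` {x. \<not> good_value C E n x})"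
  proof
    fix c assume c: "c \<in> {c. card (quot_map C E -` {c}) < n}"
    show "c \<in> insert None (Some ` {x. \<not> good_value C E n x})"
    proof (cases c)
      case (Some x)
      then have "\<not> good_value C E n x"
        using c card_vimage_Some[OF assms, of x] good_value_card[OF assms, of x] by auto
      then show ?thesis using Some by blast
    qed simp
  qed
  then show ?thesis using finite_bad_values[OF assms] finite_subset by blast
qed

section \<open>Moving infinity into general position\<close>

lemma ex_moebius_None: "\<exists>\<nu>. moebius \<nu> \<and> \<nu> None = s"
proof (cases s)
  case None
  have "moebius (quot_map [:0, 1:] [:1, 0:])" unfolding moebius_def by (intro exI[of _ 1] exI[of _ 0]) simp
  moreover have "quot_map [:0, 1:] [:1, 0:] None = s" using None by (simp add: quot_map_def)
  ultimately show ?thesis by blast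
next
  case (Some x)
  have "moebius (quot_map [:1, x:] [:0, 1:])"
    unfolding moebius_def by (rule exI[of _ x], rule exI[of _ 1], rule exI[of _ 1], rule exI[of _ 0]) simp
  moreover have "quot_map [:1, x:] [:0, 1:] None = s" using Some by (simp add: quot_map_def)
  ultimately show ?thesis by blast
qed

lemma moebius_conj:
  assumes F: "rational_function F" "rat_degree F \<ge> 1" and \<mu>: "moebius \<mu>" and \<nu>: "moebius \<nu>"
  shows "rational_function (inv \<mu> \<circ> F \<circ> \<nu>)" "rat_degree (inv \<mu> \<circ> F \<circ> \<nu>) = rat_degree F"
proof -
  note m = moebius_inverse(2)[OF \<mu>, unfolded moebius_iff] \<nu>[unfolded moebius_iff]
  have 1: "rational_function (inv \<mu> \<circ> F)" "rat_degree (inv \<mu> \<circ> F) = rat_degree F"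
    using rational_function_comp[of "inv \<mu>" F] m F by simp_all
  show "rational_function (inv \<mu> \<circ> F \<circ> \<nu>)" "rat_degree (inv \<mu> \<circ> F \<circ> \<nu>) = rat_degree F"
    using rational_function_comp[of "inv \<mu> \<circ> F" \<nu>] m 1 by simp_all
qed

lemma card_vimage_conj:
  assumes "bij \<mu>" "bij \<nu>"
  shows "card ((inv \<mu> \<circ> F \<circ> \<nu>) -` {c}) = card (F -` {\<mu> c})"
proof -
  have "inv \<mu> y = c \<longleftrightarrow> y = \<mu> c" for y using assms(1) by (metis bij_inv_eq_iff)
  then have "(inv \<mu> \<circ> F \<circ> \<nu>) -` {c} = \<nu> -` (F -` {\<mu> c})"
    unfolding vimage_def comp_def by blast
  also have "card \<dots> = card (F -` {\<mu> c})"
    using assms(2) by (intro card_vimage_inj) (auto simp: bij_def)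
  finally show ?thesis .
qed

lemma infinite_sphere: "infinite (UNIV :: sphere set)"
  by (simp add: infinite_UNIV_char_0)

lemma finite_vimage_rational_function:
  assumes "rational_function X" "rat_degree X \<ge> 1" "finite S"
  shows "finite (X -` S)"
  using assms rational_functionE finite_vimage_rational by metis

text \<open>Four spheres occur: the common source, the sources of \<open>F\<close> and
  \<open>G\<close>, and the common target. A Moebius map on each moves infinity to a generic point;
  degrees, fibre cardinalities and generic injectivity are unaffected.\<close>

lemma no_generically_injective_square:
  assumes F: "simple_rational F" "rat_degree F \<ge> 4" and G: "rational_function G" "rat_degree G \<ge> 2"
    and X: "rational_function X" "rat_degree X \<ge> 1" and Y: "rational_function Y" "rat_degree Y \<ge> 2"
    and comm: "F \<circ> X = G \<circ> Y" and inj: "gen_inj X Y"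
  shows False
proof -
  have rF: "rational_function F" using F(1) by (simp add: simple_rational_def)
  have dF: "rat_degree F \<ge> 1" and dG: "rat_degree G \<ge> 1" and dY: "rat_degree Y \<ge> 1" using F G Y by simp_all
  define V where "V = {c. card (G -` {c}) < rat_degree G}"
  have finV: "finite V"
  proof -
    obtain C E where "reduced C E (rat_degree G)" "G = quot_map C E" using rational_functionE[OF G(1)] .
    then show ?thesis using finite_critical_values dG V_def by metis
  qed
  obtain t0 where t0: "t0 \<notin> V" using finV infinite_sphere ex_new_if_finite by metis
  obtain x0 where x0: "x0 \<notin> F -` V"
    using finite_vimage_rational_function[OF rF dF finV] infinite_sphere ex_new_if_finite by metis
  \<comment> \<open>The point \<open>y0\<close> must also avoid the fibre over \<open>t0\<close>, so
    that the normalised \<open>G\<close> is finite at infinity.\<close>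
  have "finite (insert t0 V)" using finV by simp
  then obtain y0 where y0: "y0 \<notin> G -` (insert t0 V)"
    using finite_vimage_rational_function[OF G(1) dG] infinite_sphere ex_new_if_finite by metis
  obtain w0 where w0: "w0 \<notin> X -` (F -` V)"
    using finite_vimage_rational_function[OF X finite_vimage_rational_function[OF rF dF finV]]
      infinite_sphere ex_new_if_finite by metis
  obtain \<nu>t where \<nu>t: "moebius \<nu>t" "\<nu>t None = t0" using ex_moebius_None by blast
  obtain \<nu>x where \<nu>x: "moebius \<nu>x" "\<nu>x None = x0" using ex_moebius_None by blast
  obtain \<nu>y where \<nu>y: "moebius \<nu>y" "\<nu>y None = y0" using ex_moebius_None by blast
  obtain \<nu>w where \<nu>w: "moebius \<nu>w" "\<nu>w None = w0" using ex_moebius_None by blast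
  note bij = moebius_inverse(1)[OF \<nu>t(1)] moebius_inverse(1)[OF \<nu>x(1)]
    moebius_inverse(1)[OF \<nu>y(1)] moebius_inverse(1)[OF \<nu>w(1)]
  define F' X' G' Y' where "F' = inv \<nu>t \<circ> F \<circ> \<nu>x" and "X' = inv \<nu>x \<circ> X \<circ> \<nu>w"
    and "G' = inv \<nu>t \<circ> G \<circ> \<nu>y" and "Y' = inv \<nu>y \<circ> Y \<circ> \<nu>w"
  have r: "\<mu> (inv \<mu> z) = z" "inv \<mu> (\<mu> z) = z" if "bij \<mu>" for \<mu> :: "sphere \<Rightarrow> sphere" and z
    using that by (simp_all add: bij_inv_eq_iff bij_is_inj bij_is_surj surj_f_inv_f)
  note F' = moebius_conj[OF rF dF \<nu>t(1) \<nu>x(1), folded F'_def]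
  note X' = moebius_conj[OF X \<nu>x(1) \<nu>w(1), folded X'_def]
  note G' = moebius_conj[OF G(1) dG \<nu>t(1) \<nu>y(1), folded G'_def]
  note Y' = moebius_conj[OF Y(1) dY \<nu>y(1) \<nu>w(1), folded Y'_def]
  obtain A B where AB: "reduced A B (rat_degree F)" "F' = quot_map A B" using rational_functionE[OF F'(1)] F'(2) by metis
  obtain a b where ab: "reduced a b (rat_degree X)" "X' = quot_map a b" using rational_functionE[OF X'(1)] X'(2) by metis
  obtain C E where CE: "reduced C E (rat_degree G)" "G' = quot_map C E" using rational_functionE[OF G'(1)] G'(2) by metis
  obtain p q where pq: "reduced p q (rat_degree Y)" "Y' = quot_map p q" using rational_functionE[OF Y'(1)] Y'(2) by metis
  have "F' (X' w) = G' (Y' w)" for w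
    using fun_cong[OF comm, of "\<nu>w w"] by (simp add: F'_def X'_def G'_def Y'_def r bij)
  then have comm': "F' \<circ> X' = G' \<circ> Y'" by auto
  have inj': "gen_inj X' Y'"
  proof -
    have "finite (\<nu>w -` {w. \<exists>z. z \<noteq> w \<and> X z = X w \<and> Y z = Y w})"
      using inj bij(4) unfolding gen_inj_def by (intro finite_vimageI) (auto simp: bij_def)
    moreover have "{w. \<exists>z. z \<noteq> w \<and> X' z = X' w \<and> Y' z = Y' w} \<subseteq>
        \<nu>w -` {w. \<exists>z. z \<noteq> w \<and> X z = X w \<and> Y z = Y w}"
    proof
      fix w assume "w \<in> {w. \<exists>z. z \<noteq> w \<and> X' z = X' w \<and> Y' z = Y' w}"
      then obtain z where z: "z \<noteq> w" "X' z = X' w" "Y' z = Y' w" by blast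
      then have "\<nu>x (X' z) = \<nu>x (X' w)" "\<nu>y (Y' z) = \<nu>y (Y' w)" by simp_all
      then have "X (\<nu>w z) = X (\<nu>w w)" "Y (\<nu>w z) = Y (\<nu>w w)" by (simp_all add: X'_def Y'_def r bij)
      moreover have "\<nu>w z \<noteq> \<nu>w w" using z(1) bij(4) by (metis r(2))
      ultimately show "w \<in> \<nu>w -` {w. \<exists>z. z \<noteq> w \<and> X z = X w \<and> Y z = Y w}" by blast
    qed
    ultimately show ?thesis unfolding gen_inj_def using finite_subset by blast
  qed
  have simple': "rat_degree F - 1 \<le> card (F' -` {w})" for w
    using F(1) card_vimage_conj[OF bij(1,2)] by (simp add: F'_def simple_rational_def)
  have crit': "c \<noteq> None \<and> G' None \<noteq> c \<and> F' None \<noteq> c \<and> F' (X' None) \<noteq> c"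
    if c: "card (G' -` {c}) < rat_degree G" for c
  proof -
    have cV: "\<nu>t c \<in> V" using c card_vimage_conj[OF bij(1,3)] by (simp add: G'_def V_def)
    have "c \<noteq> None" using cV t0 \<nu>t(2) by metis
    moreover have "\<nu>t (G' None) = G y0" "\<nu>t (F' None) = F x0" "\<nu>t (F' (X' None)) = F (X w0)"
      by (simp_all add: G'_def F'_def X'_def r bij \<nu>y(2) \<nu>x(2) \<nu>w(2))
    ultimately show ?thesis using cV x0 y0 w0 by auto
  qed
  have inf': "G' None \<noteq> None"
  proof
    assume "G' None = None"
    then have "\<nu>t (G' None) = t0" using \<nu>t(2) by simp
    then show False using y0 by (simp add: G'_def r bij \<nu>y(2))
  qed
  show False
    by (rule normalised_square.contradiction[of A B C E a b p q "rat_degree F" "rat_degree G" "rat_degree X" "rat_degree Y"],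
        rule normalised_square.intro)
      (use AB(1) CE(1) ab(1) pq(1) F(2) G(2) X(2) Y(2) comm' inj' simple' crit' inf' in
        \<open>simp_all add: AB(2)[symmetric] CE(2)[symmetric] ab(2)[symmetric] pq(2)[symmetric]\<close>)
qed

text \<open>After cancelling the common right factor \<open>W\<close>, the remaining
  \<open>Y1\<close> cannot have degree at least two. So it is invertible and \<open>R\<close> is
  \<open>X1 \<circ> inv Y1\<close>.\<close>

lemma simple_left_factor:
  assumes F: "simple_rational F" "rat_degree F \<ge> 4" and G: "rational_function G" "rat_degree G \<ge> 2"
    and X: "rational_function X" "rat_degree X \<ge> 1" and Y: "rational_function Y" "rat_degree Y \<ge> 1"
    and comm: "F \<circ> X = G \<circ> Y"
  shows "\<exists>R. rational_function R \<and> X = R \<circ> Y \<and> G = F \<circ> R"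
proof -
  obtain W X1 Y1 where W: "rational_function W" "rat_degree W \<ge> 1" and X1: "rational_function X1" "rat_degree X1 \<ge> 1"
    and Y1: "rational_function Y1" "rat_degree Y1 \<ge> 1" and eq: "X = X1 \<circ> W" "Y = Y1 \<circ> W" and inj: "gen_inj X1 Y1"
    using gen_inj_factorisation[OF X Y] by blast
  have "surj W" using W rational_functionE surj_rational by metis
  have comm1: "F \<circ> X1 = G \<circ> Y1"
  proof
    fix z
    obtain w where "z = W w" using \<open>surj W\<close> by (metis surjD)
    then show "(F \<circ> X1) z = (G \<circ> Y1) z" using fun_cong[OF comm, of w] by (simp add: eq)
  qed
  have "\<not> rat_degree Y1 \<ge> 2"
    using no_generically_injective_square[OF F G X1 Y1(1) _ comm1 inj] by blast
  then have Y1m: "moebius Y1" using Y1 by (simp add: moebius_iff)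
  define R where "R = X1 \<circ> inv Y1"
  note bij = moebius_inverse[OF Y1m]
  have "rational_function R"
    unfolding R_def using rational_function_comp(1)[OF X1(1)] bij(2) by (simp add: moebius_iff)
  moreover have "X = R \<circ> Y"
    using bij(1) by (auto simp: eq R_def fun_eq_iff bij_is_inj inv_f_f)
  moreover have "G = F \<circ> R"
  proof
    fix y
    have "G y = G (Y1 (inv Y1 y))" using bij(1) by (simp add: bij_is_surj surj_f_inv_f)
    also have "\<dots> = F (X1 (inv Y1 y))" using fun_cong[OF comm1, of "inv Y1 y"] by simp
    finally show "G y = (F \<circ> R) y" by (simp add: R_def)
  qed
  ultimately show ?thesis by blast
qed

lemma rational_function_fold:
  assumes "\<forall>G\<in>set Fs. rational_function G \<and> 2 \<le> rat_degree G"
  shows "rational_function (fold (\<circ>) Fs id) \<and> rat_degree (fold (\<circ>) Fs id) \<ge> 1 \<and>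
    (Fs \<noteq> [] \<longrightarrow> rat_degree (fold (\<circ>) Fs id) \<ge> 2)"
  using assms
proof (induction Fs rule: rev_induct)
  case Nil
  then show ?case using moebius_id unfolding moebius_iff by (simp add: id_def)
next
  case (snoc H Gs)
  have "\<forall>G\<in>set Gs. rational_function G \<and> 2 \<le> rat_degree G"
    and H: "rational_function H" "2 \<le> rat_degree H" using snoc.prems by simp_all
  then have IH: "rational_function (fold (\<circ>) Gs id)" "rat_degree (fold (\<circ>) Gs id) \<ge> 1"
    using snoc.IH by blast+
  have "2 * 1 \<le> rat_degree H * rat_degree (fold (\<circ>) Gs id)" using IH H by (intro mult_mono) auto
  moreover have "fold (\<circ>) (Gs @ [H]) id = H \<circ> fold (\<circ>) Gs id" by simp
  ultimately show ?case using rational_function_comp[OF H(1) IH] H(2) IH(2) by (simp only:) auto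
qed

lemma rational_function_funpow:
  assumes "rational_function F" "rat_degree F \<ge> 1"
  shows "rational_function (F ^^ l) \<and> rat_degree (F ^^ l) = rat_degree F ^ l"
proof (induction l)
  case 0
  then show ?case using moebius_id unfolding moebius_iff by (simp add: id_def)
next
  case (Suc l)
  have "F ^^ Suc l = F \<circ> F ^^ l" by simp
  moreover have "rat_degree (F ^^ l) \<ge> 1" using Suc assms(2) by simp
  ultimately show ?case
    using rational_function_comp[OF assms(1), of "F ^^ l"] Suc by (simp only: power_Suc)
qed

text \<open>\<open>M\<close> is carried for the induction: splitting off the outermost factor
  \<open>H\<close>, the last list entry, gives \<open>M \<circ> H = F \<circ> R\<close>, and
  \<open>F ^^ l\<close> is \<open>R\<close> composed with the remaining factors. As \<open>H\<close>
  is indecomposable and \<open>F\<close> is not of degree one, \<open>R\<close> is again a Moebius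
  map and takes the place of \<open>M\<close>.\<close>

lemma iterate_decomposition:
  assumes F: "simple_rational F" "rat_degree F \<ge> 4"
    and "moebius M" "F ^^ l = M \<circ> fold (\<circ>) Fs id" "\<forall>G\<in>set Fs. indecomposable G"
  shows "length Fs = l \<and> (\<exists>\<mu>. \<mu> l = M \<and> \<mu> 0 = id \<and> (\<forall>i\<le>l. moebius (\<mu> i)) \<and>
    (\<forall>i<l. \<mu> (Suc i) \<circ> Fs ! i = F \<circ> \<mu> i))"
  using assms(3-)
proof (induction l arbitrary: M Fs)
  case 0
  have Fs: "\<forall>G\<in>set Fs. rational_function G \<and> 2 \<le> rat_degree G"
    using "0.prems"(3) by (auto simp: indecomposable_def)
  have "Fs = []"
  proof (rule ccontr)
    assume "Fs \<noteq> []"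
    then have "rational_function (fold (\<circ>) Fs id)" "rat_degree (fold (\<circ>) Fs id) \<ge> 2"
      using rational_function_fold[OF Fs] by auto
    then have "rat_degree (M \<circ> fold (\<circ>) Fs id) \<ge> 2"
      using rational_function_comp(2)[of M "fold (\<circ>) Fs id"] "0.prems"(1) by (simp add: moebius_iff)
    moreover have "M \<circ> fold (\<circ>) Fs id = id" using "0.prems"(2) by (simp only: funpow.simps(1))
    ultimately show False using moebius_id by (simp add: moebius_iff)
  qed
  then show ?case using 0 by (auto intro!: exI[of _ "\<lambda>_. id"] simp: moebius_id)
next
  case (Suc l)
  have rF: "rational_function F" "rat_degree F \<ge> 1" using F by (simp_all add: simple_rational_def)
  have Fs: "\<forall>G\<in>set Fs. rational_function G \<and> 2 \<le> rat_degree G"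
    using Suc.prems(3) by (auto simp: indecomposable_def)
  note rFl = rational_function_funpow[OF rF]
  have M: "rational_function M" "rat_degree M = 1" using Suc.prems(1) by (simp_all add: moebius_iff)
  have "Fs \<noteq> []"
  proof
    assume "Fs = []"
    then have "F ^^ Suc l = M" unfolding Suc.prems(2) by simp
    then have "rat_degree (F ^^ Suc l) = 1" using M by (simp only:)
    moreover have "rat_degree F ^ Suc l \<ge> 4 * 1" using F(2) by (simp only: power_Suc) (intro mult_mono, auto)
    ultimately show False using rFl[of "Suc l"] by simp
  qed
  then obtain Gs H where Fs_eq: "Fs = Gs @ [H]" by (metis rev_exhaust)
  have H: "rational_function H" "rat_degree H \<ge> 2" "indecomposable H" using Fs Suc.prems(3) Fs_eq by auto
  have Gs: "\<forall>G\<in>set Gs. rational_function G \<and> 2 \<le> rat_degree G" using Fs Fs_eq by auto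
  have MH: "rational_function (M \<circ> H)" "rat_degree (M \<circ> H) \<ge> 2"
    using rational_function_comp[of M H] M H by simp_all
  have "fold (\<circ>) Fs id = H \<circ> fold (\<circ>) Gs id" by (simp add: Fs_eq)
  then have "F \<circ> F ^^ l = (M \<circ> H) \<circ> fold (\<circ>) Gs id"
    using Suc.prems(2) by (simp only: funpow.simps(2) comp_assoc)
  then obtain R where R: "rational_function R" "F ^^ l = R \<circ> fold (\<circ>) Gs id" "M \<circ> H = F \<circ> R"
    using simple_left_factor[OF F MH _ _ _ _] rFl[of l] rational_function_fold[OF Gs] rF(2) by fastforce
  have invM: "rational_function (inv M)" "rat_degree (inv M) = 1"
    using moebius_inverse(2)[OF Suc.prems(1)] by (simp_all add: moebius_iff)
  have Heq: "H = (inv M \<circ> F) \<circ> R"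
  proof
    fix z
    have "H z = inv M ((M \<circ> H) z)" using moebius_inverse(1)[OF Suc.prems(1)] by (simp add: bij_is_inj inv_f_f)
    then show "H z = ((inv M \<circ> F) \<circ> R) z" by (simp add: R(3))
  qed
  have "rational_function (inv M \<circ> F)" "rat_degree (inv M \<circ> F) = rat_degree F"
    using rational_function_comp[OF invM(1) rF] invM(2) by simp_all
  then have "rat_degree R = 1"
    using H(3) Heq R(1) F(2) unfolding indecomposable_def by (metis One_nat_def numeral_le_one_iff semiring_norm(69))
  then have Rm: "moebius R" using R(1) by (simp add: moebius_iff)
  have "\<forall>G\<in>set Gs. indecomposable G" using Suc.prems(3) Fs_eq by auto
  from Suc.IH[OF Rm R(2) this] obtain \<mu> where len: "length Gs = l" and
    \<mu>: "\<mu> l = R" "\<mu> 0 = id" "\<forall>i\<le>l. moebius (\<mu> i)" "\<forall>i<l. \<mu> (Suc i) \<circ> Gs ! i = F \<circ> \<mu> i"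
    by blast
  define \<mu>' where "\<mu>' = \<mu>(Suc l := M)"
  have "\<mu>' (Suc i) \<circ> Fs ! i = F \<circ> \<mu>' i" if "i < Suc l" for i
    using that \<mu> len R(3) by (cases "i = l") (auto simp: \<mu>'_def Fs_eq nth_append)
  moreover have "moebius (\<mu>' i)" if "i \<le> Suc l" for i
    using that \<mu>(3) Suc.prems(1) by (auto simp: \<mu>'_def)
  ultimately show ?case using len Fs_eq \<mu>(2) by (intro conjI exI[of _ \<mu>']) (auto simp: \<mu>'_def)
qed

theorem theorem1p1:
  fixes F :: "sphere \<Rightarrow> sphere" and m l :: nat and Fs :: "(sphere \<Rightarrow> sphere) list"
  assumes "simple_rational F"
    and "rat_degree F = m"
    and "m \<ge> 4"
    and "l \<ge> 1"
    and "decomposition (F ^^ l) Fs"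
    and "\<forall>G\<in>set Fs. indecomposable G"
  shows "equivalent_decompositions (F ^^ l) Fs (replicate l F)"
proof -
  have "F ^^ l = id \<circ> fold (\<circ>) Fs id" using assms(5) by (simp add: decomposition_def)
  then obtain \<mu> where len: "length Fs = l" and
    \<mu>: "\<mu> l = id" "\<mu> 0 = id" "\<forall>i\<le>l. moebius (\<mu> i)" "\<forall>i<l. \<mu> (Suc i) \<circ> Fs ! i = F \<circ> \<mu> i"
    using iterate_decomposition[OF assms(1) _ moebius_id _ assms(6)] assms(2,3) by blast
  have "fold (\<circ>) (replicate k F) id = F ^^ k" for k
  proof (induction k)
    case (Suc k)
    have "replicate (Suc k) F = replicate k F @ [F]" by (simp add: replicate_append_same)
    then show ?case using Suc by simp
  qed simp
  then have dec: "decomposition (F ^^ l) (replicate l F)"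
    using assms(1,4) by (simp add: decomposition_def simple_rational_def)
  \<comment> \<open>With the identity as \<open>\<mu> 0\<close> and \<open>\<mu> l\<close>, this one
    formula covers the first, middle and last conditions of equivalence.\<close>
  have step: "Fs ! i = inv (\<mu> (Suc i)) \<circ> F \<circ> \<mu> i" if "i < l" for i
  proof
    fix z
    have "bij (\<mu> (Suc i))" using \<mu>(3) that moebius_inverse(1) by simp
    then have "(Fs ! i) z = inv (\<mu> (Suc i)) ((\<mu> (Suc i) \<circ> Fs ! i) z)" by (simp add: bij_is_inj inv_f_f)
    then show "(Fs ! i) z = (inv (\<mu> (Suc i)) \<circ> F \<circ> \<mu> i) z" using \<mu>(4) that by simp
  qed
  show ?thesis
  proof (cases "l = 1")
    case True
    then show ?thesis
      using step[of 0] \<mu>(1,2) dec assms(5) len by (simp add: equivalent_decompositions_def)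
  next
    case False
    then have l2: "l \<ge> 2" using assms(4) by simp
    have "Fs ! (l - 1) = F \<circ> \<mu> (l - 1)" using step[of "l - 1"] \<mu>(1) l2 by simp
    moreover have "Fs ! 0 = inv (\<mu> 1) \<circ> F" using step[of 0] \<mu>(2) l2 by simp
    moreover have "Fs ! (i - 1) = inv (\<mu> i) \<circ> F \<circ> \<mu> (i - 1)" if "1 < i" "i < l" for i
      using step[of "i - 1"] that by simp
    ultimately show ?thesis
      using \<mu>(3) l2 dec assms(5) len
      by (auto simp: equivalent_decompositions_def Let_def intro!: exI[of _ \<mu>])
  qed
qed

end
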